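(* Consider a regularity structure $(\mathcal A,\mathcal T,\mathcal G)$ with a model $(\Pi,\Gamma)$, endowed with a product $\star\colon V\times\overline V\to\mathcal T$ between two sectors $V,\overline V$. Let $1\le p_1,p_2<\infty$, $1\le q_1,q_2\le\infty$, $\gamma_1,\gamma_2>0$, $\alpha_1,\alpha_2\in\mathbf R$, and set $$\alpha=\alpha_1+\alpha_2,\quad\gamma=(\gamma_1+\alpha_2)\wedge(\gamma_2+\alpha_1),\quad p=\frac{p_1p_2}{p_1+p_2},\quad q=q_1\vee q_2.$$ Assume $p\ge1$, $\gamma>0$ and $\gamma_1,\gamma_2,\gamma\notin\mathcal A$. Then for any $f\in\mathcal F^{\gamma_1,\alpha_1}_{p_1,q_1}$ with values in $V$ and any $g\in\mathcal F^{\gamma_2,\alpha_2}_{p_2,q_2}$ with values in $\overline V$, the pointwise product $fg(x):=f(x)\star g(x)$ (where contributions of homogeneity $\ge\gamma$ are set to zero) lies in $\mathcal F^{\gamma,\alpha}_{p,q}$, and $$\|fg\|_{\mathcal F^\gamma_{p,q}}\lesssim\|f\|_{\mathcal F^{\gamma_1}_{p_1,q_1}}\|g\|_{\mathcal F^{\gamma_2}_{p_2,q_2}},$$ with a constant independent of $f$ and $g$.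
   Context: Basic notation. Fix $d\ge1$ and a scaling $\mathfrak s=(\mathfrak s_1,\dots,\mathfrak s_d)$ of positive integers; $|\mathfrak s|=\sum_i\mathfrak s_i$, $\|x\|_{\mathfrak s}=\max_i|x_i|^{1/\mathfrak s_i}$, $Q(x,R)=\{y\in\mathbf R^d:\|y-x\|_{\mathfrak s}\le R\}$, $|k|_{\mathfrak s}=\sum_ik_i\mathfrak s_i$. $L^p=L^p(\mathbf R^d,dx)$, $L^q_\lambda=L^q((0,1],\lambda^{-1}d\lambda)$. $\eta^\lambda_x(z)=\lambda^{-|\mathfrak s|}\eta(\lambda^{-\mathfrak s_1}(z_1-x_1),\dots,\lambda^{-\mathfrak s_d}(z_d-x_d))$. $\mathfrak B^r$ is the set of $\eta\in\mathcal C^\infty(\mathbf R^d)$ supported in $Q(0,1)$ with $\mathcal C^r$-norm (involving derivatives $D^k$, $|k|_{\mathfrak s}\le r$) at most $1$. Regularity structure. A triple $(\mathcal A,\mathcal T,\mathcal G)$: $\mathcal A\subset\mathbf R$ bounded below and locally finite; $\mathcal T=\bigoplus_{\zeta\in\mathcal A}\mathcal T_\zeta$ with Banach spaces $\mathcal T_\zeta$ (with $\mathcal T_\zeta=\{0\}$ for $\zeta\notin\mathcal A$); $\mathcal G$ a group of linear maps on $\mathcal T$ with $\Gamma\tau-\tau\in\bigoplus_{\beta\in\mathcal A,\beta<\zeta}\mathcal T_\beta$ for $\tau\in\mathcal T_\zeta$. $\mathcal Q_\zeta$ is the projection onto $\mathcal T_\zeta$, $|\tau|_\zeta=\|\mathcal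 Q_\zeta\tau\|_{\mathcal T_\zeta}$, $\mathcal A_\gamma=\mathcal A\cap(-\infty,\gamma)$, $\mathcal T^-_\gamma=\bigoplus_{\beta\in\mathcal A_\gamma}\mathcal T_\beta$. Model. A pair $(\Pi,\Gamma)$: continuous linear maps $\Pi_x:\mathcal T\to\mathcal D'(\mathbf R^d)$ and $\Gamma:\mathbf R^d\times\mathbf R^d\to\mathcal G$ with $\Gamma_{x,x}=1$, $\Gamma_{x,z}\Gamma_{z,y}=\Gamma_{x,y}$, $\Pi_y=\Pi_x\Gamma_{x,y}$, such that for every $\gamma>0$ (with $r$ the smallest positive integer larger than $|\min\mathcal A|\vee|\max\mathcal A_\gamma|$): $|\langle\Pi_x\tau,\eta^\lambda_x\rangle|\lesssim|\tau|_\zeta\lambda^\zeta$ and $|\Gamma_{x,y}\tau|_\beta\lesssim|\tau|_\zeta\|x-y\|_{\mathfrak s}^{\zeta-\beta}$, uniformly over $x\in\mathbf R^d$, $y\in Q(x,1)$, $\eta\in\mathfrak B^r$, $\lambda\in(0,1]$, $\zeta\in\mathcal A_\gamma$, $\tau\in\mathcal T_\zeta$, $\beta\in\mathcal A$ with $\beta\le\zeta$. Sector. $V\subset\mathcal T$ is a sector if $\Gamma\tau\in V$ for all $\tau\in V$, $\Gamma\in\mathcal G$, and $V=\bigoplus_{a\in\mathcal A}V_a$ with $V_a\subset\mathcal T_a$. Product. A product between sectors $V,\overline V$ is a map $\star:V\times\overline V\to\mathcal T$ whose restriction to $V_a\times\overline V_b$ is, for all $a,b\in\mathcal A$, a continuous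 bilinear map into $\mathcal T_{a+b}$, and such that $\Gamma(\tau\star\bar\tau)=\Gamma\tau\star\Gamma\bar\tau$ for all $\Gamma\in\mathcal G$, $\tau\in V_a$, $\bar\tau\in\overline V_b$. Spaces. $\mathcal F^\gamma_{p,q}$ is the Banach space of $f:\mathbf R^d\to\mathcal T^-_\gamma$ with finite norm $$\|f\|_{\mathcal F^\gamma_{p,q}}=\sup_{\zeta\in\mathcal A_\gamma}\big\||f(x)|_\zeta\big\|_{L^p}+\sup_{\zeta\in\mathcal A_\gamma}\bigg\|\Big\|\frac1{|Q(0,4\lambda)|}\int_{Q(0,4\lambda)}\frac{|f(x+h)-\Gamma_{x+h,x}f(x)|_\zeta}{\lambda^{\gamma-\zeta}}\,dh\Big\|_{L^q_\lambda}\bigg\|_{L^p}.$$ $\mathcal F^{\gamma,\alpha}_{p,q}$ is the set of $f\in\mathcal F^\gamma_{p,q}$ taking values in $\mathcal T_{\ge\alpha}=\bigoplus_{\zeta\in\mathcal A,\zeta\ge\alpha}\mathcal T_\zeta$. *)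

theory Defs
  imports "HOL-Analysis.Analysis" "HOL-Probability.Essential_Supremum"
begin

section \<open>Scaled Euclidean space\<close>

type_synonym 'd scaling = "'d \<Rightarrow> nat"

definition scal_size :: "('d::finite) scaling \<Rightarrow> nat" where
  "scal_size s = (\<Sum>i\<in>UNIV. s i)"

definition snorm :: "('d::finite) scaling \<Rightarrow> real^'d \<Rightarrow> real" where
  "snorm s x = Max (range (\<lambda>i. \<bar>x $ i\<bar> powr (1 / real (s i))))"

definition sball :: "('d::finite) scaling \<Rightarrow> real^'d \<Rightarrow> real \<Rightarrow> (real^'d) set" where
  "sball s x R = {y. snorm s (y - x) \<le> R}"

text \<open>Real powers of non-negative reals with the convention \<open>0\<^sup>0 = 1\<close>, whereas
  \<^term>\<open>(0::real) powr 0\<close> is \<^term>\<open>0::real\<close>.\<close>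

definition rpow :: "real \<Rightarrow> real \<Rightarrow> real" where
  "rpow a b = (if b = 0 then 1 else a powr b)"


section \<open>Smooth functions, test functions and distributions\<close>

definition partial :: "'d \<Rightarrow> (real^('d::finite) \<Rightarrow> real) \<Rightarrow> real^'d \<Rightarrow> real" where
  "partial i f x = frechet_derivative f (at x) (axis i 1)"

text \<open>A multi-index \<open>k\<close> is represented by any list in which each direction \<open>i\<close> occurs \<open>k\<^sub>i\<close>
  times; for smooth functions the order of the partial derivatives is irrelevant.\<close>

definition partials :: "'d list \<Rightarrow> (real^('d::finite) \<Rightarrow> real) \<Rightarrow> real^'d \<Rightarrow> real" where
  "partials k f = foldr partial k f"

definition sdegree :: "'d scaling \<Rightarrow> 'd list \<Rightarrow> nat" where
  "sdegree s k = (\<Sum>i\<leftarrow>k. s i)"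

definition smooth :: "(real^('d::finite) \<Rightarrow> real) \<Rightarrow> bool" where
  "smooth f \<longleftrightarrow> (\<forall>k. partials k f differentiable_on UNIV)"

definition supp :: "(real^('d::finite) \<Rightarrow> real) \<Rightarrow> (real^'d) set" where
  "supp f = closure {x. f x \<noteq> 0}"

definition Cr_norm :: "('d::finite) scaling \<Rightarrow> nat \<Rightarrow> (real^'d \<Rightarrow> real) \<Rightarrow> ennreal" where
  "Cr_norm s r f = (SUP k\<in>{k. sdegree s k \<le> r}. SUP x. ennreal \<bar>partials k f x\<bar>)"

definition test_functions :: "(real^('d::finite) \<Rightarrow> real) set" where
  "test_functions = {f. smooth f \<and> compact (supp f)}"

definition Br :: "('d::finite) scaling \<Rightarrow> nat \<Rightarrow> (real^'d \<Rightarrow> real) set" where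
  "Br s r = {f. smooth f \<and> supp f \<subseteq> sball s 0 1 \<and> Cr_norm s r f \<le> 1}"

definition rescale :: "('d::finite) scaling \<Rightarrow> (real^'d \<Rightarrow> real) \<Rightarrow> real \<Rightarrow> real^'d \<Rightarrow> real^'d \<Rightarrow> real" where
  "rescale s f l x z =
     f (\<chi> i. (z $ i - x $ i) / l ^ s i) / l ^ scal_size s"

text \<open>Only the values on \<^const>\<open>test_functions\<close> are relevant.  Continuity is the usual seminorm
  criterion on each space of test functions supported in a fixed compact set; the scaling
  \<open>\<lambda>_. 1\<close> makes \<^const>\<open>Cr_norm\<close> the ordinary \<open>C\<^sup>N\<close> norm.\<close>

definition distribution :: "((real^('d::finite) \<Rightarrow> real) \<Rightarrow> real) \<Rightarrow> bool" where
  "distribution u \<longleftrightarrow>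
     (\<forall>f\<in>test_functions. \<forall>g\<in>test_functions. u (\<lambda>x. f x + g x) = u f + u g) \<and>
     (\<forall>f\<in>test_functions. \<forall>c. u (\<lambda>x. c * f x) = c * u f) \<and>
     (\<forall>K. compact K \<longrightarrow> (\<exists>C::real. \<exists>N. \<forall>f\<in>test_functions. supp f \<subseteq> K \<longrightarrow>
        ennreal \<bar>u f\<bar> \<le> ennreal C * Cr_norm (\<lambda>_. 1) N f))"


section \<open>Regularity structures\<close>

text \<open>The type \<^typ>\<open>'t\<close> is the whole space \<open>\<T>\<close>; the homogeneous components are subspaces of it,
  each with its own norm.  Only the values of \<open>homnorm R \<zeta>\<close> on \<open>homspace R \<zeta>\<close> matter.\<close>

record 't reg_structure =
  homs :: "real set"
  homspace :: "real \<Rightarrow> 't set"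
  homnorm :: "real \<Rightarrow> 't \<Rightarrow> real"
  sgroup :: "('t \<Rightarrow> 't) set"

definition hsum :: "('t::real_vector) reg_structure \<Rightarrow> real set \<Rightarrow> 't set" where
  "hsum R B = span (\<Union>\<zeta>\<in>homs R \<inter> B. homspace R \<zeta>)"

definition banach_subspace :: "('t::real_vector) set \<Rightarrow> ('t \<Rightarrow> real) \<Rightarrow> bool" where
  "banach_subspace S N \<longleftrightarrow>
     subspace S \<and>
     (\<forall>\<tau>\<in>S. 0 \<le> N \<tau> \<and> (N \<tau> = 0 \<longleftrightarrow> \<tau> = 0)) \<and>
     (\<forall>\<tau>\<in>S. \<forall>c. N (c *\<^sub>R \<tau>) = \<bar>c\<bar> * N \<tau>) \<and>
     (\<forall>\<sigma>\<in>S. \<forall>\<tau>\<in>S. N (\<sigma> + \<tau>) \<le> N \<sigma> + N \<tau>) \<and>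
     Metric_space.mcomplete S (\<lambda>\<sigma> \<tau>. N (\<sigma> - \<tau>))"

definition regularity_structure :: "('t::real_vector) reg_structure \<Rightarrow> bool" where
  "regularity_structure R \<longleftrightarrow>
     bdd_below (homs R) \<and> (\<forall>a b. finite (homs R \<inter> {a..b})) \<and>
     (\<forall>\<zeta>. banach_subspace (homspace R \<zeta>) (homnorm R \<zeta>)) \<and>
     (\<forall>\<zeta>. \<zeta> \<notin> homs R \<longrightarrow> homspace R \<zeta> = {0}) \<and>
     hsum R UNIV = UNIV \<and>
     (\<forall>\<zeta>\<in>homs R. homspace R \<zeta> \<inter> hsum R (- {\<zeta>}) = {0}) \<and>
     (\<forall>\<Gamma>\<in>sgroup R. linear \<Gamma>) \<and>
     id \<in> sgroup R \<and>
     (\<forall>\<Gamma>\<in>sgroup R. \<forall>\<Delta>\<in>sgroup R. \<Gamma> \<circ> \<Delta> \<in> sgroup R) \<and>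
     (\<forall>\<Gamma>\<in>sgroup R. bij \<Gamma> \<and> inv \<Gamma> \<in> sgroup R) \<and>
     (\<forall>\<Gamma>\<in>sgroup R. \<forall>\<zeta>\<in>homs R. \<forall>\<tau>\<in>homspace R \<zeta>. \<Gamma> \<tau> - \<tau> \<in> hsum R {..<\<zeta>})"

definition hproj :: "('t::real_vector) reg_structure \<Rightarrow> real \<Rightarrow> 't \<Rightarrow> 't" where
  "hproj R \<zeta> \<tau> = (THE \<sigma>. \<sigma> \<in> homspace R \<zeta> \<and> \<tau> - \<sigma> \<in> hsum R (- {\<zeta>}))"

definition hsize :: "('t::real_vector) reg_structure \<Rightarrow> real \<Rightarrow> 't \<Rightarrow> real" where
  "hsize R \<zeta> \<tau> = homnorm R \<zeta> (hproj R \<zeta> \<tau>)"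

definition homs_below :: "'t reg_structure \<Rightarrow> real \<Rightarrow> real set" where
  "homs_below R \<gamma> = homs R \<inter> {..<\<gamma>}"


section \<open>Models\<close>

text \<open>For a regularity structure, a nonempty \<open>homs R\<close> has a minimum, which is its \<open>Inf\<close>, and
  \<open>homs_below R \<gamma>\<close> is finite.  If the latter is empty, the value below is irrelevant, since the
  analytic bounds of order \<open>\<gamma>\<close> are then void.\<close>

definition test_order :: "'t reg_structure \<Rightarrow> real \<Rightarrow> nat" where
  "test_order R \<gamma> =
     (LEAST r. 0 < r \<and> max \<bar>Inf (homs R)\<bar> \<bar>Max (homs_below R \<gamma>)\<bar> < real r)"

text \<open>\<open>\<T>\<close> carries the direct sum topology and the space of distributions the topology of
  pointwise convergence, so that a linear map \<open>P\<close> between them is continuous iff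
  \<open>\<tau> \<mapsto> P \<tau> f\<close> is bounded on every homogeneous component for every test function \<open>f\<close>.  By
  uniform boundedness the strong topology on distributions yields the same maps.\<close>

definition continuous_linear_to_distributions ::
  "('t::real_vector) reg_structure \<Rightarrow> ('t \<Rightarrow> (real^('d::finite) \<Rightarrow> real) \<Rightarrow> real) \<Rightarrow> bool" where
  "continuous_linear_to_distributions R P \<longleftrightarrow>
     (\<forall>\<tau>. distribution (P \<tau>)) \<and>
     (\<forall>f\<in>test_functions. linear (\<lambda>\<tau>. P \<tau> f)) \<and>
     (\<forall>f\<in>test_functions. \<forall>\<zeta>\<in>homs R. \<exists>C. \<forall>\<tau>\<in>homspace R \<zeta>. \<bar>P \<tau> f\<bar> \<le> C * homnorm R \<zeta> \<tau>)"

definition model ::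
  "('t::real_vector) reg_structure \<Rightarrow> ('d::finite) scaling \<Rightarrow>
   (real^'d \<Rightarrow> 't \<Rightarrow> (real^'d \<Rightarrow> real) \<Rightarrow> real) \<Rightarrow> (real^'d \<Rightarrow> real^'d \<Rightarrow> 't \<Rightarrow> 't) \<Rightarrow> bool" where
  "model R s \<pi> \<Gamma> \<longleftrightarrow>
     (\<forall>x. continuous_linear_to_distributions R (\<pi> x)) \<and>
     (\<forall>x y. \<Gamma> x y \<in> sgroup R) \<and>
     (\<forall>x. \<Gamma> x x = id) \<and>
     (\<forall>x y z. \<Gamma> x z \<circ> \<Gamma> z y = \<Gamma> x y) \<and>
     (\<forall>x y \<tau>. \<forall>f\<in>test_functions. \<pi> y \<tau> f = \<pi> x (\<Gamma> x y \<tau>) f) \<and>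
     (\<forall>\<gamma>>0. \<exists>C. \<forall>x. \<forall>\<zeta>\<in>homs_below R \<gamma>. \<forall>\<tau>\<in>homspace R \<zeta>.
        (\<forall>f\<in>Br s (test_order R \<gamma>). \<forall>l\<in>{0<..1}.
           \<bar>\<pi> x \<tau> (rescale s f l x)\<bar> \<le> C * hsize R \<zeta> \<tau> * l powr \<zeta>) \<and>
        (\<forall>y\<in>sball s x 1. \<forall>\<beta>\<in>homs R. \<beta> \<le> \<zeta> \<longrightarrow>
           hsize R \<beta> (\<Gamma> x y \<tau>) \<le> C * hsize R \<zeta> \<tau> * rpow (snorm s (x - y)) (\<zeta> - \<beta>)))"


section \<open>Sectors and products\<close>

text \<open>The components of a sector are necessarily \<open>V\<^sub>a = V \<inter> \<T>\<^sub>a\<close>.\<close>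

definition sector :: "('t::real_vector) reg_structure \<Rightarrow> 't set \<Rightarrow> bool" where
  "sector R V \<longleftrightarrow>
     V = span (\<Union>a\<in>homs R. V \<inter> homspace R a) \<and>
     (\<forall>\<Gamma>\<in>sgroup R. \<forall>\<tau>\<in>V. \<Gamma> \<tau> \<in> V)"

text \<open>Bilinearity is required on all of \<open>V \<times> W\<close>: this is how the maps on the pairs of
  components determine the product of non-homogeneous elements.\<close>

definition sector_product ::
  "('t::real_vector) reg_structure \<Rightarrow> 't set \<Rightarrow> 't set \<Rightarrow> ('t \<Rightarrow> 't \<Rightarrow> 't) \<Rightarrow> bool" where
  "sector_product R V W star \<longleftrightarrow>
     (\<forall>\<sigma>\<in>V. \<forall>\<tau>\<in>V. \<forall>\<rho>\<in>W. star (\<sigma> + \<tau>) \<rho> = star \<sigma> \<rho> + star \<tau> \<rho>) \<and>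
     (\<forall>\<rho>\<in>V. \<forall>\<sigma>\<in>W. \<forall>\<tau>\<in>W. star \<rho> (\<sigma> + \<tau>) = star \<rho> \<sigma> + star \<rho> \<tau>) \<and>
     (\<forall>c. \<forall>\<sigma>\<in>V. \<forall>\<tau>\<in>W. star (c *\<^sub>R \<sigma>) \<tau> = c *\<^sub>R star \<sigma> \<tau> \<and> star \<sigma> (c *\<^sub>R \<tau>) = c *\<^sub>R star \<sigma> \<tau>) \<and>
     (\<forall>a\<in>homs R. \<forall>b\<in>homs R.
        (\<forall>\<sigma>\<in>V \<inter> homspace R a. \<forall>\<tau>\<in>W \<inter> homspace R b. star \<sigma> \<tau> \<in> homspace R (a + b)) \<and>
        (\<exists>C. \<forall>\<sigma>\<in>V \<inter> homspace R a. \<forall>\<tau>\<in>W \<inter> homspace R b.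
           homnorm R (a + b) (star \<sigma> \<tau>) \<le> C * homnorm R a \<sigma> * homnorm R b \<tau>) \<and>
        (\<forall>\<Gamma>\<in>sgroup R. \<forall>\<sigma>\<in>V \<inter> homspace R a. \<forall>\<tau>\<in>W \<inter> homspace R b.
           \<Gamma> (star \<sigma> \<tau>) = star (\<Gamma> \<sigma>) (\<Gamma> \<tau>)))"

definition truncate :: "('t::real_vector) reg_structure \<Rightarrow> real \<Rightarrow> 't \<Rightarrow> 't" where
  "truncate R \<gamma> \<tau> = (\<Sum>\<zeta>\<in>homs_below R \<gamma>. hproj R \<zeta> \<tau>)"

definition trunc_product ::
  "('t::real_vector) reg_structure \<Rightarrow> ('t \<Rightarrow> 't \<Rightarrow> 't) \<Rightarrow> real \<Rightarrow>
   (real^'d \<Rightarrow> 't) \<Rightarrow> (real^'d \<Rightarrow> 't) \<Rightarrow> real^('d::finite) \<Rightarrow> 't" where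
  "trunc_product R star \<gamma> f g x = truncate R \<gamma> (star (f x) (g x))"


section \<open>Spaces of modelled distributions\<close>

definition ennpow :: "ennreal \<Rightarrow> real \<Rightarrow> ennreal" where
  "ennpow a p = (if a = \<infinity> then \<infinity> else ennreal (enn2real a powr p))"

definition Lnorm :: "ennreal \<Rightarrow> 'a measure \<Rightarrow> ('a \<Rightarrow> ennreal) \<Rightarrow> ennreal" where
  "Lnorm p M F =
     (if p = \<infinity> then esssup M F
      else ennpow (\<integral>\<^sup>+x. ennpow (F x) (enn2real p) \<partial>M) (1 / enn2real p))"

definition scale_measure01 :: "real measure" where
  "scale_measure01 = density (lebesgue_on {0<..1}) (\<lambda>l. ennreal (1 / l))"

text \<open>Bochner measurability: almost everywhere limit of simple functions in the Banach space
  \<open>homspace R \<zeta>\<close>, which need not be separable.\<close>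

definition strongly_measurable ::
  "('t::real_vector) reg_structure \<Rightarrow> real \<Rightarrow> (real^('d::finite) \<Rightarrow> 't) \<Rightarrow> bool" where
  "strongly_measurable R \<zeta> F \<longleftrightarrow>
     (\<exists>S. (\<forall>n::nat. simple_function lebesgue (S n) \<and> range (S n) \<subseteq> homspace R \<zeta>) \<and>
          (AE x in lebesgue. (\<lambda>n. homnorm R \<zeta> (S n x - F x)) \<longlonglongrightarrow> 0))"

definition mean_increment ::
  "('t::real_vector) reg_structure \<Rightarrow> ('d::finite) scaling \<Rightarrow> (real^'d \<Rightarrow> real^'d \<Rightarrow> 't \<Rightarrow> 't) \<Rightarrow>
   real \<Rightarrow> real \<Rightarrow> (real^'d \<Rightarrow> 't) \<Rightarrow> real^'d \<Rightarrow> real \<Rightarrow> ennreal" where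
  "mean_increment R s \<Gamma> \<gamma> \<zeta> f x l =
     (\<integral>\<^sup>+h\<in>sball s 0 (4 * l).
        ennreal (hsize R \<zeta> (f (x + h) - \<Gamma> (x + h) x (f x)) / l powr (\<gamma> - \<zeta>)) \<partial>lebesgue)
     / emeasure lebesgue (sball s 0 (4 * l))"

definition F_norm ::
  "('t::real_vector) reg_structure \<Rightarrow> ('d::finite) scaling \<Rightarrow> (real^'d \<Rightarrow> real^'d \<Rightarrow> 't \<Rightarrow> 't) \<Rightarrow>
   real \<Rightarrow> ennreal \<Rightarrow> ennreal \<Rightarrow> (real^'d \<Rightarrow> 't) \<Rightarrow> ennreal" where
  "F_norm R s \<Gamma> \<gamma> p q f =
     (SUP \<zeta>\<in>homs_below R \<gamma>. Lnorm p lebesgue (\<lambda>x. ennreal (hsize R \<zeta> (f x)))) +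
     (SUP \<zeta>\<in>homs_below R \<gamma>.
        Lnorm p lebesgue (\<lambda>x. Lnorm q scale_measure01 (mean_increment R s \<Gamma> \<gamma> \<zeta> f x)))"

text \<open>Elements are actual functions rather than classes modulo null sets;
  \<^const>\<open>F_norm\<close> is insensitive to changes on null sets.\<close>

definition F_space ::
  "('t::real_vector) reg_structure \<Rightarrow> ('d::finite) scaling \<Rightarrow> (real^'d \<Rightarrow> real^'d \<Rightarrow> 't \<Rightarrow> 't) \<Rightarrow>
   real \<Rightarrow> ennreal \<Rightarrow> ennreal \<Rightarrow> (real^'d \<Rightarrow> 't) set" where
  "F_space R s \<Gamma> \<gamma> p q =
     {f. (\<forall>x. f x \<in> hsum R {..<\<gamma>}) \<and>
         (\<forall>\<zeta>\<in>homs_below R \<gamma>. strongly_measurable R \<zeta> (\<lambda>x. hproj R \<zeta> (f x))) \<and>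
         F_norm R s \<Gamma> \<gamma> p q f < \<infinity>}"

definition F_space_ge ::
  "('t::real_vector) reg_structure \<Rightarrow> ('d::finite) scaling \<Rightarrow> (real^'d \<Rightarrow> real^'d \<Rightarrow> 't \<Rightarrow> 't) \<Rightarrow>
   real \<Rightarrow> real \<Rightarrow> ennreal \<Rightarrow> ennreal \<Rightarrow> (real^'d \<Rightarrow> 't) set" where
  "F_space_ge R s \<Gamma> \<gamma> \<alpha> p q =
     {f \<in> F_space R s \<Gamma> \<gamma> p q. \<forall>x. f x \<in> hsum R {\<alpha>..}}"

end

theory Submission
  imports Defs
begin

text \<open>The delicate part of the norm of the product is its increment.  For two points \<open>x\<close>, \<open>y\<close> at
distance at most \<open>4\<lambda>\<close> put \<open>\<Delta>f = f y - \<Gamma> y x (f x)\<close> and \<open>\<Delta>g = g y - \<Gamma> y x (g x)\<close>.  Since \<open>\<Gamma> y x\<close>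
is multiplicative, the increment of \<open>f \<star> g\<close> is
\<open>\<Delta>f \<star> \<Gamma> y x (g x) + \<Gamma> y x (f x) \<star> \<Delta>g + \<Delta>f \<star> \<Delta>g\<close>, up to the image under \<open>\<Gamma> y x\<close> of the
components of \<open>f x \<star> g x\<close> that the truncation removes.  In the first two terms one factor is
controlled by its value at \<open>x\<close> alone, so it leaves the average over \<open>y\<close>, and Hoelder's inequality
concludes.  The third term is a product of two increments in the same variable \<open>y\<close>, of which
the norms of \<open>f\<close> and \<open>g\<close> control the averages only, and the average of a product is not
controlled by the averages of its factors.

The way out is a pointwise estimate: \<open>|\<Delta>f|\<^sub>a \<le> C \<lambda>\<^bsup>\<gamma>\<^sub>1 - a\<^esup> (H x + H y)\<close>, where \<open>H\<close> is a function
whose \<open>L\<^sup>p\<close> norm is bounded by the norm of \<open>f\<close> (\<open>weighted_incr_le_dyadic_total\<close> and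
\<open>Lnorm_control\<close>).  It holds because \<open>f x\<close> and \<open>f y\<close> can both be compared with \<open>f u\<close> and the
comparison be averaged over \<open>u\<close>.  So the third term is at most
\<open>\<lambda>\<^bsup>\<gamma>\<^sub>1 + \<gamma>\<^sub>2 - \<zeta>\<^esup> (H x + H y) (K x + K y)\<close>, with \<open>K\<close> belonging to \<open>g\<close> as \<open>H\<close> does to \<open>f\<close>.  Unless
one of the factors vanishes, \<open>\<gamma> < \<gamma>\<^sub>1 + \<gamma>\<^sub>2\<close>, and the truncated components have homogeneity
strictly above \<open>\<gamma>\<close>, because \<open>\<gamma>\<close> is not a homogeneity.  Both terms therefore carry a spare
power \<open>\<lambda>\<^sup>\<delta>\<close> (\<open>product_increment\<close>).

The spare power replaces a maximal inequality.  Half of it makes the \<open>L\<^sup>q\<close> norm in \<open>\<lambda>\<close> finite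
for every \<open>q\<close>.  The other half makes the operator that takes the supremum over \<open>\<lambda>\<close> of \<open>\<lambda>\<^sup>\<epsilon>\<close>
times the average over a ball of radius \<open>4\<lambda>\<close> bounded on \<open>L\<^sup>p\<close>: the supremum over dyadic scales
is at most an \<open>\<ell>\<^sup>p\<close> sum, and Jensen's inequality and Tonelli's theorem bound each summand by a
term of a geometric series (\<open>Lnorm_frac_maximal\<close>).  This includes \<open>p = 1\<close>, where the
Hardy-Littlewood maximal function is unbounded.

Measurability cannot be left implicit.  The integral of a nonmeasurable function is a lower
integral and is not subadditive, so every sum to which a norm is applied must have measurable
terms.  For this reason \<open>H\<close> is assembled from integrals at countably many dyadic scales.
Their dependence on \<open>x\<close> is measurable by Tonelli's theorem, because
\<open>|f u - \<Gamma> u x (f x)|\<close> is jointly measurable: \<open>f\<close> is a limit of simple functions and \<open>\<Gamma>\<close> is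
continuous in both base points (\<open>continuous_\<Gamma>\<close>, \<open>increment_joint_measurable\<close>).\<close>

section \<open>Powers and norms of functions with values in the extended half-line\<close>

lemma ennpow_ennreal: "0 \<le> x \<Longrightarrow> ennpow (ennreal x) p = ennreal (x powr p)"
  by (simp add: ennpow_def)

lemma ennpow_top [simp]: "ennpow top p = top"
  by (simp add: ennpow_def)

lemma ennpow_zero [simp]: "ennpow 0 p = 0"
  by (simp add: ennpow_def)

lemma ennpow_one_left [simp]: "ennpow 1 p = 1"
  by (simp add: ennpow_def)

lemma ennpow_eq_zero: "ennpow a p = 0 \<Longrightarrow> a = 0"
  by (cases a) (auto simp: ennpow_def split: if_splits)

lemma ennpow_one [simp]: "ennpow a 1 = a"
  by (cases a) (auto simp: ennpow_def)

lemma ennpow_mono: "0 \<le> p \<Longrightarrow> a \<le> b \<Longrightarrow> ennpow a p \<le> ennpow b p"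
  by (cases a; cases b) (auto simp: ennpow_def top_unique intro!: ennreal_leI powr_mono2)

lemma ennpow_mult: "ennpow (a * b) p = ennpow a p * ennpow b p"
proof (cases "a = top \<or> b = top")
  case True
  then show ?thesis
    by (cases "a = 0"; cases "b = 0")
      (auto simp: ennreal_mult_top ennreal_top_mult ennreal_mult_eq_top_iff dest: ennpow_eq_zero)
next
  case False
  then show ?thesis
    by (cases a; cases b)
      (auto simp: ennpow_def ennreal_mult[symmetric] powr_mult)
qed

lemma ennpow_ennpow: "ennpow (ennpow a p) q = ennpow a (p * q)"
  by (cases a) (auto simp: ennpow_def powr_powr)

lemma ennpow_add: "ennpow a (p + q) = ennpow a p * ennpow a q"
  by (cases a) (auto simp: ennpow_def powr_add ennreal_mult)

lemma ennpow_inverse: "p \<noteq> 0 \<Longrightarrow> ennpow (ennpow a p) (1 / p) = a"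
  by (simp add: ennpow_ennpow)

lemma ennpow_inverse': "p \<noteq> 0 \<Longrightarrow> ennpow (ennpow a (1 / p)) p = a"
  by (simp add: ennpow_ennpow)

lemma ennpow_measurable [measurable (raw)]:
  assumes [measurable]: "F \<in> borel_measurable M"
  shows "(\<lambda>x. ennpow (F x) p) \<in> borel_measurable M"
  unfolding ennpow_def by measurable

text \<open>A substitute for Minkowski's inequality that works for all nonnegative exponents: the sum is at
most its number of terms times its largest term.  The loss is a constant, which is harmless for
finite sums.\<close>

lemma ennpow_sum_le:
  fixes u :: "'i \<Rightarrow> ennreal"
  assumes "finite I" "0 \<le> p"
  shows "ennpow (\<Sum>i\<in>I. u i) p \<le> ennpow (of_nat (card I)) p * (\<Sum>i\<in>I. ennpow (u i) p)"
proof (cases "I = {}")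
  case False
  obtain j where j: "j \<in> I" "\<And>i. i \<in> I \<Longrightarrow> u i \<le> u j"
  proof -
    have "Max (u ` I) \<in> u ` I" using assms False by simp
    then obtain j where "j \<in> I" "u j = Max (u ` I)" by auto
    then show ?thesis using that assms(1) by (metis Max_ge finite_imageI imageI)
  qed
  have "(\<Sum>i\<in>I. u i) \<le> of_nat (card I) * u j"
    using sum_bounded_above[of I u "u j"] j by auto
  then have "ennpow (\<Sum>i\<in>I. u i) p \<le> ennpow (of_nat (card I)) p * ennpow (u j) p"
    using ennpow_mono[OF assms(2)] ennpow_mult by metis
  also have "ennpow (u j) p \<le> (\<Sum>i\<in>I. ennpow (u i) p)"
    using j assms by (intro member_le_sum) auto
  finally show ?thesis by (simp add: mult_left_mono)
qed auto

abbreviation Lp :: "real \<Rightarrow> ('a::euclidean_space \<Rightarrow> ennreal) \<Rightarrow> ennreal" where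
  "Lp p \<equiv> Lnorm (ennreal p) lebesgue"

lemma Lnorm_real: "0 \<le> p \<Longrightarrow> Lnorm (ennreal p) M F = ennpow (\<integral>\<^sup>+x. ennpow (F x) p \<partial>M) (1 / p)"
  by (simp add: Lnorm_def)

lemma Lnorm_real_mono:
  assumes "0 < p" "\<And>x. x \<in> space M \<Longrightarrow> F x \<le> G x"
  shows "Lnorm (ennreal p) M F \<le> Lnorm (ennreal p) M G"
  using assms by (auto simp: Lnorm_real intro!: ennpow_mono nn_integral_mono)

lemma Lnorm_real_cmult:
  assumes "0 < p" "F \<in> borel_measurable M"
  shows "Lnorm (ennreal p) M (\<lambda>x. c * F x) = c * Lnorm (ennreal p) M F"
  using assms by (simp add: Lnorm_real ennpow_mult nn_integral_cmult ennpow_inverse)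

text \<open>Constants cannot in general be taken out of the integral of an arbitrary \<open>F\<close>, so the constant is
first moved to the side of the measurable function \<open>G\<close>.\<close>

lemma Lnorm_real_le_cmult:
  assumes "0 < p" "0 < c" and G: "G \<in> borel_measurable M" and le: "\<And>x. G x \<le> ennreal c * F x"
  shows "Lnorm (ennreal p) M G \<le> ennreal c * Lnorm (ennreal p) M F"
proof -
  have inv: "ennreal (1 / c) * (ennreal c * a) = a" "ennreal c * (ennreal (1 / c) * a) = a" for a
    using \<open>0 < c\<close> by (simp_all add: mult.assoc[symmetric] ennreal_mult[symmetric])
  have "ennreal (1 / c) * G x \<le> F x" for x
    using mult_left_mono[OF le[of x], of "ennreal (1 / c)"] by (simp add: inv)
  then have "Lnorm (ennreal p) M (\<lambda>x. ennreal (1 / c) * G x) \<le> Lnorm (ennreal p) M F"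
    using assms by (intro Lnorm_real_mono) auto
  then have "ennreal (1 / c) * Lnorm (ennreal p) M G \<le> Lnorm (ennreal p) M F"
    using assms by (simp add: Lnorm_real_cmult)
  from mult_left_mono[OF this, of "ennreal c"] show ?thesis by (simp add: inv)
qed

lemma card_power_le: 
  assumes "1 \<le> p" shows "ennpow (of_nat n) (1/p) \<le> of_nat n"
proof (cases n)
  case (Suc m)
  have "real n powr (1/p) \<le> real n powr 1" using assms Suc by (intro powr_mono) auto
  then show ?thesis using ennpow_ennreal[of "real n" "1/p"] Suc
    by (metis ennreal_leI ennreal_of_nat_eq_real_of_nat of_nat_0_le_iff powr_one)
qed auto

lemma Lnorm_real_sum:
  assumes p: "1 \<le> p" and I: "finite I" and m: "\<And>i. i \<in> I \<Longrightarrow> F i \<in> borel_measurable M"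
  shows "Lnorm (ennreal p) M (\<lambda>x. \<Sum>i\<in>I. F i x)
    \<le> of_nat (card I * card I) * (\<Sum>i\<in>I. Lnorm (ennreal p) M (F i))"
proof -
  have "(\<integral>\<^sup>+x. ennpow (\<Sum>i\<in>I. F i x) p \<partial>M)
      \<le> (\<integral>\<^sup>+x. ennpow (of_nat (card I)) p * (\<Sum>i\<in>I. ennpow (F i x) p) \<partial>M)"
    using p I by (intro nn_integral_mono ennpow_sum_le) auto
  also have "\<dots> = ennpow (of_nat (card I)) p * (\<Sum>i\<in>I. (\<integral>\<^sup>+x. ennpow (F i x) p \<partial>M))"
    using m by (subst nn_integral_cmult) (auto simp: nn_integral_sum intro!: borel_measurable_sum)
  finally have "ennpow (\<integral>\<^sup>+x. ennpow (\<Sum>i\<in>I. F i x) p \<partial>M) (1/p)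
      \<le> ennpow (ennpow (of_nat (card I)) p * (\<Sum>i\<in>I. (\<integral>\<^sup>+x. ennpow (F i x) p \<partial>M))) (1/p)"
    using p by (intro ennpow_mono) auto
  then have "Lnorm (ennreal p) M (\<lambda>x. \<Sum>i\<in>I. F i x) \<le>
     of_nat (card I) * ennpow (\<Sum>i\<in>I. (\<integral>\<^sup>+x. ennpow (F i x) p \<partial>M)) (1/p)"
    using p by (simp add: Lnorm_real ennpow_mult ennpow_inverse)
  also have "ennpow (\<Sum>i\<in>I. (\<integral>\<^sup>+x. ennpow (F i x) p \<partial>M)) (1/p)
     \<le> ennpow (of_nat (card I)) (1/p) * (\<Sum>i\<in>I. Lnorm (ennreal p) M (F i))"
    using ennpow_sum_le[OF I, of "1/p"] p by (simp add: Lnorm_real)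
  also have "\<dots> \<le> of_nat (card I) * (\<Sum>i\<in>I. Lnorm (ennreal p) M (F i))"
    using card_power_le[OF p] by (intro mult_right_mono) auto
  finally show ?thesis
    using p by (simp add: mult.assoc mult_left_mono order_trans)
qed

lemma Lnorm_real_add:
  assumes "1 \<le> p" "F \<in> borel_measurable M" "G \<in> borel_measurable M"
  shows "Lnorm (ennreal p) M (\<lambda>x. F x + G x) \<le> 4 * (Lnorm (ennreal p) M F + Lnorm (ennreal p) M G)"
  using Lnorm_real_sum[OF assms(1), of "UNIV :: bool set" "\<lambda>b. if b then F else G" M] assms
  by (simp add: UNIV_bool add.commute)

lemma young_ennreal:
  fixes a b :: ennreal
  assumes "r > 1" "r' > 1" "1/r + 1/r' = (1::real)"
  shows "a * b \<le> ennreal (1/r) * ennpow a r + ennreal (1/r') * ennpow b r'"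
proof (cases "a = top \<or> b = top")
  case True
  then show ?thesis using assms by (auto simp: ennreal_mult_top)
next
  case False
  then obtain x y where xy: "a = ennreal x" "0 \<le> x" "b = ennreal y" "0 \<le> y"
    by (metis ennreal_cases)
  have "x * y \<le> x powr r / r + y powr r' / r'"
    using Youngs_inequality[of r r' x y] assms xy by simp
  then show ?thesis using xy assms
    by (simp add: ennpow_ennreal ennreal_mult[symmetric] ennreal_plus[symmetric] del: ennreal_plus)
qed

text \<open>Young's inequality for \<open>F / A\<close> and \<open>G / B\<close>, where \<open>A\<close> and \<open>B\<close> are the two norms.  The
degenerate values 0 and \<open>\<infinity>\<close> of the norms are treated first.\<close>

lemma Holder_nn_integral:
  assumes r: "r > 1" "r' > 1" "1/r + 1/r' = (1::real)"
    and [measurable]: "F \<in> borel_measurable M" "G \<in> borel_measurable M"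
  shows "(\<integral>\<^sup>+x. F x * G x \<partial>M)
    \<le> ennpow (\<integral>\<^sup>+x. ennpow (F x) r \<partial>M) (1/r) * ennpow (\<integral>\<^sup>+x. ennpow (G x) r' \<partial>M) (1/r')"
proof -
  define A where "A = ennpow (\<integral>\<^sup>+x. ennpow (F x) r \<partial>M) (1/r)"
  define B where "B = ennpow (\<integral>\<^sup>+x. ennpow (G x) r' \<partial>M) (1/r')"
  have Ar: "ennpow A r = (\<integral>\<^sup>+x. ennpow (F x) r \<partial>M)" and Br: "ennpow B r' = (\<integral>\<^sup>+x. ennpow (G x) r' \<partial>M)"
    using r by (auto simp: A_def B_def ennpow_inverse')
  consider "A = 0 \<or> B = 0" | "A \<noteq> 0" "B \<noteq> 0" "A = top \<or> B = top" | "A \<noteq> 0" "B \<noteq> 0" "A < top" "B < top"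
    by (metis top.not_eq_extremum)
  then have "(\<integral>\<^sup>+x. F x * G x \<partial>M) \<le> A * B"
  proof cases
    case 1
    then have "(AE x in M. F x * G x = 0)"
    proof
      assume "A = 0"
      then have "AE x in M. ennpow (F x) r = 0" using Ar by (simp add: nn_integral_0_iff_AE)
      then show ?thesis by eventually_elim (auto dest: ennpow_eq_zero)
    next
      assume "B = 0"
      then have "AE x in M. ennpow (G x) r' = 0" using Br by (simp add: nn_integral_0_iff_AE)
      then show ?thesis by eventually_elim (auto dest: ennpow_eq_zero)
    qed
    then have "(\<integral>\<^sup>+x. F x * G x \<partial>M) = 0" by (simp add: nn_integral_0_iff_AE)
    then show ?thesis by simp
  next
    case 2 then show ?thesis by (auto simp: ennreal_mult_top ennreal_top_mult)
  next
    case 3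
    have FA: "F x * G x = A * B * ((F x / A) * (G x / B))" for x
    proof -
      have "A * B * ((F x / A) * (G x / B)) = (A * (F x / A)) * (B * (G x / B))" by (simp add: mult_ac)
      also have "A * (F x / A) = F x" using 3 by (simp add: ennreal_times_divide mult.commute[of A] ennreal_mult_divide_eq less_top)
      also have "B * (G x / B) = G x" using 3 by (simp add: ennreal_times_divide mult.commute[of B] ennreal_mult_divide_eq less_top)
      finally show ?thesis by simp
    qed
    have div: "ennpow (u / A) r = ennpow u r * ennpow (inverse A) r" "ennpow (u / B) r' = ennpow u r' * ennpow (inverse B) r'" for u
      by (simp_all add: divide_ennreal_def ennpow_mult)
    have one: "ennpow A r * ennpow (inverse A) r = 1" "ennpow B r' * ennpow (inverse B) r' = 1"
      using 3 by (simp_all add: ennpow_mult[symmetric] divide_ennreal_def[symmetric])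
    have "(\<integral>\<^sup>+x. F x * G x \<partial>M) = (\<integral>\<^sup>+x. A * B * ((F x / A) * (G x / B)) \<partial>M)"
      using FA by simp
    also have "\<dots> \<le> (\<integral>\<^sup>+x. A * B * (ennreal (1/r) * ennpow (F x / A) r + ennreal (1/r') * ennpow (G x / B) r') \<partial>M)"
      by (intro nn_integral_mono mult_left_mono young_ennreal r) auto
    also have "\<dots> = A * B * (ennreal (1/r) * (ennpow A r * ennpow (inverse A) r) + ennreal (1/r') * (ennpow B r' * ennpow (inverse B) r'))"
      unfolding div Ar Br by (simp add: nn_integral_cmult nn_integral_multc nn_integral_add)
    also have "\<dots> = A * B" using r one
      by (simp add: ennreal_plus[symmetric] del: ennreal_plus)
    finally show ?thesis .
  qed
  then show ?thesis by (simp add: A_def B_def)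
qed

text \<open>The previous inequality for the \<open>p\<close>-th powers, with the conjugate exponents \<open>p\<^sub>1 / p\<close> and
\<open>p\<^sub>2 / p\<close>.\<close>

lemma Lnorm_real_Holder:
  assumes p: "1 \<le> p\<^sub>1" "1 \<le> p\<^sub>2" "p = p\<^sub>1 * p\<^sub>2 / (p\<^sub>1 + p\<^sub>2)"
    and [measurable]: "F \<in> borel_measurable M" "G \<in> borel_measurable M"
  shows "Lnorm (ennreal p) M (\<lambda>x. F x * G x) \<le> Lnorm (ennreal p\<^sub>1) M F * Lnorm (ennreal p\<^sub>2) M G"
proof -
  have pos: "p > 0" using p by (simp add: add_pos_pos)
  have r: "p\<^sub>1 / p = 1 + p\<^sub>1/p\<^sub>2" "p\<^sub>2 / p = 1 + p\<^sub>2/p\<^sub>1" "p/p\<^sub>1 = p\<^sub>2/(p\<^sub>1+p\<^sub>2)" "p/p\<^sub>2 = p\<^sub>1/(p\<^sub>1+p\<^sub>2)"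
    using p(1,2) add_pos_pos[of p\<^sub>1 "p\<^sub>2"] unfolding p(3) by (auto simp: divide_simps)
  have "(\<integral>\<^sup>+x. ennpow (F x) p * ennpow (G x) p \<partial>M) \<le>
     ennpow (\<integral>\<^sup>+x. ennpow (ennpow (F x) p) (p\<^sub>1/p) \<partial>M) (1/(p\<^sub>1/p)) *
     ennpow (\<integral>\<^sup>+x. ennpow (ennpow (G x) p) (p\<^sub>2/p) \<partial>M) (1/(p\<^sub>2/p))"
  proof (rule Holder_nn_integral)
    show "1 / (p\<^sub>1 / p) + 1 / (p\<^sub>2 / p) = 1" using p(1,2) by (simp add: r(3,4) add_divide_distrib[symmetric])
  qed (use p r in auto)
  then have "ennpow (\<integral>\<^sup>+x. ennpow (F x) p * ennpow (G x) p \<partial>M) (1/p) \<le>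
     ennpow (ennpow (\<integral>\<^sup>+x. ennpow (F x) p\<^sub>1 \<partial>M) (p/p\<^sub>1) * ennpow (\<integral>\<^sup>+x. ennpow (G x) p\<^sub>2 \<partial>M) (p/p\<^sub>2)) (1/p)"
    using pos p by (intro ennpow_mono) (auto simp: ennpow_ennpow)
  also have "\<dots> = ennpow (\<integral>\<^sup>+x. ennpow (F x) p\<^sub>1 \<partial>M) (1/p\<^sub>1) * ennpow (\<integral>\<^sup>+x. ennpow (G x) p\<^sub>2 \<partial>M) (1/p\<^sub>2)"
    using pos by (simp add: ennpow_mult ennpow_ennpow)
  finally show ?thesis using pos p by (simp add: Lnorm_real ennpow_mult)
qed

text \<open>Hoelder's inequality against the indicator of \<open>A\<close>.  For \<open>p = 1\<close> the first factor on the right is 0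
or at least 1, according to whether \<open>A\<close> is a null set, because of the convention
\<open>0 powr 0 = 0\<close>.\<close>

lemma Jensen_nn_integral:
  assumes p: "1 \<le> p" and [measurable]: "F \<in> borel_measurable M" "A \<in> sets M"
  shows "ennpow (\<integral>\<^sup>+x\<in>A. F x \<partial>M) p \<le> ennpow (emeasure M A) (p - 1) * (\<integral>\<^sup>+x\<in>A. ennpow (F x) p \<partial>M)"
proof (cases "p = 1")
  case False
  then have p1: "p > 1" using p by simp
  define p' where "p' = p / (p - 1)"
  have p': "p' > 1" "1/p + 1/p' = 1" "p / p' = p - 1" using p1 by (auto simp: p'_def field_simps)
  have ind: "ennpow (indicator A x) q = indicator A x" for q x
    by (auto simp: indicator_def ennpow_def)
  have "(\<integral>\<^sup>+x\<in>A. F x \<partial>M) = (\<integral>\<^sup>+x. (F x * indicator A x) * indicator A x \<partial>M)"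
    by (intro nn_integral_cong) (auto simp: indicator_def)
  also have "\<dots> \<le> ennpow (\<integral>\<^sup>+x. ennpow (F x * indicator A x) p \<partial>M) (1/p) * ennpow (\<integral>\<^sup>+x. ennpow (indicator A x) p' \<partial>M) (1/p')"
    by (rule Holder_nn_integral) (use p1 p' in auto)
  also have "\<dots> = ennpow (\<integral>\<^sup>+x\<in>A. ennpow (F x) p \<partial>M) (1/p) * ennpow (emeasure M A) (1/p')"
    by (simp add: ennpow_mult ind)
  finally have "ennpow (\<integral>\<^sup>+x\<in>A. F x \<partial>M) p \<le> ennpow (ennpow (\<integral>\<^sup>+x\<in>A. ennpow (F x) p \<partial>M) (1/p) * ennpow (emeasure M A) (1/p')) p"
    using p by (intro ennpow_mono) auto
  also have "\<dots> = ennpow (emeasure M A) (p - 1) * (\<integral>\<^sup>+x\<in>A. ennpow (F x) p \<partial>M)"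
    using p1 p' by (simp add: ennpow_mult ennpow_ennpow mult.commute)
  finally show ?thesis by simp
next
  case True
  show ?thesis
  proof (cases "emeasure M A = 0")
    case True
    then have "AE x in M. x \<notin> A" by (intro AE_not_in) auto
    then have "(\<integral>\<^sup>+x\<in>A. F x \<partial>M) = 0"
      by (subst nn_integral_0_iff_AE) (auto elim: eventually_mono)
    then show ?thesis by simp
  next
    case False
    have "1 \<le> ennpow (emeasure M A) 0" using False
      by (cases "emeasure M A") (auto simp: ennpow_def zero_ennreal_def[symmetric])
    then show ?thesis using \<open>p = 1\<close> mult_right_mono[of 1 "ennpow (emeasure M A) 0"] by fastforce
  qed
qed

section \<open>Sequence norms and dyadic scales\<close>

definition lq_norm :: "ennreal \<Rightarrow> (nat \<Rightarrow> ennreal) \<Rightarrow> ennreal" where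
  "lq_norm q a = (if q = \<infinity> then SUP n. a n
     else ennpow (\<Sum>n. ennpow (a n) (enn2real q)) (1 / enn2real q))"

lemma exponent_cases:
  assumes "1 \<le> (q::ennreal)"
  obtains (top) "q = top" | (real) r where "q = ennreal r" "1 \<le> r"
  using assms by (cases q) auto

lemma lq_norm_top: "lq_norm top a = (SUP n. a n)"
  by (simp add: lq_norm_def)

lemma lq_norm_real: "0 \<le> r \<Longrightarrow> lq_norm (ennreal r) a = ennpow (\<Sum>n. ennpow (a n) r) (1 / r)"
  by (simp add: lq_norm_def)

lemma lq_norm_measurable [measurable (raw)]:
  assumes [measurable]: "\<And>n. a n \<in> borel_measurable M"
  shows "(\<lambda>x. lq_norm q (\<lambda>n. a n x)) \<in> borel_measurable M"
  unfolding lq_norm_def by measurable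

lemma lq_norm_mono:
  assumes "1 \<le> q" "\<And>n. a n \<le> b n"
  shows "lq_norm q a \<le> lq_norm q b"
  using assms(1)
proof (cases q rule: exponent_cases)
  case top
  then show ?thesis using assms by (auto simp: lq_norm_top intro!: SUP_mono)
next
  case (real r)
  then show ?thesis using assms
    by (auto simp: lq_norm_real intro!: ennpow_mono suminf_le)
qed

lemma lq_norm_ge:
  assumes "1 \<le> q" shows "a n \<le> lq_norm q a"
  using assms
proof (cases q rule: exponent_cases)
  case top
  then show ?thesis by (auto simp: lq_norm_top intro!: SUP_upper)
next
  case (real r)
  have "ennpow (a n) r \<le> (\<Sum>n. ennpow (a n) r)"
    using sum_le_suminf[of "\<lambda>n. ennpow (a n) r" "{n}"] by simp
  then have "ennpow (ennpow (a n) r) (1/r) \<le> ennpow (\<Sum>n. ennpow (a n) r) (1/r)"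
    using real by (intro ennpow_mono) auto
  then show ?thesis using real by (simp add: lq_norm_real ennpow_inverse)
qed

text \<open>Every term is at most the norm \<open>S\<close> with the smaller exponent \<open>q\<^sub>1\<close>, so the \<open>q\<close>-th power of a
term is at most its \<open>q\<^sub>1\<close>-th power times \<open>S\<close> to the power \<open>q - q\<^sub>1\<close>.\<close>

lemma lq_norm_antimono:
  assumes "1 \<le> q\<^sub>1" "q\<^sub>1 \<le> q"
  shows "lq_norm q a \<le> lq_norm q\<^sub>1 a"
proof -
  define S where "S = lq_norm q\<^sub>1 a"
  have le: "a n \<le> S" for n using lq_norm_ge assms S_def by blast
  have "1 \<le> q" using assms by auto
  then have "lq_norm q a \<le> S"
  proof (cases q rule: exponent_cases)
    case top
    then show ?thesis using le by (auto simp: lq_norm_top intro!: SUP_least)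
  next
    case (real r)
    obtain r1 where r1: "q\<^sub>1 = ennreal r1" "1 \<le> r1" "r1 \<le> r"
      using assms real by (cases q\<^sub>1) (auto simp: ennreal_le_iff top_unique)
    have eq: "ennpow S r1 = (\<Sum>n. ennpow (a n) r1)"
      using r1 by (simp add: S_def lq_norm_real ennpow_inverse')
    have *: "ennpow u r = ennpow u r1 * ennpow u (r - r1)" for u
      using ennpow_add[of u r1 "r - r1"] by simp
    have "(\<Sum>n. ennpow (a n) r) = (\<Sum>n. ennpow (a n) r1 * ennpow (a n) (r - r1))"
      by (simp add: *)
    also have "\<dots> \<le> (\<Sum>n. ennpow (a n) r1 * ennpow S (r - r1))"
      using r1 le by (intro suminf_le mult_left_mono ennpow_mono) auto
    also have "\<dots> = ennpow S r" using eq by (simp add: *)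
    finally have "ennpow (\<Sum>n. ennpow (a n) r) (1/r) \<le> ennpow (ennpow S r) (1/r)"
      using real by (intro ennpow_mono) auto
    then show ?thesis using real by (simp add: lq_norm_real ennpow_inverse)
  qed
  then show ?thesis by (simp add: S_def)
qed

lemma lq_norm_cmult:
  assumes "1 \<le> q" shows "lq_norm q (\<lambda>n. c * a n) = c * lq_norm q a"
  using assms
proof (cases q rule: exponent_cases)
  case top
  then show ?thesis by (simp add: lq_norm_top SUP_mult_left_ennreal)
next
  case (real r)
  then show ?thesis by (simp add: lq_norm_real ennpow_mult ennpow_inverse)
qed

lemma lq_norm_sum:
  assumes q: "1 \<le> q" and I: "finite I"
  shows "lq_norm q (\<lambda>n. \<Sum>i\<in>I. a i n) \<le> of_nat (card I * card I) * (\<Sum>i\<in>I. lq_norm q (a i))"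
  using q
proof (cases q rule: exponent_cases)
  case top
  have "(SUP n. \<Sum>i\<in>I. a i n) \<le> (\<Sum>i\<in>I. SUP n. a i n)"
    by (intro SUP_least sum_mono SUP_upper) auto
  also have "\<dots> \<le> of_nat (card I * card I) * (\<Sum>i\<in>I. SUP n. a i n)"
  proof (cases "I = {}")
    case False
    then have "1 \<le> card I * card I" using I by (simp add: Suc_leI card_gt_0_iff)
    then have "(1::ennreal) \<le> of_nat (card I * card I)"
      by (metis of_nat_1 of_nat_mono)
    then show ?thesis using mult_right_mono[of "1::ennreal"] by fastforce
  qed auto
  finally show ?thesis using top by (simp add: lq_norm_top)
next
  case (real p)
  have "(\<Sum>n. ennpow (\<Sum>i\<in>I. a i n) p) \<le> (\<Sum>n. ennpow (of_nat (card I)) p * (\<Sum>i\<in>I. ennpow (a i n) p))"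
    using real I by (intro suminf_le ennpow_sum_le) auto
  also have "\<dots> = ennpow (of_nat (card I)) p * (\<Sum>i\<in>I. (\<Sum>n. ennpow (a i n) p))"
    by (simp add: suminf_sum)
  finally have "ennpow (\<Sum>n. ennpow (\<Sum>i\<in>I. a i n) p) (1/p)
      \<le> ennpow (ennpow (of_nat (card I)) p * (\<Sum>i\<in>I. (\<Sum>n. ennpow (a i n) p))) (1/p)"
    using real by (intro ennpow_mono) auto
  then have "lq_norm q (\<lambda>n. \<Sum>i\<in>I. a i n) \<le> of_nat (card I) * ennpow (\<Sum>i\<in>I. (\<Sum>n. ennpow (a i n) p)) (1/p)"
    using real by (simp add: lq_norm_real ennpow_mult ennpow_inverse)
  also have "ennpow (\<Sum>i\<in>I. (\<Sum>n. ennpow (a i n) p)) (1/p)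
     \<le> ennpow (of_nat (card I)) (1/p) * (\<Sum>i\<in>I. lq_norm q (a i))"
    using ennpow_sum_le[OF I, of "1/p"] real by (simp add: lq_norm_real)
  also have "\<dots> \<le> of_nat (card I) * (\<Sum>i\<in>I. lq_norm q (a i))"
    using card_power_le[OF real(2)] by (intro mult_right_mono) auto
  finally show ?thesis by (simp add: mult.assoc mult_left_mono order_trans)
qed

lemma lq_norm_add:
  assumes "1 \<le> q" shows "lq_norm q (\<lambda>n. a n + b n) \<le> 4 * (lq_norm q a + lq_norm q b)"
  using lq_norm_sum[OF assms, of "UNIV :: bool set" "\<lambda>i. if i then a else b"]
  by (simp add: UNIV_bool add.commute)

text \<open>Separates the two largest scales, which have to be estimated in a different way.\<close>

lemma lq_norm_shift:
  assumes "1 \<le> q"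
  shows "lq_norm q a \<le> 9 * (a 0 + a 1 + lq_norm q (\<lambda>n. a (n + 2)))"
  using assms
proof (cases q rule: exponent_cases)
  case top
  have "a n \<le> a 0 + a 1 + lq_norm q (\<lambda>n. a (n + 2))" for n
  proof -
    consider "n = 0" | "n = 1" | m where "n = m + 2" by (metis One_nat_def add_2_eq_Suc' not0_implies_Suc)
    then show ?thesis
    proof cases
      case 3 then show ?thesis using lq_norm_ge[OF assms, of "\<lambda>n. a (n+2)" m] by (simp add: add_increasing)
    qed (auto simp: add_increasing2 add_increasing add.assoc)
  qed
  then have "lq_norm q a \<le> 1 * (a 0 + a 1 + lq_norm q (\<lambda>n. a (n + 2)))"
    using top by (auto simp: lq_norm_top intro!: SUP_least)
  also have "\<dots> \<le> 9 * (a 0 + a 1 + lq_norm q (\<lambda>n. a (n + 2)))" by (intro mult_right_mono) auto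
  finally show ?thesis .
next
  case (real r)
  define S where "S = (\<Sum>n. ennpow (a (n + 2)) r)"
  define f where "f = (\<lambda>i::nat. if i = 0 then ennpow (a 0) r else if i = 1 then ennpow (a 1) r else S)"
  have "(\<Sum>n. ennpow (a n) r) = S + (ennpow (a 0) r + ennpow (a 1) r)"
    using suminf_offset[of "\<lambda>n. ennpow (a n) r" 2] by (simp add: S_def numeral_2_eq_2 add.commute)
  also have "\<dots> = (\<Sum>i<3. f i)" by (simp add: f_def eval_nat_numeral add_ac)
  finally have "lq_norm q a = ennpow (\<Sum>i<3. f i) (1/r)" using real by (simp add: lq_norm_real)
  also have "\<dots> \<le> ennpow (of_nat 3) (1/r) * (\<Sum>i<3. ennpow (f i) (1/r))"
    using ennpow_sum_le[of "{..<3::nat}" "1/r" f] real by simp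
  also have "\<dots> \<le> of_nat 3 * (\<Sum>i<3. ennpow (f i) (1/r))"
    using real by (intro mult_right_mono card_power_le) auto
  also have "(\<Sum>i<3. ennpow (f i) (1/r)) = a 0 + a 1 + lq_norm q (\<lambda>n. a (n + 2))"
    using real by (simp add: f_def eval_nat_numeral ennpow_inverse S_def lq_norm_real)
  also have "of_nat 3 * \<dots> \<le> 9 * \<dots>" by (intro mult_right_mono) auto
  finally show ?thesis .
qed

lemma lq_norm_geometric:
  assumes "1 \<le> q" "0 < \<epsilon>"
  shows "lq_norm q (\<lambda>n. ennreal (((1/2)^n) powr \<epsilon>)) \<le> ennreal (1 / (1 - (1/2) powr \<epsilon>))"
proof -
  have lt: "(1/2) powr \<epsilon> < (1::real)" using assms(2) by (simp add: powr01_less_one)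
  have eq: "((1/2)^n) powr \<epsilon> = ((1/2::real) powr \<epsilon>) ^ n" for n
    by (simp add: powr_realpow[symmetric] powr_powr mult.commute)
  have "lq_norm q (\<lambda>n. ennreal (((1/2)^n) powr \<epsilon>)) \<le> lq_norm (ennreal 1) (\<lambda>n. ennreal (((1/2)^n) powr \<epsilon>))"
    using assms by (intro lq_norm_antimono) auto
  also have "\<dots> = (\<Sum>n. ennreal (((1/2) powr \<epsilon>) ^ n))" by (subst lq_norm_real) (auto simp: eq)
  also have "\<dots> = ennreal (1 / (1 - (1/2) powr \<epsilon>))"
    using geometric_sums[of "(1/2::real) powr \<epsilon>"] lt by (intro suminf_ennreal_eq) auto
  finally show ?thesis .
qed

definition dyadic :: "nat \<Rightarrow> real set" where
  "dyadic n = {(1/2)^Suc n<..(1/2)^n}"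

lemma dyadic_subset: "dyadic n \<subseteq> {0<..1}"
proof
  fix l :: real assume "l \<in> dyadic n"
  then have "(1/2)^Suc n < l" "l \<le> (1/2)^n" by (auto simp: dyadic_def)
  moreover have "(1/2::real)^n \<le> 1" "(0::real) < (1/2)^Suc n" by (auto intro: power_le_one)
  ultimately show "l \<in> {0<..1}" using order.strict_trans by fastforce
qed

lemma dyadic_cover:
  assumes "l \<in> {0<..1::real}" obtains n where "l \<in> dyadic n"
proof -
  have "\<exists>n. (1/2)^n < l" using assms by (intro real_arch_pow_inv) auto
  define m where "m = (LEAST n. (1/2)^n < l)"
  have m: "(1/2)^m < l" unfolding m_def by (rule LeastI_ex) fact
  have "m \<noteq> 0" using m assms by (cases m) auto
  then obtain n where n: "m = Suc n" using not0_implies_Suc by auto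
  have "\<not> (1/2)^n < l" using not_less_Least[of n "\<lambda>n. (1/2)^n < l"] n unfolding m_def by auto
  then show ?thesis using that[of n] m n by (auto simp: dyadic_def not_less)
qed

lemma dyadic_unique:
  assumes "l \<in> dyadic n" "l \<in> dyadic m" shows "n = m"
proof (rule ccontr)
  have *: False if "n < m" "l \<in> dyadic n" "l \<in> dyadic m" for n m
  proof -
    have "(1/2::real)^m \<le> (1/2)^Suc n" using that by (intro power_decreasing) auto
    then show False using that by (auto simp: dyadic_def)
  qed
  assume "n \<noteq> m"
  then show False using * assms by (metis linorder_neqE_nat)
qed

lemma powr_dyadic_le:
  assumes l: "l \<in> dyadic n" and "0 \<le> \<theta>"
  shows "l powr (- \<theta>) \<le> (2 ^ Suc n) powr \<theta>"
proof -
  have l01: "0 < l" "(1/2)^Suc n < l" using l dyadic_subset[of n] by (auto simp: dyadic_def)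
  have "l powr (- \<theta>) = (1 / l) powr \<theta>" using l01 by (simp add: powr_minus_divide powr_divide)
  also have "\<dots> \<le> (2 ^ Suc n) powr \<theta>"
  proof (intro powr_mono2)
    have "1 / l \<le> 1 / (1/2)^Suc n" using l01 by (intro divide_left_mono) auto
    then show "1 / l \<le> 2 ^ Suc n" by (simp add: power_one_over)
  qed (use l01 assms in auto)
  finally show ?thesis .
qed

lemma powr_dyadic_ge:
  assumes l: "l \<in> dyadic n" and "0 \<le> \<theta>"
  shows "(2 ^ n) powr \<theta> \<le> l powr (- \<theta>)"
proof -
  have l01: "0 < l" "l \<le> (1/2)^n" using l dyadic_subset[of n] by (auto simp: dyadic_def)
  have "(2 ^ n) powr \<theta> \<le> (1 / l) powr \<theta>"
  proof (intro powr_mono2)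
    have "1 / (1/2)^n \<le> 1 / l" using l01 by (intro divide_left_mono) auto
    then show "2 ^ n \<le> 1 / l" by (simp add: power_one_over)
  qed (use assms in auto)
  also have "\<dots> = l powr (- \<theta>)" using l01 by (simp add: powr_minus_divide powr_divide)
  finally show ?thesis .
qed

lemma suminf_indicator_dyadic:
  assumes "l \<in> dyadic n" shows "(\<Sum>m. b m * indicator (dyadic m) l) = (b n :: ennreal)"
proof -
  have "(\<Sum>m. b m * indicator (dyadic m) l) = (\<Sum>m\<in>{n}. b m * indicator (dyadic m) l)"
    by (rule suminf_finite) (use assms dyadic_unique in \<open>auto simp: indicator_def\<close>)
  then show ?thesis using assms by simp
qed

lemma space_scale_measure01: "space scale_measure01 = {0<..1}"
  by (simp add: scale_measure01_def space_restrict_space)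

lemma sets_scale_measure01: "sets scale_measure01 = sets (lebesgue_on {0<..1})"
  by (simp add: scale_measure01_def)

lemma borel_measurable_scale_measure01:
  assumes "f \<in> borel_measurable borel" shows "f \<in> borel_measurable scale_measure01"
  unfolding measurable_cong_sets[OF sets_scale_measure01 refl]
  by (intro measurable_restrict_space1 measurable_completion) (use assms in simp)

lemma dyadic_in_sets [measurable]: "dyadic n \<in> sets scale_measure01"
proof -
  have "dyadic n \<in> sets lebesgue" by (simp add: dyadic_def)
  then show ?thesis unfolding sets_scale_measure01
    using dyadic_subset by (subst sets_restrict_space_iff) auto
qed

lemma nn_integral_scale_measure01:
  assumes "f \<in> borel_measurable scale_measure01"
  shows "(\<integral>\<^sup>+l. f l \<partial>scale_measure01) = (\<integral>\<^sup>+l\<in>{0<..1}. ennreal (1/l) * f l \<partial>lebesgue)"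
proof -
  have f: "f \<in> borel_measurable (lebesgue_on {0<..1})"
    using assms unfolding measurable_cong_sets[OF sets_scale_measure01 refl] .
  have m: "(\<lambda>l::real. ennreal (1/l)) \<in> borel_measurable (lebesgue_on {0<..1})"
    by (intro measurable_restrict_space1 measurable_completion) auto
  show ?thesis unfolding scale_measure01_def
    by (subst nn_integral_density[OF m f]) (simp add: nn_integral_restrict_space)
qed

text \<open>The exact value is \<open>ln 2\<close>.\<close>

lemma emeasure_dyadic:
  "ennreal (1/2) \<le> emeasure scale_measure01 (dyadic n)" "emeasure scale_measure01 (dyadic n) \<le> 1"
proof -
  have "emeasure scale_measure01 (dyadic n) = (\<integral>\<^sup>+l. indicator (dyadic n) l \<partial>scale_measure01)" by simp
  also have "\<dots> = (\<integral>\<^sup>+l\<in>{0<..1}. ennreal (1/l) * indicator (dyadic n) l \<partial>lebesgue)"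
    by (intro nn_integral_scale_measure01) auto
  also have "\<dots> = (\<integral>\<^sup>+l\<in>dyadic n. ennreal (1/l) \<partial>lebesgue)"
    by (intro nn_integral_cong) (auto simp: indicator_def dest: subsetD[OF dyadic_subset])
  finally have eq: "emeasure scale_measure01 (dyadic n) = (\<integral>\<^sup>+l\<in>dyadic n. ennreal (1/l) \<partial>lebesgue)" .
  have len: "emeasure lebesgue (dyadic n) = ennreal ((1/2)^Suc n)"
    by (simp add: dyadic_def)
  have ds: "dyadic n \<in> sets lebesgue" by (simp add: dyadic_def)
  have "ennreal (1/2) = ennreal (2^n) * ennreal ((1/2)^Suc n)"
    by (subst ennreal_mult[symmetric]) (auto simp: power_one_over)
  also have "\<dots> = (\<integral>\<^sup>+l\<in>dyadic n. ennreal (2^n) \<partial>lebesgue)"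
    using ds len by (simp add: nn_integral_cmult_indicator)
  also have "\<dots> \<le> (\<integral>\<^sup>+l\<in>dyadic n. ennreal (1/l) \<partial>lebesgue)"
  proof (intro nn_integral_mono)
    fix l :: real
    have "ennreal (2^n) \<le> ennreal (1/l)" if "l \<in> dyadic n"
    proof -
      have "0 < l" "l \<le> (1/2)^n" using that dyadic_subset[of n] by (auto simp: dyadic_def)
      then have "1 / (1/2)^n \<le> 1 / l" by (intro divide_left_mono) auto
      then show ?thesis by (intro ennreal_leI) (simp add: power_one_over)
    qed
    then show "ennreal (2^n) * indicator (dyadic n) l \<le> ennreal (1/l) * indicator (dyadic n) l"
      by (auto simp: indicator_def)
  qed
  finally show "ennreal (1/2) \<le> emeasure scale_measure01 (dyadic n)" using eq by simp
  have "(\<integral>\<^sup>+l\<in>dyadic n. ennreal (1/l) \<partial>lebesgue) \<le> (\<integral>\<^sup>+l\<in>dyadic n. ennreal (2^Suc n) \<partial>lebesgue)"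
  proof (intro nn_integral_mono)
    fix l :: real
    have "ennreal (1/l) \<le> ennreal (2^Suc n)" if "l \<in> dyadic n"
    proof -
      have "0 < l" "(1/2)^Suc n \<le> l" using that dyadic_subset[of n] by (auto simp: dyadic_def)
      then have "1 / l \<le> 1 / (1/2)^Suc n" by (intro divide_left_mono) (auto intro!: mult_pos_pos)
      then show ?thesis by (intro ennreal_leI) (simp add: power_one_over)
    qed
    then show "ennreal (1/l) * indicator (dyadic n) l \<le> ennreal (2^Suc n) * indicator (dyadic n) l"
      by (auto simp: indicator_def)
  qed
  also have "\<dots> = ennreal (2^Suc n) * ennreal ((1/2)^Suc n)"
    using ds len by (simp add: nn_integral_cmult_indicator)
  also have "\<dots> = 1"
    by (subst ennreal_mult[symmetric]) (auto simp: power_one_over)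
  finally show "emeasure scale_measure01 (dyadic n) \<le> 1" using eq by simp
qed

text \<open>Measurability of \<open>e\<close> matters for \<open>q = \<infinity>\<close>, as the essential supremum of a nonmeasurable function
is infinite by convention.\<close>

lemma Lnorm_scale_le_lq_norm:
  assumes q: "1 \<le> q" and e: "e \<in> borel_measurable scale_measure01"
    and le: "\<And>n l. l \<in> dyadic n \<Longrightarrow> e l \<le> a n"
  shows "Lnorm q scale_measure01 e \<le> lq_norm q a"
  using q
proof (cases q rule: exponent_cases)
  case top
  have "esssup scale_measure01 e \<le> (SUP n. a n)"
  proof (intro esssup_I e AE_I2)
    fix l assume "l \<in> space scale_measure01"
    then obtain n where "l \<in> dyadic n" using dyadic_cover by (auto simp: space_scale_measure01)
    then show "e l \<le> (SUP n. a n)" using le by (meson SUP_upper2 UNIV_I)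
  qed
  then show ?thesis using top by (simp add: Lnorm_def lq_norm_top)
next
  case (real r)
  have "(\<integral>\<^sup>+l. ennpow (e l) r \<partial>scale_measure01)
      \<le> (\<integral>\<^sup>+l. (\<Sum>n. ennpow (a n) r * indicator (dyadic n) l) \<partial>scale_measure01)"
  proof (intro nn_integral_mono)
    fix l assume "l \<in> space scale_measure01"
    then obtain n where n: "l \<in> dyadic n" using dyadic_cover by (auto simp: space_scale_measure01)
    then show "ennpow (e l) r \<le> (\<Sum>n. ennpow (a n) r * indicator (dyadic n) l)"
      using real le[OF n] by (simp add: suminf_indicator_dyadic ennpow_mono)
  qed
  also have "\<dots> = (\<Sum>n. ennpow (a n) r * emeasure scale_measure01 (dyadic n))"
    by (subst nn_integral_suminf) (auto simp: nn_integral_cmult_indicator)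
  also have "\<dots> \<le> (\<Sum>n. ennpow (a n) r * 1)"
    by (intro suminf_le mult_left_mono emeasure_dyadic) auto
  finally show ?thesis using real by (auto simp: Lnorm_real lq_norm_real intro!: ennpow_mono)
qed

text \<open>The step function with value \<open>b n\<close> on \<open>dyadic n\<close> lies below \<open>e\<close>, and its norm is, up to a
factor, the sequence norm of \<open>b\<close>.\<close>

lemma lq_norm_le_Lnorm_scale:
  assumes q: "1 \<le> q" and le: "\<And>n l. l \<in> dyadic n \<Longrightarrow> b n \<le> e l"
  shows "lq_norm q b \<le> 2 * Lnorm q scale_measure01 e"
  using q
proof (cases q rule: exponent_cases)
  case top
  have "b n \<le> esssup scale_measure01 e" for n
  proof (rule ccontr)
    assume "\<not> b n \<le> esssup scale_measure01 e"
    then have lt: "esssup scale_measure01 e < b n" by simp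
    have m: "e \<in> borel_measurable scale_measure01"
      using lt unfolding esssup_def by (metis top.extremum_strict)
    have "dyadic n \<subseteq> {l \<in> space scale_measure01. e l > esssup scale_measure01 e}"
      using le lt dyadic_subset by (fastforce simp: space_scale_measure01)
    then have "emeasure scale_measure01 (dyadic n) \<le> 0"
      using m by (subst esssup_zero_measure[of scale_measure01 e, symmetric]) (auto intro!: emeasure_mono)
    then show False using emeasure_dyadic(1)[of n] by auto
  qed
  then have "lq_norm q b \<le> 1 * Lnorm q scale_measure01 e"
    using top by (auto simp: lq_norm_top Lnorm_def intro!: SUP_least)
  also have "\<dots> \<le> 2 * Lnorm q scale_measure01 e" by (intro mult_right_mono) auto
  finally show ?thesis .
next
  case (real r)
  have "(\<Sum>n. ennpow (b n) r * ennreal (1/2)) \<le> (\<Sum>n. ennpow (b n) r * emeasure scale_measure01 (dyadic n))"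
    by (intro suminf_le mult_left_mono emeasure_dyadic) auto
  also have "\<dots> = (\<integral>\<^sup>+l. (\<Sum>n. ennpow (b n) r * indicator (dyadic n) l) \<partial>scale_measure01)"
    by (subst nn_integral_suminf) (auto simp: nn_integral_cmult_indicator)
  also have "\<dots> \<le> (\<integral>\<^sup>+l. ennpow (e l) r \<partial>scale_measure01)"
  proof (intro nn_integral_mono)
    fix l assume "l \<in> space scale_measure01"
    then obtain n where n: "l \<in> dyadic n" using dyadic_cover by (auto simp: space_scale_measure01)
    then show "(\<Sum>n. ennpow (b n) r * indicator (dyadic n) l) \<le> ennpow (e l) r"
      using real le[OF n] by (simp add: suminf_indicator_dyadic ennpow_mono)
  qed
  finally have "2 * ((\<Sum>n. ennpow (b n) r) * ennreal (1/2)) \<le> 2 * (\<integral>\<^sup>+l. ennpow (e l) r \<partial>scale_measure01)"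
    by (intro mult_left_mono) auto
  also have "2 * ((\<Sum>n. ennpow (b n) r) * ennreal (1/2)) = (\<Sum>n. ennpow (b n) r)"
  proof -
    have "(2::ennreal) * ennreal (1/2) = 1"
      by (metis ennreal_1 ennreal_mult ennreal_numeral mult.commute nonzero_eq_divide_eq zero_le_divide_1_iff zero_le_numeral zero_neq_numeral)
    then show ?thesis by (metis mult.assoc mult.commute mult_1)
  qed
  finally have "ennpow (\<Sum>n. ennpow (b n) r) (1/r) \<le> ennpow (2 * (\<integral>\<^sup>+l. ennpow (e l) r \<partial>scale_measure01)) (1/r)"
    using real by (intro ennpow_mono) auto
  also have "\<dots> = ennpow 2 (1/r) * Lnorm q scale_measure01 e"
    using real by (simp add: ennpow_mult Lnorm_real)
  also have "\<dots> \<le> 2 * Lnorm q scale_measure01 e"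
    using card_power_le[OF real(2), of 2] by (intro mult_right_mono) auto
  finally show ?thesis using real by (simp add: lq_norm_real)
qed

section \<open>Scaled balls and averages over them\<close>

lemma snorm_le_iff:
  fixes s :: "('d::finite) scaling"
  assumes "\<forall>i. 0 < s i" "0 \<le> \<rho>"
  shows "snorm s x \<le> \<rho> \<longleftrightarrow> (\<forall>i. \<bar>x $ i\<bar> \<le> \<rho> ^ s i)"
proof -
  have "\<bar>x $ i\<bar> powr (1 / real (s i)) \<le> \<rho> \<longleftrightarrow> \<bar>x $ i\<bar> \<le> \<rho> ^ s i" for i
  proof -
    have s: "0 < real (s i)" using assms by simp
    have "\<bar>x $ i\<bar> = (\<bar>x $ i\<bar> powr (1 / real (s i))) ^ s i"
      using s by (cases "x $ i = 0") (simp_all add: powr_realpow[symmetric] powr_powr)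
    then show ?thesis
      using assms s by (metis power_mono_iff powr_ge_zero of_nat_0_less_iff)
  qed
  then show ?thesis by (simp add: snorm_def)
qed

lemma snorm_nonneg: "0 \<le> snorm s (x :: real^'d::finite)"
proof -
  obtain i :: 'd where True by simp
  have "0 \<le> \<bar>x $ i\<bar> powr (1 / real (s i))" by simp
  also have "\<dots> \<le> snorm s x" unfolding snorm_def by (rule Max_ge) auto
  finally show ?thesis .
qed

lemma snorm_minus: "snorm s (- x) = snorm s x"
  by (simp add: snorm_def)

lemma snorm_commute: "snorm s (x - y) = snorm s (y - x)"
  using snorm_minus[of s "x - y"] by simp

lemma power_add_ge:
  fixes a b :: real assumes "0 \<le> a" "0 \<le> b" "0 < n"
  shows "a ^ n + b ^ n \<le> (a + b) ^ n"
  using assms(3)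
proof (induction n)
  case (Suc n)
  show ?case
  proof (cases "n = 0")
    case False
    have "a ^ Suc n + b ^ Suc n \<le> (a + b) * (a ^ n + b ^ n)"
      using assms by (simp add: algebra_simps)
    also have "\<dots> \<le> (a + b) * (a + b) ^ n" using Suc False assms by (intro mult_left_mono) auto
    finally show ?thesis by simp
  qed simp
qed simp

text \<open>The scaled norm is subadditive since \<open>a\<^sup>n + b\<^sup>n \<le> (a + b)\<^sup>n\<close> in each coordinate.\<close>

lemma snorm_triangle:
  assumes "\<forall>i. 0 < s i" shows "snorm s (x + y) \<le> snorm s x + snorm s y"
proof -
  have "\<bar>(x + y) $ i\<bar> \<le> (snorm s x + snorm s y) ^ s i" for i
  proof -
    have "\<bar>x $ i\<bar> \<le> snorm s x ^ s i" "\<bar>y $ i\<bar> \<le> snorm s y ^ s i"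
      using snorm_le_iff[OF assms snorm_nonneg] by auto
    then show ?thesis using power_add_ge[OF snorm_nonneg snorm_nonneg] assms
      by (smt (verit, best) vector_add_component)
  qed
  then show ?thesis using snorm_le_iff[OF assms] snorm_nonneg[of s x] snorm_nonneg[of s y] by simp
qed

lemma snorm_small:
  fixes s :: "('d::finite) scaling"
  assumes "\<forall>i. 0 < s i" "0 < \<rho>"
  obtains \<delta> where "0 < \<delta>" "\<And>x. norm x < \<delta> \<Longrightarrow> snorm s x \<le> \<rho>"
proof
  show "0 < Min (range (\<lambda>i. \<rho> ^ s i))" using assms by simp
  fix x :: "real^'d" assume x: "norm x < Min (range (\<lambda>i. \<rho> ^ s i))"
  have "\<bar>x $ i\<bar> \<le> \<rho> ^ s i" for i
  proof -
    have "\<bar>x $ i\<bar> \<le> norm x" by (rule component_le_norm_cart)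
    also have "\<dots> \<le> \<rho> ^ s i" using x by (simp add: less_imp_le)
    finally show ?thesis .
  qed
  then show "snorm s x \<le> \<rho>" using assms by (simp add: snorm_le_iff)
qed

text \<open>Used to subdivide a segment into steps of scaled length at most 1: dividing a vector by \<open>N\<close>
divides the \<open>i\<close>-th coordinate of its scaled norm by the \<open>s i\<close>-th root of \<open>N\<close>.\<close>

lemma snorm_shrink:
  fixes s :: "('d::finite) scaling"
  assumes "\<forall>i. 0 < s i"
  obtains N :: nat where "0 < N" "\<And>x. snorm s x \<le> \<rho> \<Longrightarrow> snorm s ((1 / real N) *\<^sub>R x) \<le> 1"
proof -
  obtain N :: nat where N: "Max (range (\<lambda>i. \<bar>\<rho>\<bar> ^ s i)) \<le> real N" by (meson real_arch_simple)
  show ?thesis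
  proof
    show "0 < Suc N" by simp
    fix x assume x: "snorm s x \<le> \<rho>"
    have "\<bar>((1 / real (Suc N)) *\<^sub>R x) $ i\<bar> \<le> 1 ^ s i" for i
    proof -
      have "\<bar>x $ i\<bar> \<le> \<bar>\<rho>\<bar> ^ s i" using snorm_le_iff[OF assms, of "\<bar>\<rho>\<bar>" x] x by auto
      also have "\<dots> \<le> Max (range (\<lambda>i. \<bar>\<rho>\<bar> ^ s i))" by (rule Max_ge) auto
      also have "\<dots> \<le> real (Suc N)" using N by linarith
      finally show ?thesis by simp
    qed
    then show "snorm s ((1 / real (Suc N)) *\<^sub>R x) \<le> 1" using snorm_le_iff[OF assms, of 1] by simp
  qed
qed

lemma mem_sball: "y \<in> sball s x \<rho> \<longleftrightarrow> snorm s (y - x) \<le> \<rho>"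
  by (simp add: sball_def)

lemma sball_eq_cbox:
  fixes s :: "('d::finite) scaling"
  assumes "\<forall>i. 0 < s i" "0 \<le> \<rho>"
  shows "sball s x \<rho> = cbox (x - (\<chi> i. \<rho> ^ s i)) (x + (\<chi> i. \<rho> ^ s i))"
proof -
  have "y \<in> sball s x \<rho> \<longleftrightarrow> y \<in> cbox (x - (\<chi> i. \<rho> ^ s i)) (x + (\<chi> i. \<rho> ^ s i))" for y
  proof -
    have "\<bar>y $ i - x $ i\<bar> \<le> \<rho> ^ s i \<longleftrightarrow> x $ i - \<rho> ^ s i \<le> y $ i \<and> y $ i \<le> x $ i + \<rho> ^ s i" for i
      by linarith
    then show ?thesis by (simp add: mem_sball snorm_le_iff[OF assms] mem_box_cart)
  qed
  then show ?thesis by blast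
qed

lemma sets_sball [measurable]:
  assumes "\<forall>i. 0 < s i" "0 \<le> \<rho>" shows "sball s x \<rho> \<in> sets lebesgue"
  by (simp add: sball_eq_cbox[OF assms])

lemma emeasure_sball:
  fixes s :: "('d::finite) scaling"
  assumes "\<forall>i. 0 < s i" "0 \<le> \<rho>"
  shows "emeasure lebesgue (sball s x \<rho>) = ennreal (2 ^ CARD('d) * \<rho> ^ scal_size s)"
proof -
  define v :: "real^'d" where "v = (\<chi> i. \<rho> ^ s i)"
  have "x \<in> cbox (x - v) (x + v)" using assms by (simp add: mem_box_cart v_def)
  then have "measure lborel (cbox (x - v) (x + v)) = (\<Prod>i\<in>UNIV. (x + v) $ i - (x - v) $ i)"
    by (intro content_cbox_cart) auto
  also have "\<dots> = (\<Prod>i\<in>UNIV. 2 * \<rho> ^ s i)" by (simp add: v_def)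
  also have "\<dots> = 2 ^ CARD('d) * \<rho> ^ scal_size s"
    by (simp add: prod.distrib scal_size_def power_sum)
  finally have "measure lborel (cbox (x - v) (x + v)) = 2 ^ CARD('d) * \<rho> ^ scal_size s" .
  then have "emeasure lborel (cbox (x - v) (x + v)) = ennreal (2 ^ CARD('d) * \<rho> ^ scal_size s)"
    using emeasure_lborel_cbox_finite[of "x - v" "x + v"] by (simp add: emeasure_eq_ennreal_measure)
  then show ?thesis by (simp add: sball_eq_cbox[OF assms] v_def)
qed

lemma sball_sym: "y \<in> sball s x \<rho> \<longleftrightarrow> x \<in> sball s y \<rho>"
  by (simp add: mem_sball snorm_commute)

lemma sball_trans:
  assumes "\<forall>i. 0 < s i" "y \<in> sball s x a" "z \<in> sball s y b" shows "z \<in> sball s x (a + b)"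
  using snorm_triangle[OF assms(1), of "y - x" "z - y"] assms(2,3) by (simp add: mem_sball)

interpretation lebesgue: sigma_finite_measure "lebesgue :: 'a::euclidean_space measure"
proof
  obtain A :: "'a set set" where "countable A" "A \<subseteq> sets lborel" "\<Union>A = space lborel" "\<forall>a\<in>A. emeasure lborel a \<noteq> \<infinity>"
    using lborel.sigma_finite_countable by blast
  then show "\<exists>A :: 'a set set. countable A \<and> A \<subseteq> sets lebesgue \<and> \<Union>A = space lebesgue \<and> (\<forall>a\<in>A. emeasure lebesgue a \<noteq> \<infinity>)"
    by (intro exI[of _ A]) (auto simp: subset_eq)
qed

interpretation lebesgue2: pair_sigma_finite "lebesgue :: 'a::euclidean_space measure" "lebesgue :: 'b::euclidean_space measure" ..

text \<open>The product of two Lebesgue sigma-algebras contains the Borel sets of the product space and makes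
both projections measurable onto Lebesgue spaces.  Both facts are used together: balls give Borel
sets of pairs, while the functions integrated over them are only Lebesgue measurable.\<close>

lemma borel_imp_lebesgue_pair_measurable:
  fixes f :: "'a::euclidean_space \<times> 'b::euclidean_space \<Rightarrow> 'c"
  assumes "f \<in> measurable borel N"
  shows "f \<in> measurable (lebesgue \<Otimes>\<^sub>M lebesgue) N"
proof -
  have "(\<lambda>z. (fst z, snd z)) \<in> (lebesgue \<Otimes>\<^sub>M lebesgue) \<rightarrow>\<^sub>M (borel \<Otimes>\<^sub>M borel :: ('a \<times> 'b) measure)"
  proof (rule measurable_Pair)
    have *: "(\<lambda>x. x) \<in> lebesgue \<rightarrow>\<^sub>M (borel :: 'x::euclidean_space measure)"
      by (intro measurable_completion) simp
    show "fst \<in> (lebesgue \<Otimes>\<^sub>M lebesgue) \<rightarrow>\<^sub>M (borel :: 'a measure)"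
      by (rule measurable_compose[OF measurable_fst *])
    show "snd \<in> (lebesgue \<Otimes>\<^sub>M lebesgue) \<rightarrow>\<^sub>M (borel :: 'b measure)"
      by (rule measurable_compose[OF measurable_snd *])
  qed
  then have "(\<lambda>z. z) \<in> (lebesgue \<Otimes>\<^sub>M lebesgue) \<rightarrow>\<^sub>M (borel :: ('a \<times> 'b) measure)"
    by (simp add: borel_prod)
  from measurable_compose[OF this assms] show ?thesis by simp
qed

lemma sball_indicator_measurable:
  fixes s :: "('d::finite) scaling"
  assumes "\<forall>i. 0 < s i" "0 \<le> \<rho>"
  shows "(\<lambda>(x, u). indicator (sball s x \<rho>) u :: ennreal) \<in> borel_measurable (lebesgue \<Otimes>\<^sub>M lebesgue)"
proof (rule borel_imp_lebesgue_pair_measurable)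
  have "{z :: (real^'d) \<times> (real^'d). snorm s (snd z - fst z) \<le> \<rho>} = (\<Inter>i. {z. \<bar>snd z $ i - fst z $ i\<bar> \<le> \<rho> ^ s i})"
    by (auto simp: snorm_le_iff[OF assms])
  also have "closed \<dots>"
    by (intro closed_INT ballI closed_Collect_le continuous_intros)
  finally have [measurable]: "{z :: (real^'d) \<times> (real^'d). snorm s (snd z - fst z) \<le> \<rho>} \<in> sets borel"
    by (rule borel_closed)
  have "(\<lambda>(x, u). indicator (sball s x \<rho>) u :: ennreal) = indicator {z. snorm s (snd z - fst z) \<le> \<rho>}"
    by (auto simp: indicator_def mem_sball)
  then show "(\<lambda>(x, u). indicator (sball s x \<rho>) u :: ennreal) \<in> borel_measurable borel" by simp
qed

definition ball_integral :: "('d::finite) scaling \<Rightarrow> real \<Rightarrow> (real^'d \<Rightarrow> ennreal) \<Rightarrow> real^'d \<Rightarrow> ennreal" where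
  "ball_integral s \<rho> F x = (\<integral>\<^sup>+u\<in>sball s x \<rho>. F u \<partial>lebesgue)"

lemma ball_integral_joint_measurable:
  fixes s :: "('d::finite) scaling"
  assumes s: "\<forall>i. 0 < s i" "0 \<le> \<rho>"
    and K: "(\<lambda>(x, u). K x u) \<in> borel_measurable (lebesgue \<Otimes>\<^sub>M lebesgue)"
  shows "(\<lambda>x. ball_integral s \<rho> (K x) x) \<in> borel_measurable lebesgue"
proof -
  have "(\<lambda>(x, u). K x u * indicator (sball s x \<rho>) u) \<in> borel_measurable (lebesgue \<Otimes>\<^sub>M lebesgue)"
    using borel_measurable_times_ennreal[OF K sball_indicator_measurable[OF s]] by (simp add: split_def)
  from lebesgue.borel_measurable_nn_integral[OF this] show ?thesis
    by (simp add: ball_integral_def)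
qed

lemma measurable_snd_lebesgue:
  "F \<in> borel_measurable lebesgue \<Longrightarrow> (\<lambda>(x, u). F u) \<in> borel_measurable (lebesgue \<Otimes>\<^sub>M lebesgue)"
  using measurable_compose[OF measurable_snd] by (simp add: split_def)

lemma ball_integral_measurable:
  fixes s :: "('d::finite) scaling"
  assumes s: "\<forall>i. 0 < s i" "0 \<le> \<rho>" and F: "F \<in> borel_measurable lebesgue"
  shows "ball_integral s \<rho> F \<in> borel_measurable lebesgue"
  using ball_integral_joint_measurable[OF s measurable_snd_lebesgue[OF F]] by simp

text \<open>Tonelli's theorem and the symmetry of \<open>y \<in> sball s x \<rho>\<close> in \<open>x\<close> and \<open>y\<close>.\<close>

lemma nn_integral_ball_integral:
  fixes s :: "('d::finite) scaling"
  assumes s: "\<forall>i. 0 < s i" "0 \<le> \<rho>" and F[measurable]: "F \<in> borel_measurable lebesgue"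
  shows "(\<integral>\<^sup>+x. ball_integral s \<rho> F x \<partial>lebesgue) = emeasure lebesgue (sball s 0 \<rho>) * (\<integral>\<^sup>+x. F x \<partial>lebesgue)"
proof -
  have "(\<lambda>(x, u). F u * indicator (sball s x \<rho>) u) \<in> borel_measurable (lebesgue \<Otimes>\<^sub>M lebesgue)"
    using borel_measurable_times_ennreal[OF measurable_snd_lebesgue[OF F] sball_indicator_measurable[OF s]]
    by (simp add: split_def)
  then have "(\<integral>\<^sup>+x. ball_integral s \<rho> F x \<partial>lebesgue) = (\<integral>\<^sup>+u. (\<integral>\<^sup>+x. F u * indicator (sball s x \<rho>) u \<partial>lebesgue) \<partial>lebesgue)"
    unfolding ball_integral_def by (subst lebesgue2.Fubini') auto
  also have "\<dots> = (\<integral>\<^sup>+u. (\<integral>\<^sup>+x. F u * indicator (sball s u \<rho>) x \<partial>lebesgue) \<partial>lebesgue)"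
    by (intro nn_integral_cong) (auto simp: indicator_def sball_sym)
  also have "\<dots> = (\<integral>\<^sup>+u. F u * emeasure lebesgue (sball s 0 \<rho>) \<partial>lebesgue)"
    using s by (intro nn_integral_cong) (simp add: nn_integral_cmult_indicator emeasure_sball sets_sball del: emeasure_completion)
  finally show ?thesis by (simp add: nn_integral_multc mult.commute)
qed

lemma Lnorm_ball_integral:
  fixes s :: "('d::finite) scaling"
  assumes s: "\<forall>i. 0 < s i" "0 \<le> \<rho>" and p: "1 \<le> p" and F[measurable]: "F \<in> borel_measurable lebesgue"
  shows "Lp p (ball_integral s \<rho> F)
    \<le> emeasure lebesgue (sball s 0 \<rho>) * Lp p F"
proof -
  define m where "m = emeasure lebesgue (sball s 0 \<rho>)"
  have m: "emeasure lebesgue (sball s x \<rho>) = m" for x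
    unfolding m_def by (simp only: emeasure_sball[OF s])
  have "(\<integral>\<^sup>+x. ennpow (ball_integral s \<rho> F x) p \<partial>lebesgue)
      \<le> (\<integral>\<^sup>+x. ennpow m (p - 1) * ball_integral s \<rho> (\<lambda>u. ennpow (F u) p) x \<partial>lebesgue)"
    unfolding ball_integral_def
    by (intro nn_integral_mono order_trans[OF Jensen_nn_integral[OF p F sets_sball[OF s]]]) (simp add: m)
  also have "\<dots> = ennpow m (p - 1) * (m * (\<integral>\<^sup>+x. ennpow (F x) p \<partial>lebesgue))"
    using s by (subst nn_integral_cmult) (auto simp: nn_integral_ball_integral m_def intro!: ball_integral_measurable)
  also have "\<dots> = ennpow m p * (\<integral>\<^sup>+x. ennpow (F x) p \<partial>lebesgue)"
    using ennpow_add[of m "p - 1" 1] by (simp add: mult.assoc)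
  finally have "ennpow (\<integral>\<^sup>+x. ennpow (ball_integral s \<rho> F x) p \<partial>lebesgue) (1/p)
      \<le> ennpow (ennpow m p * (\<integral>\<^sup>+x. ennpow (F x) p \<partial>lebesgue)) (1/p)"
    using p by (intro ennpow_mono) auto
  then show ?thesis using p by (simp add: Lnorm_real ennpow_mult ennpow_inverse m_def)
qed

lemma ball_integral_mono_radius: "mono (\<lambda>\<rho>. ball_integral s \<rho> F x)"
  unfolding ball_integral_def
  by (intro monoI nn_integral_mono) (auto simp: indicator_def mem_sball)

text \<open>The radius \<open>4 * l\<close> is the one in the definition of the norms.\<close>

definition ball_avg :: "('d::finite) scaling \<Rightarrow> real \<Rightarrow> (real^'d \<Rightarrow> ennreal) \<Rightarrow> real^'d \<Rightarrow> ennreal" where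
  "ball_avg s l F x = ball_integral s (4 * l) F x / emeasure lebesgue (sball s 0 (4 * l))"

context
  fixes s :: "('d::finite) scaling" and l :: real
  assumes s: "\<forall>i. 0 < s i" and l: "0 < l"
begin

lemma ball_avg_le: "ball_avg s l F x \<le> ennreal (l powr (- real (scal_size s))) * ball_integral s (4 * l) F x"
proof -
  have "1 * l ^ scal_size s \<le> 2 ^ CARD('d) * (4 * l) ^ scal_size s"
    using l by (intro mult_mono power_mono) auto
  then have "1 / (2 ^ CARD('d) * (4 * l) ^ scal_size s) \<le> 1 / l ^ scal_size s"
    by (intro divide_left_mono) (use l in auto)
  also have "\<dots> = l powr (- real (scal_size s))"
    using l by (simp add: powr_minus_divide powr_realpow)
  finally have "inverse (emeasure lebesgue (sball s 0 (4 * l))) \<le> ennreal (l powr (- real (scal_size s)))"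
    using l s by (subst emeasure_sball) (auto simp: inverse_ennreal inverse_eq_divide intro!: ennreal_leI)
  then show ?thesis
    unfolding ball_avg_def divide_ennreal_def by (subst mult.commute) (rule mult_right_mono, auto)
qed

lemma ball_avg_mono:
  "(\<And>u. u \<in> sball s x (4 * l) \<Longrightarrow> F u \<le> G u) \<Longrightarrow> ball_avg s l F x \<le> ball_avg s l G x"
  unfolding ball_avg_def ball_integral_def divide_ennreal_def
  by (intro mult_right_mono[OF nn_integral_mono]) (auto simp: indicator_def)

lemma ball_avg_cmult:
  assumes [measurable]: "F \<in> borel_measurable lebesgue"
  shows "ball_avg s l (\<lambda>u. c * F u) x = c * ball_avg s l F x"
proof -
  have [measurable]: "sball s x (4 * l) \<in> sets lebesgue" using l s by simp
  show ?thesis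
    unfolding ball_avg_def ball_integral_def by (simp add: mult.assoc nn_integral_cmult ennreal_times_divide)
qed

lemma ball_avg_add:
  assumes [measurable]: "F \<in> borel_measurable lebesgue" "G \<in> borel_measurable lebesgue"
  shows "ball_avg s l (\<lambda>u. F u + G u) x = ball_avg s l F x + ball_avg s l G x"
proof -
  have [measurable]: "sball s x (4 * l) \<in> sets lebesgue" using l s by simp
  show ?thesis
    unfolding ball_avg_def ball_integral_def by (simp add: distrib_right nn_integral_add divide_ennreal_def)
qed

lemma ball_avg_sum:
  assumes [measurable]: "\<And>i. F i \<in> borel_measurable lebesgue"
  shows "ball_avg s l (\<lambda>u. \<Sum>i\<in>I. F i u) x = (\<Sum>i\<in>I. ball_avg s l (F i) x)"
proof (induction I rule: infinite_finite_induct)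
  case (insert i I)
  then show ?case by (simp add: ball_avg_add)
qed (simp_all add: ball_avg_def ball_integral_def)

lemma ball_avg_const: "ball_avg s l (\<lambda>_. c) x = c"
proof -
  have "sball s x (4 * l) \<in> sets lebesgue" using l s by simp
  moreover have "emeasure lebesgue (sball s x (4 * l)) = emeasure lebesgue (sball s 0 (4 * l))"
    "emeasure lebesgue (sball s 0 (4 * l)) \<noteq> 0" "emeasure lebesgue (sball s 0 (4 * l)) < top"
    using l s by (auto simp: emeasure_sball simp del: emeasure_completion)
  ultimately show ?thesis
    unfolding ball_avg_def ball_integral_def
    by (simp add: nn_integral_cmult_indicator ennreal_mult_divide_eq del: emeasure_completion)
qed

end

text \<open>On \<open>dyadic n\<close> the second factor of the weight dominates the inverse of the volume of a ball of
radius \<open>4 * l\<close>.  Hence this is a bound for the supremum over all \<open>l\<close> of \<open>l powr \<epsilon>\<close> times the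
average over the ball of radius \<open>4 * l\<close>.\<close>

definition frac_maximal :: "('d::finite) scaling \<Rightarrow> real \<Rightarrow> (real^'d \<Rightarrow> ennreal) \<Rightarrow> real^'d \<Rightarrow> ennreal" where
  "frac_maximal s \<epsilon> F x = (SUP n. ennreal (((1/2)^n) powr \<epsilon> * (2 ^ Suc n) powr real (scal_size s))
     * ball_integral s (4 * (1/2)^n) F x)"

lemma frac_maximal_measurable:
  fixes s :: "('d::finite) scaling"
  assumes s: "\<forall>i. 0 < s i" and F[measurable]: "F \<in> borel_measurable lebesgue"
  shows "frac_maximal s \<epsilon> F \<in> borel_measurable lebesgue"
proof -
  have [measurable]: "ball_integral s (4 * (1/2)^n) F \<in> borel_measurable lebesgue" for n
    using s F by (intro ball_integral_measurable) auto
  show ?thesis unfolding frac_maximal_def by measurable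
qed

lemma frac_maximal_ge:
  fixes s :: "('d::finite) scaling"
  assumes s: "\<forall>i. 0 < s i" and l: "l \<in> dyadic n"
  shows "ennreal (((1/2)^n) powr \<epsilon>) * ball_avg s l F x \<le> frac_maximal s \<epsilon> F x"
proof -
  have l01: "0 < l" "l \<le> (1/2)^n" using l dyadic_subset[of n] by (auto simp: dyadic_def)
  have "ball_avg s l F x \<le> ennreal (l powr (- real (scal_size s))) * ball_integral s (4 * l) F x"
    by (rule ball_avg_le[OF s l01(1)])
  also have "\<dots> \<le> ennreal ((2 ^ Suc n) powr real (scal_size s)) * ball_integral s (4 * (1/2)^n) F x"
    using l01 by (intro mult_mono ennreal_leI powr_dyadic_le[OF l] monoD[OF ball_integral_mono_radius]) auto
  finally have "ennreal (((1/2)^n) powr \<epsilon>) * ball_avg s l F x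
      \<le> ennreal (((1/2)^n) powr \<epsilon> * (2 ^ Suc n) powr real (scal_size s)) * ball_integral s (4 * (1/2)^n) F x"
    by (simp add: ennreal_mult mult.assoc mult_left_mono del: power_Suc)
  also have "\<dots> \<le> frac_maximal s \<epsilon> F x"
    unfolding frac_maximal_def by (intro SUP_upper) auto
  finally show ?thesis .
qed

text \<open>The supremum over the scales is at most the \<open>\<ell>\<^sup>p\<close> norm over the scales, which can be exchanged
with the \<open>L\<^sup>p\<close> norm.  By Jensen's inequality each averaging operator is bounded on \<open>L\<^sup>p\<close>
uniformly in the scale, so that the \<open>n\<close>-th term decays like \<open>(1/2) powr (n * \<epsilon>)\<close>.\<close>

lemma Lnorm_frac_maximal:
  fixes s :: "('d::finite) scaling"
  assumes s: "\<forall>i. 0 < s i" and p: "1 \<le> p" and \<epsilon>: "0 < \<epsilon>"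
  obtains C :: real where "0 \<le> C"
    "\<And>F. F \<in> borel_measurable lebesgue \<Longrightarrow>
      Lp p (frac_maximal s \<epsilon> F) \<le> ennreal C * Lp p F"
proof -
  define c where "c = (\<lambda>n::nat. ((1/2)^n) powr \<epsilon> * (2 ^ Suc n) powr real (scal_size s) :: real)"
  define K :: real where "K = 2 ^ CARD('d) * 8 ^ scal_size s"
  define C where "C = K * (1 / (1 - (1/2) powr \<epsilon>))"
  have lt: "(1/2) powr \<epsilon> < (1::real)" using \<epsilon> by (simp add: powr01_less_one)
  show ?thesis
  proof
    show "0 \<le> C" using lt by (simp add: C_def K_def)
    fix F :: "real^'d \<Rightarrow> ennreal" assume F[measurable]: "F \<in> borel_measurable lebesgue"
    define a where "a = (\<lambda>n x. ennreal (c n) * ball_integral s (4 * (1/2)^n) F x)"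
    have bm[measurable]: "ball_integral s (4 * (1/2)^n) F \<in> borel_measurable lebesgue" for n
      using s F by (intro ball_integral_measurable) auto
    have [measurable]: "a n \<in> borel_measurable lebesgue" for n unfolding a_def by measurable
    have an: "Lp p (a n) \<le> ennreal K * Lp p F * ennreal (((1/2)^n) powr \<epsilon>)" for n
    proof -
      have "Lp p (a n) = ennreal (c n) * Lp p (ball_integral s (4 * (1/2)^n) F)"
        unfolding a_def using p by (intro Lnorm_real_cmult) auto
      also have "\<dots> \<le> ennreal (c n) * (emeasure lebesgue (sball s 0 (4 * (1/2)^n)) * Lp p F)"
        using s p by (intro mult_left_mono Lnorm_ball_integral) auto
      also have "\<dots> = ennreal (c n * (2 ^ CARD('d) * (4 * (1/2)^n) ^ scal_size s)) * Lp p F"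
        using s by (simp add: emeasure_sball ennreal_mult mult.assoc c_def del: emeasure_completion)
      also have "c n * (2 ^ CARD('d) * (4 * (1/2)^n) ^ scal_size s) = K * ((1/2)^n) powr \<epsilon>"
      proof -
        have "(2 ^ Suc n) powr real (scal_size s) * (4 * (1/2)^n) ^ scal_size s = (8::real) ^ scal_size s"
          unfolding powr_realpow[OF zero_less_power[OF zero_less_numeral]] power_mult_distrib[symmetric]
          by (simp add: power_one_over)
        then show ?thesis by (simp add: c_def K_def mult_ac)
      qed
      finally show ?thesis by (simp add: ennreal_mult K_def mult_ac)
    qed
    have "frac_maximal s \<epsilon> F x = (SUP n. a n x)" for x
      by (simp add: frac_maximal_def a_def c_def)
    then have "frac_maximal s \<epsilon> F x \<le> lq_norm (ennreal p) (\<lambda>n. a n x)" for x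
      using p lq_norm_ge[of "ennreal p" "\<lambda>n. a n x"] by (auto intro!: SUP_least)
    then have "Lp p (frac_maximal s \<epsilon> F) \<le> Lp p (\<lambda>x. lq_norm (ennreal p) (\<lambda>n. a n x))"
      using p by (intro Lnorm_real_mono) auto
    also have "\<dots> = lq_norm (ennreal p) (\<lambda>n. Lp p (a n))"
      using p by (simp add: Lnorm_real lq_norm_real ennpow_inverse' nn_integral_suminf)
    also have "\<dots> \<le> lq_norm (ennreal p) (\<lambda>n. ennreal K * Lp p F * ennreal (((1/2)^n) powr \<epsilon>))"
      using p an by (intro lq_norm_mono) auto
    also have "\<dots> = ennreal K * Lp p F * lq_norm (ennreal p) (\<lambda>n. ennreal (((1/2)^n) powr \<epsilon>))"
      using p by (intro lq_norm_cmult) auto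
    also have "\<dots> \<le> ennreal K * Lp p F * ennreal (1 / (1 - (1/2) powr \<epsilon>))"
      using p \<epsilon> by (intro mult_left_mono lq_norm_geometric) auto
    also have "\<dots> = ennreal C * Lp p F"
      using lt unfolding C_def by (subst ennreal_mult) (auto simp: K_def mult_ac)
    finally show "Lp p (frac_maximal s \<epsilon> F) \<le> ennreal C * Lp p F" .
  qed
qed

section \<open>Homogeneous components, sectors and products\<close>

locale reg_struct =
  fixes R :: "('t::real_vector) reg_structure"
  assumes reg: "regularity_structure R"
begin

abbreviation "N \<equiv> homnorm R"
abbreviation "below \<equiv> homs_below R"

lemma finite_homs_below: "finite (below \<gamma>)"
proof -
  have "bdd_below (homs R)" using reg by (simp add: regularity_structure_def)
  then obtain m where m: "\<And>a. a \<in> homs R \<Longrightarrow> m \<le> a"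
    by (auto simp: bdd_below_def)
  have "below \<gamma> \<subseteq> homs R \<inter> {m..\<gamma>}" using m by (auto simp: homs_below_def)
  then show ?thesis using reg unfolding regularity_structure_def by (meson finite_subset)
qed

lemma banach: "banach_subspace (homspace R \<zeta>) (N \<zeta>)"
  using reg by (simp add: regularity_structure_def)

lemma homspace_notin: "\<zeta> \<notin> homs R \<Longrightarrow> homspace R \<zeta> = {0}"
  using reg by (simp add: regularity_structure_def)

lemma subspace_homspace: "subspace (homspace R \<zeta>)"
  using banach by (simp add: banach_subspace_def)

lemmas homspace_0 = subspace_0[OF subspace_homspace]
  and homspace_add = subspace_add[OF subspace_homspace]
  and homspace_diff = subspace_diff[OF subspace_homspace]
  and homspace_scale = subspace_scale[OF subspace_homspace]
  and homspace_sum = subspace_sum[OF subspace_homspace]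
  and homspace_neg = subspace_neg[OF subspace_homspace]

lemma N_nonneg: "\<tau> \<in> homspace R \<zeta> \<Longrightarrow> 0 \<le> N \<zeta> \<tau>"
  using banach by (simp add: banach_subspace_def)

lemma N_zero: "N \<zeta> 0 = 0"
  using banach[of \<zeta>] homspace_0[of \<zeta>] unfolding banach_subspace_def by blast

lemma N_triangle: "\<sigma> \<in> homspace R \<zeta> \<Longrightarrow> \<tau> \<in> homspace R \<zeta> \<Longrightarrow> N \<zeta> (\<sigma> + \<tau>) \<le> N \<zeta> \<sigma> + N \<zeta> \<tau>"
  using banach by (simp add: banach_subspace_def)

lemma N_minus: "\<tau> \<in> homspace R \<zeta> \<Longrightarrow> N \<zeta> (- \<tau>) = N \<zeta> \<tau>"
  using banach[of \<zeta>] unfolding banach_subspace_def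
  by (metis abs_minus_cancel abs_one mult_1 scaleR_minus1_left)

lemma N_diff: "\<sigma> \<in> homspace R \<zeta> \<Longrightarrow> \<tau> \<in> homspace R \<zeta> \<Longrightarrow> N \<zeta> (\<sigma> - \<tau>) \<le> N \<zeta> \<sigma> + N \<zeta> \<tau>"
  using N_triangle[of \<sigma> \<zeta> "- \<tau>"] N_minus homspace_neg by simp

lemma subspace_hsum: "subspace (hsum R B)"
  by (simp add: hsum_def)

lemmas hsum_0 = subspace_0[OF subspace_hsum]
  and hsum_add = subspace_add[OF subspace_hsum]
  and hsum_diff = subspace_diff[OF subspace_hsum]
  and hsum_scale = subspace_scale[OF subspace_hsum]
  and hsum_sum = subspace_sum[OF subspace_hsum]

lemma hsum_mono: "B \<subseteq> B' \<Longrightarrow> hsum R B \<subseteq> hsum R B'"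
  unfolding hsum_def by (intro span_mono) auto

lemma homspace_hsum:
  assumes "\<tau> \<in> homspace R \<zeta>" "\<zeta> \<in> B" shows "\<tau> \<in> hsum R B"
proof (cases "\<zeta> \<in> homs R")
  case True
  then show ?thesis unfolding hsum_def using assms by (intro span_base) auto
next
  case False
  then show ?thesis using assms homspace_notin hsum_0 by auto
qed

lemma hproj_ex1: "\<exists>!\<sigma>. \<sigma> \<in> homspace R \<zeta> \<and> \<tau> - \<sigma> \<in> hsum R (- {\<zeta>})"
proof (cases "\<zeta> \<in> homs R")
  case True
  have "\<tau> \<in> hsum R UNIV" using reg by (simp add: regularity_structure_def)
  also have "hsum R UNIV = span (homspace R \<zeta> \<union> (\<Union>\<beta>\<in>homs R \<inter> - {\<zeta>}. homspace R \<beta>))"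
    unfolding hsum_def using True by (intro arg_cong[where f=span]) auto
  finally obtain x y where xy: "x \<in> span (homspace R \<zeta>)" "y \<in> hsum R (- {\<zeta>})" "\<tau> = x + y"
    unfolding span_Un hsum_def by auto
  have x: "x \<in> homspace R \<zeta>" using xy(1) subspace_homspace by (metis span_eq_iff)
  show ?thesis
  proof (intro ex1I[of _ x] conjI)
    show "x \<in> homspace R \<zeta>" by fact
    show "\<tau> - x \<in> hsum R (- {\<zeta>})" using xy by simp
    fix \<sigma> assume *: "\<sigma> \<in> homspace R \<zeta> \<and> \<tau> - \<sigma> \<in> hsum R (- {\<zeta>})"
    have "\<sigma> - x \<in> homspace R \<zeta>" using * x homspace_diff by auto
    moreover have "\<sigma> - x = (\<tau> - x) - (\<tau> - \<sigma>)" by simp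
    then have "\<sigma> - x \<in> hsum R (- {\<zeta>})" using * xy hsum_diff by (metis add_diff_cancel_left')
    ultimately have "\<sigma> - x \<in> {0}" using reg True unfolding regularity_structure_def by blast
    then show "\<sigma> = x" by simp
  qed
next
  case False
  have "homs R \<inter> - {\<zeta>} = homs R" using False by auto
  then have "hsum R (- {\<zeta>}) = UNIV" using reg by (simp add: regularity_structure_def hsum_def)
  then show ?thesis using homspace_notin[OF False] by auto
qed

lemma hproj_in: "hproj R \<zeta> \<tau> \<in> homspace R \<zeta>" and hproj_diff: "\<tau> - hproj R \<zeta> \<tau> \<in> hsum R (- {\<zeta>})"
  using theI'[OF hproj_ex1[of \<zeta> \<tau>]] unfolding hproj_def by auto

lemma hproj_unique: "\<sigma> \<in> homspace R \<zeta> \<Longrightarrow> \<tau> - \<sigma> \<in> hsum R (- {\<zeta>}) \<Longrightarrow> hproj R \<zeta> \<tau> = \<sigma>"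
  using hproj_ex1[of \<zeta> \<tau>] hproj_in[of \<zeta> \<tau>] hproj_diff[of \<tau> \<zeta>] by blast

lemma linear_hproj: "linear (hproj R \<zeta>)"
proof
  fix \<sigma> \<tau> c
  have "\<sigma> + \<tau> - (hproj R \<zeta> \<sigma> + hproj R \<zeta> \<tau>) = (\<sigma> - hproj R \<zeta> \<sigma>) + (\<tau> - hproj R \<zeta> \<tau>)" by simp
  then show "hproj R \<zeta> (\<sigma> + \<tau>) = hproj R \<zeta> \<sigma> + hproj R \<zeta> \<tau>"
    by (intro hproj_unique homspace_add hproj_in) (metis hproj_diff hsum_add)
  have "c *\<^sub>R \<sigma> - c *\<^sub>R hproj R \<zeta> \<sigma> = c *\<^sub>R (\<sigma> - hproj R \<zeta> \<sigma>)" by (simp add: scaleR_diff_right)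
  then show "hproj R \<zeta> (c *\<^sub>R \<sigma>) = c *\<^sub>R hproj R \<zeta> \<sigma>"
    by (intro hproj_unique homspace_scale hproj_in) (metis hproj_diff hsum_scale)
qed

lemmas hproj_add = linear_add[OF linear_hproj]
  and hproj_minus = linear_neg[OF linear_hproj]
  and hproj_sub = linear_diff[OF linear_hproj]
  and hproj_sum = linear_sum[OF linear_hproj]
  and hproj_0 = linear_0[OF linear_hproj]

lemma hproj_same: "\<tau> \<in> homspace R \<zeta> \<Longrightarrow> hproj R \<zeta> \<tau> = \<tau>"
  by (intro hproj_unique) (auto simp: hsum_0)

lemma hproj_hsum_zero: "\<tau> \<in> hsum R B \<Longrightarrow> \<zeta> \<notin> B \<Longrightarrow> hproj R \<zeta> \<tau> = 0"
  using hsum_mono[of B "- {\<zeta>}"] by (intro hproj_unique) (auto simp: homspace_0)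

lemma hproj_other: "\<tau> \<in> homspace R \<beta> \<Longrightarrow> \<beta> \<noteq> \<zeta> \<Longrightarrow> hproj R \<zeta> \<tau> = 0"
  using hproj_hsum_zero[of \<tau> "{\<beta>}" \<zeta>] homspace_hsum by auto

lemma hproj_homspace: "\<tau> \<in> homspace R \<beta> \<Longrightarrow> hproj R \<zeta> \<tau> = (if \<zeta> = \<beta> then \<tau> else 0)"
  using hproj_same hproj_other by auto

lemma hproj_notin: "\<zeta> \<notin> homs R \<Longrightarrow> hproj R \<zeta> \<tau> = 0"
  using hproj_in[of \<zeta> \<tau>] homspace_notin by auto

lemma hsum_decomp:
  assumes "finite (homs R \<inter> B)" "\<tau> \<in> hsum R B"
  shows "\<tau> = (\<Sum>\<zeta>\<in>homs R \<inter> B. hproj R \<zeta> \<tau>)"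
  using assms(2) unfolding hsum_def
proof (induction rule: span_induct)
  case base
  show ?case
    by (auto simp: subspace_def hproj_0 hproj_add linear_scale[OF linear_hproj] sum.distrib scaleR_sum_right[symmetric])
next
  case (step \<tau>)
  then obtain \<beta> where \<beta>: "\<beta> \<in> homs R \<inter> B" "\<tau> \<in> homspace R \<beta>" by auto
  then show ?case using assms(1) by (simp add: hproj_homspace)
qed

lemma decomp_below: "\<tau> \<in> hsum R {..<\<gamma>} \<Longrightarrow> \<tau> = (\<Sum>\<zeta>\<in>below \<gamma>. hproj R \<zeta> \<tau>)"
  using hsum_decomp[of "{..<\<gamma>}"] finite_homs_below[of \<gamma>] by (simp add: homs_below_def)

abbreviation "esize \<zeta> \<tau> \<equiv> ennreal (hsize R \<zeta> \<tau>)"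

lemma hsize_nonneg: "0 \<le> hsize R \<zeta> \<tau>"
  by (simp add: hsize_def N_nonneg hproj_in)

lemma hsize_0 [simp]: "hsize R \<zeta> 0 = 0"
  by (simp add: hsize_def hproj_0 N_zero)

lemma hsize_add: "hsize R \<zeta> (\<sigma> + \<tau>) \<le> hsize R \<zeta> \<sigma> + hsize R \<zeta> \<tau>"
  by (simp add: hsize_def hproj_add N_triangle hproj_in)

lemma hsize_diff: "hsize R \<zeta> (\<sigma> - \<tau>) \<le> hsize R \<zeta> \<sigma> + hsize R \<zeta> \<tau>"
  by (simp add: hsize_def hproj_sub N_diff hproj_in)

lemma hsize_minus: "hsize R \<zeta> (- \<tau>) = hsize R \<zeta> \<tau>"
  by (simp add: hsize_def hproj_minus N_minus hproj_in)

lemma hsize_diff_le: "\<bar>hsize R \<zeta> \<sigma> - hsize R \<zeta> \<tau>\<bar> \<le> hsize R \<zeta> (\<sigma> - \<tau>)"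
  using hsize_add[of \<zeta> \<tau> "\<sigma> - \<tau>"] hsize_diff[of \<zeta> \<sigma> "\<sigma> - \<tau>"] by simp

lemma hsize_sum: "hsize R \<zeta> (\<Sum>i\<in>I. f i) \<le> (\<Sum>i\<in>I. hsize R \<zeta> (f i))"
  by (induction I rule: infinite_finite_induct)
    (auto intro: order_trans[OF hsize_add])

lemma hsize_homspace: "\<tau> \<in> homspace R \<beta> \<Longrightarrow> hsize R \<zeta> \<tau> = (if \<zeta> = \<beta> then N \<zeta> \<tau> else 0)"
  by (simp add: hsize_def hproj_homspace N_zero)

lemma hsize_hproj: "hsize R \<zeta> (hproj R \<beta> \<tau>) = (if \<zeta> = \<beta> then hsize R \<zeta> \<tau> else 0)"
  using hsize_homspace[OF hproj_in, of \<zeta> \<beta> \<tau>] by (auto simp: hsize_def)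

lemma hsize_hsum_zero: "\<tau> \<in> hsum R B \<Longrightarrow> \<zeta> \<notin> B \<Longrightarrow> hsize R \<zeta> \<tau> = 0"
  by (simp add: hsize_def hproj_hsum_zero N_zero)

lemma hsize_notin: "\<zeta> \<notin> homs R \<Longrightarrow> hsize R \<zeta> \<tau> = 0"
  by (simp add: hsize_def hproj_notin N_zero)

lemma sgroup_linear: "G \<in> sgroup R \<Longrightarrow> linear G"
  using reg by (simp add: regularity_structure_def)

lemma sgroup_diff:
  assumes "G \<in> sgroup R" "\<tau> \<in> homspace R \<zeta>" shows "G \<tau> - \<tau> \<in> hsum R {..<\<zeta>}"
proof (cases "\<zeta> \<in> homs R")
  case True
  then show ?thesis using reg assms by (simp add: regularity_structure_def)
next
  case False
  then have "\<tau> = 0" using assms homspace_notin by auto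
  then show ?thesis using linear_0[OF sgroup_linear[OF assms(1)]] hsum_0 by simp
qed

text \<open>A structure group element changes a homogeneous element by lower components only, hence preserves
the span of all components below \<open>\<gamma>\<close>.\<close>

lemma sgroup_hsum:
  assumes "G \<in> sgroup R" "\<tau> \<in> hsum R {..<\<gamma>}" shows "G \<tau> \<in> hsum R {..<\<gamma>}"
proof -
  have "G (hproj R \<zeta> \<tau>) \<in> hsum R {..<\<gamma>}" if "\<zeta> \<in> below \<gamma>" for \<zeta>
  proof -
    have "\<zeta> < \<gamma>" using that by (simp add: homs_below_def)
    then have "G (hproj R \<zeta> \<tau>) - hproj R \<zeta> \<tau> \<in> hsum R {..<\<gamma>}" "hproj R \<zeta> \<tau> \<in> hsum R {..<\<gamma>}"
      using sgroup_diff[OF assms(1) hproj_in] hsum_mono[of "{..<\<zeta>}" "{..<\<gamma>}"] homspace_hsum[OF hproj_in] by auto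
    from hsum_add[OF this] show ?thesis by simp
  qed
  moreover have "G \<tau> = (\<Sum>\<zeta>\<in>below \<gamma>. G (hproj R \<zeta> \<tau>))"
    using decomp_below[OF assms(2)] linear_sum[OF sgroup_linear[OF assms(1)]] by metis
  ultimately show ?thesis by (simp add: hsum_sum)
qed

lemma hproj_sgroup:
  assumes "G \<in> sgroup R" "\<tau> \<in> homspace R \<zeta>" "\<zeta> \<le> \<beta>"
  shows "hproj R \<beta> (G \<tau>) = hproj R \<beta> \<tau>"
  using hproj_hsum_zero[OF sgroup_diff[OF assms(1,2)], of \<beta>] assms(3) by (simp add: hproj_sub)

lemma truncate_hsum: "truncate R \<gamma> \<tau> \<in> hsum R {..<\<gamma>}"
  unfolding truncate_def by (intro hsum_sum homspace_hsum[OF hproj_in]) (auto simp: homs_below_def)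

lemma hproj_truncate: "hproj R \<zeta> (truncate R \<gamma> \<tau>) = (if \<zeta> < \<gamma> then hproj R \<zeta> \<tau> else 0)"
proof -
  have "hproj R \<zeta> (truncate R \<gamma> \<tau>) = (\<Sum>\<beta>\<in>below \<gamma>. if \<zeta> = \<beta> then hproj R \<zeta> \<tau> else 0)"
    unfolding truncate_def hproj_sum
    by (intro sum.cong refl) (simp add: hproj_homspace[OF hproj_in])
  also have "\<dots> = (if \<zeta> \<in> below \<gamma> then hproj R \<zeta> \<tau> else 0)" by (simp add: finite_homs_below)
  finally show ?thesis using hproj_notin by (auto simp: homs_below_def)
qed

lemma sector_subspace: "sector R U \<Longrightarrow> subspace U"
  unfolding sector_def by (metis subspace_span)

lemma sector_sgroup: "sector R U \<Longrightarrow> G \<in> sgroup R \<Longrightarrow> \<tau> \<in> U \<Longrightarrow> G \<tau> \<in> U"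
  by (simp add: sector_def)

text \<open>A sector is spanned by its homogeneous elements, and the elements whose projection stays in \<open>U\<close> form
a subspace that contains these.\<close>

lemma sector_hproj:
  assumes U: "sector R U" and "\<tau> \<in> U" shows "hproj R \<zeta> \<tau> \<in> U"
proof -
  have "\<tau> \<in> span (\<Union>a\<in>homs R. U \<inter> homspace R a)" using assms by (simp add: sector_def)
  then show ?thesis
  proof (induction rule: span_induct)
    case base
    show ?case using sector_subspace[OF U]
      by (auto simp: subspace_def hproj_0 hproj_add linear_scale[OF linear_hproj])
  next
    case (step \<tau>)
    then show ?case using subspace_0[OF sector_subspace[OF U]] by (auto simp: hproj_homspace)
  qed
qed

end

locale sector_prod = reg_struct R for R :: "('t::real_vector) reg_structure" +
  fixes V W :: "'t set" and star :: "'t \<Rightarrow> 't \<Rightarrow> 't" (infixl "\<star>" 70)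
  assumes V: "sector R V" and W: "sector R W" and product: "sector_product R V W star"
begin

lemma star_add_left: "\<sigma> \<in> V \<Longrightarrow> \<tau> \<in> V \<Longrightarrow> \<rho> \<in> W \<Longrightarrow> (\<sigma> + \<tau>) \<star> \<rho> = \<sigma> \<star> \<rho> + \<tau> \<star> \<rho>"
  and star_add_right: "\<rho> \<in> V \<Longrightarrow> \<sigma> \<in> W \<Longrightarrow> \<tau> \<in> W \<Longrightarrow> \<rho> \<star> (\<sigma> + \<tau>) = \<rho> \<star> \<sigma> + \<rho> \<star> \<tau>"
  and star_scale_left: "\<sigma> \<in> V \<Longrightarrow> \<tau> \<in> W \<Longrightarrow> (c *\<^sub>R \<sigma>) \<star> \<tau> = c *\<^sub>R (\<sigma> \<star> \<tau>)"
  and star_scale_right: "\<sigma> \<in> V \<Longrightarrow> \<tau> \<in> W \<Longrightarrow> \<sigma> \<star> (c *\<^sub>R \<tau>) = c *\<^sub>R (\<sigma> \<star> \<tau>)"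
  using product by (simp_all add: sector_product_def)

lemma star_0_left: "\<tau> \<in> W \<Longrightarrow> 0 \<star> \<tau> = 0"
  using star_scale_left[of 0 \<tau> 0] subspace_0[OF sector_subspace[OF V]] by simp

lemma star_0_right: "\<sigma> \<in> V \<Longrightarrow> \<sigma> \<star> 0 = 0"
  using star_scale_right[of \<sigma> 0 0] subspace_0[OF sector_subspace[OF W]] by simp

lemma star_sum_left: "(\<And>i. i \<in> I \<Longrightarrow> f i \<in> V) \<Longrightarrow> \<tau> \<in> W \<Longrightarrow> (\<Sum>i\<in>I. f i) \<star> \<tau> = (\<Sum>i\<in>I. f i \<star> \<tau>)"
  by (induction I rule: infinite_finite_induct)
    (auto simp: star_0_left star_add_left subspace_sum[OF sector_subspace[OF V]])

lemma star_sum_right: "(\<And>i. i \<in> I \<Longrightarrow> f i \<in> W) \<Longrightarrow> \<sigma> \<in> V \<Longrightarrow> \<sigma> \<star> (\<Sum>i\<in>I. f i) = (\<Sum>i\<in>I. \<sigma> \<star> f i)"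
  by (induction I rule: infinite_finite_induct)
    (auto simp: star_0_right star_add_right subspace_sum[OF sector_subspace[OF W]])

lemma star_diff_left: "\<sigma> \<in> V \<Longrightarrow> \<tau> \<in> V \<Longrightarrow> \<rho> \<in> W \<Longrightarrow> (\<sigma> - \<tau>) \<star> \<rho> = \<sigma> \<star> \<rho> - \<tau> \<star> \<rho>"
  using star_add_left[of "\<sigma> - \<tau>" \<tau> \<rho>] subspace_diff[OF sector_subspace[OF V]] by (simp add: algebra_simps)

lemma star_diff_right: "\<rho> \<in> V \<Longrightarrow> \<sigma> \<in> W \<Longrightarrow> \<tau> \<in> W \<Longrightarrow> \<rho> \<star> (\<sigma> - \<tau>) = \<rho> \<star> \<sigma> - \<rho> \<star> \<tau>"
  using star_add_right[of \<rho> "\<sigma> - \<tau>" \<tau>] subspace_diff[OF sector_subspace[OF W]] by (simp add: algebra_simps)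

lemma star_homspace:
  assumes "\<sigma> \<in> V" "\<sigma> \<in> homspace R a" "\<tau> \<in> W" "\<tau> \<in> homspace R b"
  shows "\<sigma> \<star> \<tau> \<in> homspace R (a + b)"
proof (cases "a \<in> homs R \<and> b \<in> homs R")
  case True
  then show ?thesis using product assms by (simp add: sector_product_def)
next
  case False
  then have "\<sigma> = 0 \<or> \<tau> = 0" using assms homspace_notin by blast
  then show ?thesis using assms star_0_left star_0_right homspace_0 by auto
qed

lemma star_decomp:
  assumes "\<sigma> \<in> V" "\<sigma> \<in> hsum R {..<\<gamma>\<^sub>1}" "\<tau> \<in> W" "\<tau> \<in> hsum R {..<\<gamma>\<^sub>2}"
  shows "\<sigma> \<star> \<tau> = (\<Sum>a\<in>below \<gamma>\<^sub>1. \<Sum>b\<in>below \<gamma>\<^sub>2. hproj R a \<sigma> \<star> hproj R b \<tau>)"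
proof -
  have "\<sigma> \<star> \<tau> = (\<Sum>a\<in>below \<gamma>\<^sub>1. hproj R a \<sigma>) \<star> (\<Sum>b\<in>below \<gamma>\<^sub>2. hproj R b \<tau>)"
    using decomp_below assms by metis
  then show ?thesis using assms sector_hproj V W
    by (simp add: star_sum_left star_sum_right subspace_sum[OF sector_subspace]) (rule sum.swap)
qed

text \<open>Multiplicativity of \<open>G\<close>, postulated for homogeneous elements, extends by bilinearity to the finite
sums of homogeneous elements.\<close>

lemma star_sgroup:
  assumes "\<sigma> \<in> V" "\<sigma> \<in> hsum R {..<\<gamma>\<^sub>1}" "\<tau> \<in> W" "\<tau> \<in> hsum R {..<\<gamma>\<^sub>2}" "G \<in> sgroup R"
  shows "G (\<sigma> \<star> \<tau>) = G \<sigma> \<star> G \<tau>"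
proof -
  have G: "linear G" using sgroup_linear assms by blast
  have hom: "G (hproj R a \<sigma> \<star> hproj R b \<tau>) = G (hproj R a \<sigma>) \<star> G (hproj R b \<tau>)"
    if "a \<in> below \<gamma>\<^sub>1" "b \<in> below \<gamma>\<^sub>2" for a b
    using product assms sector_hproj[OF V, of \<sigma> a] sector_hproj[OF W, of \<tau> b] hproj_in that
    unfolding sector_product_def homs_below_def by blast
  have "G (\<sigma> \<star> \<tau>) = (\<Sum>a\<in>below \<gamma>\<^sub>1. \<Sum>b\<in>below \<gamma>\<^sub>2. G (hproj R a \<sigma>) \<star> G (hproj R b \<tau>))"
    using hom by (subst star_decomp[OF assms(1-4)]) (simp add: linear_sum[OF G])
  also have "\<dots> = (\<Sum>a\<in>below \<gamma>\<^sub>1. G (hproj R a \<sigma>)) \<star> (\<Sum>b\<in>below \<gamma>\<^sub>2. G (hproj R b \<tau>))"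
    using assms sector_hproj sector_sgroup V W
    by (simp add: star_sum_left star_sum_right subspace_sum[OF sector_subspace]) (rule sum.swap)
  also have "\<dots> = G \<sigma> \<star> G \<tau>"
    using decomp_below[OF assms(2)] decomp_below[OF assms(4)] linear_sum[OF G] by metis
  finally show ?thesis .
qed

definition star_bounded :: "real \<Rightarrow> real \<Rightarrow> real \<Rightarrow> bool" where
  "star_bounded \<gamma>\<^sub>1 \<gamma>\<^sub>2 K \<longleftrightarrow> 0 \<le> K \<and>
     (\<forall>a\<in>below \<gamma>\<^sub>1. \<forall>b\<in>below \<gamma>\<^sub>2. \<forall>\<sigma>\<in>V \<inter> homspace R a. \<forall>\<tau>\<in>W \<inter> homspace R b. N (a + b) (\<sigma> \<star> \<tau>) \<le> K * N a \<sigma> * N b \<tau>)"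

lemma star_bounded_ex: "\<exists>K. star_bounded \<gamma>\<^sub>1 \<gamma>\<^sub>2 K"
proof -
  have "\<exists>C. \<forall>\<sigma>\<in>V \<inter> homspace R a. \<forall>\<tau>\<in>W \<inter> homspace R b. N (a + b) (\<sigma> \<star> \<tau>) \<le> C * N a \<sigma> * N b \<tau>"
    if "a \<in> below \<gamma>\<^sub>1" "b \<in> below \<gamma>\<^sub>2" for a b
    using product that unfolding sector_product_def homs_below_def by blast
  then obtain C where C: "\<And>a b \<sigma> \<tau>. a \<in> below \<gamma>\<^sub>1 \<Longrightarrow> b \<in> below \<gamma>\<^sub>2 \<Longrightarrow> \<sigma> \<in> V \<inter> homspace R a \<Longrightarrow> \<tau> \<in> W \<inter> homspace R b
     \<Longrightarrow> N (a + b) (\<sigma> \<star> \<tau>) \<le> C a b * N a \<sigma> * N b \<tau>" by metis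
  define K where "K = (\<Sum>a\<in>below \<gamma>\<^sub>1. \<Sum>b\<in>below \<gamma>\<^sub>2. \<bar>C a b\<bar>)"
  have "star_bounded \<gamma>\<^sub>1 \<gamma>\<^sub>2 K" unfolding star_bounded_def
  proof (intro conjI ballI)
    show "0 \<le> K" by (simp add: K_def sum_nonneg)
    fix \<sigma> \<tau> a b assume *: "a \<in> below \<gamma>\<^sub>1" "b \<in> below \<gamma>\<^sub>2" "\<sigma> \<in> V \<inter> homspace R a" "\<tau> \<in> W \<inter> homspace R b"
    have "C a b \<le> \<bar>C a b\<bar>" by simp
    also have "\<dots> \<le> (\<Sum>b\<in>below \<gamma>\<^sub>2. \<bar>C a b\<bar>)" using * finite_homs_below by (intro member_le_sum) auto
    also have "\<dots> \<le> K" unfolding K_def using * finite_homs_below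
      by (intro member_le_sum[of a _ "\<lambda>a. \<Sum>b\<in>below \<gamma>\<^sub>2. \<bar>C a b\<bar>"]) (auto simp: sum_nonneg)
    finally have "C a b * N a \<sigma> * N b \<tau> \<le> K * N a \<sigma> * N b \<tau>"
      using * N_nonneg by (intro mult_right_mono) auto
    then show "N (a + b) (\<sigma> \<star> \<tau>) \<le> K * N a \<sigma> * N b \<tau>" using C[OF *] by simp
  qed
  then show ?thesis ..
qed

lemma hproj_star:
  assumes "\<sigma> \<in> V" "\<sigma> \<in> hsum R {..<\<gamma>\<^sub>1}" "\<tau> \<in> W" "\<tau> \<in> hsum R {..<\<gamma>\<^sub>2}"
  shows "hproj R \<zeta> (\<sigma> \<star> \<tau>) =
    (\<Sum>a\<in>below \<gamma>\<^sub>1. \<Sum>b\<in>below \<gamma>\<^sub>2. if a + b = \<zeta> then hproj R a \<sigma> \<star> hproj R b \<tau> else 0)"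
proof -
  have "hproj R \<zeta> (hproj R a \<sigma> \<star> hproj R b \<tau>) = (if a + b = \<zeta> then hproj R a \<sigma> \<star> hproj R b \<tau> else 0)" for a b
    using hproj_homspace[OF star_homspace[OF sector_hproj[OF V assms(1)] hproj_in sector_hproj[OF W assms(3)] hproj_in]]
    by auto
  then show ?thesis by (subst star_decomp[OF assms]) (simp add: hproj_sum)
qed

end

section \<open>Uniform bounds and continuity of the re-expansion maps\<close>

locale reg_model = reg_struct R for R :: "('t::real_vector) reg_structure" +
  fixes s :: "('d::finite) scaling"
    and \<pi> :: "real^'d \<Rightarrow> 't \<Rightarrow> (real^'d \<Rightarrow> real) \<Rightarrow> real"
    and \<Gamma> :: "real^'d \<Rightarrow> real^'d \<Rightarrow> 't \<Rightarrow> 't"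
  assumes s_pos: "\<forall>i. 0 < s i" and model: "model R s \<pi> \<Gamma>"
begin

lemma \<Gamma>_sgroup: "\<Gamma> x y \<in> sgroup R"
  using model by (simp add: model_def)

lemmas \<Gamma>_linear = sgroup_linear[OF \<Gamma>_sgroup]
lemmas \<Gamma>_diff = linear_diff[OF \<Gamma>_linear]
  and \<Gamma>_sum = linear_sum[OF \<Gamma>_linear]
  and \<Gamma>_0 = linear_0[OF \<Gamma>_linear]

lemma \<Gamma>_refl: "\<Gamma> x x \<tau> = \<tau>"
  using model by (simp add: model_def)

lemma \<Gamma>_comp: "\<Gamma> x z (\<Gamma> z y \<tau>) = \<Gamma> x y \<tau>"
proof -
  have "\<Gamma> x z \<circ> \<Gamma> z y = \<Gamma> x y" using model by (simp add: model_def)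
  then show ?thesis by (metis comp_apply)
qed

text \<open>A single seminorm for all components below \<open>\<gamma>\<close>, convenient where the powers of the distance are of
no concern.\<close>

definition total :: "real \<Rightarrow> 't \<Rightarrow> real" where
  "total \<gamma> \<tau> = (\<Sum>c\<in>below \<gamma>. hsize R c \<tau>)"

lemma total_nonneg: "0 \<le> total \<gamma> \<tau>"
  by (simp add: total_def sum_nonneg hsize_nonneg)

lemma hsize_le_total: "\<tau> \<in> hsum R {..<\<gamma>} \<Longrightarrow> hsize R \<beta> \<tau> \<le> total \<gamma> \<tau>"
proof (cases "\<beta> \<in> below \<gamma>")
  case True
  then show ?thesis unfolding total_def
    using finite_homs_below by (intro member_le_sum) (auto simp: hsize_nonneg)
next
  case False
  assume "\<tau> \<in> hsum R {..<\<gamma>}"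
  then have "hsize R \<beta> \<tau> = 0"
    using False hsize_notin hsize_hsum_zero by (auto simp: homs_below_def)
  then show ?thesis using total_nonneg by simp
qed

lemma total_homspace: "\<tau> \<in> homspace R \<zeta> \<Longrightarrow> \<zeta> < \<gamma> \<Longrightarrow> total \<gamma> \<tau> = hsize R \<zeta> \<tau>"
proof -
  assume *: "\<tau> \<in> homspace R \<zeta>" "\<zeta> < \<gamma>"
  have "total \<gamma> \<tau> = (\<Sum>c\<in>below \<gamma>. if c = \<zeta> then hsize R \<zeta> \<tau> else 0)"
    unfolding total_def using * by (intro sum.cong) (auto simp: hsize_homspace)
  also have "\<dots> = hsize R \<zeta> \<tau>" using * finite_homs_below hsize_notin by (auto simp: homs_below_def)
  finally show ?thesis .
qed

lemma model_bound:
  obtains C where "0 \<le> C"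
    "\<And>x y \<zeta> \<tau> \<beta>. snorm s (x - y) \<le> 1 \<Longrightarrow> \<zeta> < \<gamma> \<Longrightarrow> \<tau> \<in> homspace R \<zeta> \<Longrightarrow> \<beta> \<in> homs R \<Longrightarrow> \<beta> \<le> \<zeta> \<Longrightarrow>
      hsize R \<beta> (\<Gamma> x y \<tau>) \<le> C * hsize R \<zeta> \<tau> * rpow (snorm s (x - y)) (\<zeta> - \<beta>)"
proof -
  have "\<forall>\<gamma>>0. \<exists>C. \<forall>x. \<forall>\<zeta>\<in>below \<gamma>. \<forall>\<tau>\<in>homspace R \<zeta>. \<forall>y\<in>sball s x 1. \<forall>\<beta>\<in>homs R. \<beta> \<le> \<zeta> \<longrightarrow>
      hsize R \<beta> (\<Gamma> x y \<tau>) \<le> C * hsize R \<zeta> \<tau> * rpow (snorm s (x - y)) (\<zeta> - \<beta>)"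
    using model unfolding model_def by meson
  from this[rule_format, of "max \<gamma> 1"]
  obtain C where C: "\<And>x y \<zeta> \<tau> \<beta>. \<zeta> \<in> below (max \<gamma> 1) \<Longrightarrow> \<tau> \<in> homspace R \<zeta> \<Longrightarrow> y \<in> sball s x 1 \<Longrightarrow> \<beta> \<in> homs R \<Longrightarrow> \<beta> \<le> \<zeta> \<Longrightarrow>
    hsize R \<beta> (\<Gamma> x y \<tau>) \<le> C * hsize R \<zeta> \<tau> * rpow (snorm s (x - y)) (\<zeta> - \<beta>)"
    by force
  have rp: "0 \<le> rpow a b" for a b by (simp add: rpow_def)
  show ?thesis
  proof
    show "0 \<le> \<bar>C\<bar>" by simp
    fix x y \<zeta> \<tau> \<beta>
    assume *: "snorm s (x - y) \<le> 1" "\<zeta> < \<gamma>" "\<tau> \<in> homspace R \<zeta>" "\<beta> \<in> homs R" "\<beta> \<le> \<zeta>"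
    show "hsize R \<beta> (\<Gamma> x y \<tau>) \<le> \<bar>C\<bar> * hsize R \<zeta> \<tau> * rpow (snorm s (x - y)) (\<zeta> - \<beta>)"
    proof (cases "\<zeta> \<in> homs R")
      case True
      then have "hsize R \<beta> (\<Gamma> x y \<tau>) \<le> C * hsize R \<zeta> \<tau> * rpow (snorm s (x - y)) (\<zeta> - \<beta>)"
        using * by (intro C) (auto simp: homs_below_def mem_sball snorm_commute)
      also have "\<dots> \<le> \<bar>C\<bar> * hsize R \<zeta> \<tau> * rpow (snorm s (x - y)) (\<zeta> - \<beta>)"
        by (intro mult_right_mono rp hsize_nonneg) simp
      finally show ?thesis .
    next
      case False
      then have "\<tau> = 0" using * homspace_notin by auto
      then show ?thesis by (simp add: \<Gamma>_0)
    qed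
  qed
qed

lemma hsize_\<Gamma>_above:
  assumes "\<tau> \<in> homspace R \<zeta>" "\<zeta> < \<beta>" shows "hsize R \<beta> (\<Gamma> x y \<tau>) = 0"
  using hproj_sgroup[OF \<Gamma>_sgroup assms(1), of \<beta>] assms hproj_other[OF assms(1), of \<beta>]
  by (simp add: hsize_def N_zero)

lemma hsize_\<Gamma>_decomp:
  assumes "\<tau> \<in> hsum R {..<\<gamma>}"
  shows "hsize R \<beta> (\<Gamma> x y \<tau>) \<le> (\<Sum>c\<in>below \<gamma>. hsize R \<beta> (\<Gamma> x y (hproj R c \<tau>)))"
proof -
  have "\<Gamma> x y \<tau> = (\<Sum>c\<in>below \<gamma>. \<Gamma> x y (hproj R c \<tau>))"
    using arg_cong[OF decomp_below[OF assms], of "\<Gamma> x y"] by (simp add: \<Gamma>_sum)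
  then show ?thesis using hsize_sum by simp
qed

lemma total_\<Gamma>_step:
  obtains B where "1 \<le> B"
    "\<And>x y \<tau>. snorm s (x - y) \<le> 1 \<Longrightarrow> \<tau> \<in> hsum R {..<\<gamma>} \<Longrightarrow> total \<gamma> (\<Gamma> x y \<tau>) \<le> B * total \<gamma> \<tau>"
proof -
  obtain C where C: "0 \<le> C" "\<And>x y \<zeta> \<tau> \<beta>. snorm s (x - y) \<le> 1 \<Longrightarrow> \<zeta> < \<gamma> \<Longrightarrow> \<tau> \<in> homspace R \<zeta> \<Longrightarrow> \<beta> \<in> homs R \<Longrightarrow> \<beta> \<le> \<zeta> \<Longrightarrow>
      hsize R \<beta> (\<Gamma> x y \<tau>) \<le> C * hsize R \<zeta> \<tau> * rpow (snorm s (x - y)) (\<zeta> - \<beta>)"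
    using model_bound[of \<gamma>] by blast
  define B where "B = max 1 (real (card (below \<gamma>)) * C)"
  show ?thesis
  proof
    show "1 \<le> B" by (simp add: B_def)
    fix x y \<tau> assume xy: "snorm s (x - y) \<le> 1" and \<tau>: "\<tau> \<in> hsum R {..<\<gamma>}"
    have one: "hsize R \<beta> (\<Gamma> x y (hproj R c \<tau>)) \<le> C * hsize R c \<tau>" if "c \<in> below \<gamma>" "\<beta> \<in> below \<gamma>" for c \<beta>
    proof (cases "\<beta> \<le> c")
      case True
      have "hsize R \<beta> (\<Gamma> x y (hproj R c \<tau>)) \<le> C * hsize R c (hproj R c \<tau>) * rpow (snorm s (x - y)) (c - \<beta>)"
        using that True xy by (intro C hproj_in) (auto simp: homs_below_def)
      also have "\<dots> \<le> C * hsize R c (hproj R c \<tau>) * 1"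
        using xy True C(1) snorm_nonneg[of s "x - y"]
        by (intro mult_left_mono mult_nonneg_nonneg hsize_nonneg) (auto simp: rpow_def powr_le1)
      finally show ?thesis by (simp add: hsize_hproj)
    next
      case False
      then show ?thesis using hsize_\<Gamma>_above[OF hproj_in, of c \<beta>] C(1) hsize_nonneg by simp
    qed
    have "hsize R \<beta> (\<Gamma> x y \<tau>) \<le> C * total \<gamma> \<tau>" if "\<beta> \<in> below \<gamma>" for \<beta>
    proof -
      have "hsize R \<beta> (\<Gamma> x y \<tau>) \<le> (\<Sum>c\<in>below \<gamma>. hsize R \<beta> (\<Gamma> x y (hproj R c \<tau>)))"
        by (rule hsize_\<Gamma>_decomp[OF \<tau>])
      also have "\<dots> \<le> (\<Sum>c\<in>below \<gamma>. C * hsize R c \<tau>)"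
        using that by (intro sum_mono one)
      finally show ?thesis by (simp add: total_def sum_distrib_left)
    qed
    then have "total \<gamma> (\<Gamma> x y \<tau>) \<le> real (card (below \<gamma>)) * (C * total \<gamma> \<tau>)"
      unfolding total_def[of _ "\<Gamma> x y \<tau>"] by (rule sum_bounded_above)
    also have "\<dots> \<le> B * total \<gamma> \<tau>"
      using total_nonneg unfolding B_def mult.assoc[symmetric] by (intro mult_right_mono) auto
    finally show "total \<gamma> (\<Gamma> x y \<tau>) \<le> B * total \<gamma> \<tau>" .
  qed
qed

text \<open>The axioms for a model bound \<open>\<Gamma> x y\<close> at distance at most 1.  For larger distances the segment from
\<open>x\<close> to \<open>y\<close> is divided into \<open>n\<close> equal steps, and \<open>\<Gamma> x y\<close> is the composition of the maps along
it.\<close>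

lemma total_\<Gamma>_bounded:
  obtains B where "0 \<le> B"
    "\<And>x y \<tau>. snorm s (x - y) \<le> \<rho> \<Longrightarrow> \<tau> \<in> hsum R {..<\<gamma>} \<Longrightarrow> total \<gamma> (\<Gamma> x y \<tau>) \<le> B * total \<gamma> \<tau>"
proof -
  obtain B where B: "1 \<le> B"
    "\<And>x y \<tau>. snorm s (x - y) \<le> 1 \<Longrightarrow> \<tau> \<in> hsum R {..<\<gamma>} \<Longrightarrow> total \<gamma> (\<Gamma> x y \<tau>) \<le> B * total \<gamma> \<tau>"
    using total_\<Gamma>_step[of \<gamma>] by blast
  obtain n :: nat where n: "0 < n" "\<And>x. snorm s x \<le> \<rho> \<Longrightarrow> snorm s ((1 / real n) *\<^sub>R x) \<le> 1"
    using snorm_shrink[OF s_pos, of \<rho>] by blast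
  show ?thesis
  proof
    show "0 \<le> B ^ n" using B(1) by simp
    fix x y \<tau> assume xy: "snorm s (x - y) \<le> \<rho>" and \<tau>: "\<tau> \<in> hsum R {..<\<gamma>}"
    define z where "z = (\<lambda>k. x + (real k / real n) *\<^sub>R (y - x))"
    have z: "z 0 = x" "z n = y" using n(1) by (auto simp: z_def)
    have step: "snorm s (z k - z (Suc k)) \<le> 1" for k
    proof -
      have "z (Suc k) = z k + (1 / real n) *\<^sub>R (y - x)"
        by (simp add: z_def add_divide_distrib scaleR_add_left)
      then have "z k - z (Suc k) = (1 / real n) *\<^sub>R (x - y)"
        using scaleR_minus_right[of "1 / real n" "y - x"] by simp
      then show ?thesis using n(2)[OF xy] by simp
    qed
    have "total \<gamma> (\<Gamma> (z 0) (z k) \<tau>) \<le> B ^ k * total \<gamma> \<tau>" if "\<tau> \<in> hsum R {..<\<gamma>}" for k \<tau>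
      using that
    proof (induction k arbitrary: \<tau>)
      case (Suc k)
      have "total \<gamma> (\<Gamma> (z 0) (z (Suc k)) \<tau>) = total \<gamma> (\<Gamma> (z 0) (z k) (\<Gamma> (z k) (z (Suc k)) \<tau>))"
        by (simp add: \<Gamma>_comp)
      also have "\<dots> \<le> B ^ k * total \<gamma> (\<Gamma> (z k) (z (Suc k)) \<tau>)"
        by (rule Suc.IH[OF sgroup_hsum[OF \<Gamma>_sgroup Suc.prems]])
      also have "\<dots> \<le> B ^ k * (B * total \<gamma> \<tau>)"
        by (rule mult_left_mono[OF B(2)[OF step Suc.prems]]) (use B(1) in simp)
      finally show ?case by (simp add: mult_ac)
    next
      case 0
      show ?case by (simp add: \<Gamma>_refl)
    qed
    from this[OF \<tau>, of n] show "total \<gamma> (\<Gamma> x y \<tau>) \<le> B ^ n * total \<gamma> \<tau>" using z by simp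
  qed
qed

text \<open>A scale \<open>l\<close> takes the place of the distance of \<open>x\<close> and \<open>y\<close>.  All powers are then powers of a
positive number, and \<open>x = y\<close> needs no convention for \<open>0\<^sup>0\<close>.  The factor 16 leaves room for two
points of a ball of radius \<open>4 * l\<close>, and for balls of radius 8 at the scale 1.\<close>

definition \<Gamma>_bounded :: "real \<Rightarrow> real \<Rightarrow> bool" where
  "\<Gamma>_bounded \<gamma> M \<longleftrightarrow> 0 \<le> M \<and> (\<forall>x y l \<zeta> \<beta>. \<forall>\<tau>\<in>homspace R \<zeta>.
     0 < l \<and> l \<le> 1 \<and> snorm s (x - y) \<le> 16 * l \<and> \<zeta> < \<gamma> \<longrightarrow>
     hsize R \<beta> (\<Gamma> x y \<tau>) \<le> M * hsize R \<zeta> \<tau> * l powr (\<zeta> - \<beta>))"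

lemma \<Gamma>_boundedD:
  assumes "\<Gamma>_bounded \<gamma> M" "0 < l" "l \<le> 1" "snorm s (x - y) \<le> 16 * l" "\<zeta> < \<gamma>" "\<tau> \<in> homspace R \<zeta>"
  shows "hsize R \<beta> (\<Gamma> x y \<tau>) \<le> M * hsize R \<zeta> \<tau> * l powr (\<zeta> - \<beta>)"
  using assms unfolding \<Gamma>_bounded_def by blast

text \<open>At distance at most 1 this is the bound for the model.  At larger distances \<open>l\<close> is bounded from below,
and the powers of \<open>l\<close> only contribute a constant.\<close>

lemma \<Gamma>_bounded_ex: "\<exists>M. \<Gamma>_bounded \<gamma> M"
proof -
  obtain C where C: "0 \<le> C" "\<And>x y \<zeta> \<tau> \<beta>. snorm s (x - y) \<le> 1 \<Longrightarrow> \<zeta> < \<gamma> \<Longrightarrow> \<tau> \<in> homspace R \<zeta> \<Longrightarrow> \<beta> \<in> homs R \<Longrightarrow> \<beta> \<le> \<zeta> \<Longrightarrow>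
      hsize R \<beta> (\<Gamma> x y \<tau>) \<le> C * hsize R \<zeta> \<tau> * rpow (snorm s (x - y)) (\<zeta> - \<beta>)"
    using model_bound[of \<gamma>] by blast
  obtain B where B: "0 \<le> B"
    "\<And>x y \<tau>. snorm s (x - y) \<le> 16 \<Longrightarrow> \<tau> \<in> hsum R {..<\<gamma>} \<Longrightarrow> total \<gamma> (\<Gamma> x y \<tau>) \<le> B * total \<gamma> \<tau>"
    using total_\<Gamma>_bounded[of 16 \<gamma>] by blast
  have "bdd_below (homs R)" using reg by (simp add: regularity_structure_def)
  then obtain m where m: "\<And>a. a \<in> homs R \<Longrightarrow> m \<le> a" by (auto simp: bdd_below_def)
  define D :: real where "D = 16 powr (\<gamma> - m)"
  have "\<Gamma>_bounded \<gamma> ((C + B) * D)" unfolding \<Gamma>_bounded_def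
  proof (intro conjI allI ballI impI)
    show "0 \<le> (C + B) * D" using B(1) C(1) by (simp add: D_def)
    fix x y l \<zeta> \<tau> \<beta>
    assume \<tau>: "\<tau> \<in> homspace R \<zeta>" and *: "0 < l \<and> l \<le> 1 \<and> snorm s (x - y) \<le> 16 * l \<and> \<zeta> < \<gamma>"
    then have l: "0 < l" "l \<le> 1" and xy: "snorm s (x - y) \<le> 16 * l" and \<zeta>: "\<zeta> < \<gamma>" by auto
    have nn: "0 \<le> (C + B) * D * hsize R \<zeta> \<tau> * l powr (\<zeta> - \<beta>)"
      using B(1) C(1) by (intro mult_nonneg_nonneg hsize_nonneg) (auto simp: D_def)
    show "hsize R \<beta> (\<Gamma> x y \<tau>) \<le> (C + B) * D * hsize R \<zeta> \<tau> * l powr (\<zeta> - \<beta>)"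
    proof (cases "\<beta> \<in> homs R \<and> \<beta> \<le> \<zeta>")
      case False
      then have "hsize R \<beta> (\<Gamma> x y \<tau>) = 0"
        using hsize_notin hsize_\<Gamma>_above[OF \<tau>] by auto
      then show ?thesis using nn by simp
    next
      case True
      have D: "16 powr (\<zeta> - \<beta>) \<le> D" unfolding D_def using \<zeta> m True by (intro powr_mono) force+
      show ?thesis
      proof (cases "snorm s (x - y) \<le> 1")
        case le: True
        have "hsize R \<beta> (\<Gamma> x y \<tau>) \<le> C * hsize R \<zeta> \<tau> * rpow (snorm s (x - y)) (\<zeta> - \<beta>)"
          using C(2) le \<zeta> \<tau> True by blast
        also have "rpow (snorm s (x - y)) (\<zeta> - \<beta>) \<le> (16 * l) powr (\<zeta> - \<beta>)"
          using xy l True snorm_nonneg[of s "x - y"] by (auto simp: rpow_def intro!: powr_mono2)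
        also have "\<dots> = 16 powr (\<zeta> - \<beta>) * l powr (\<zeta> - \<beta>)" using l by (simp add: powr_mult)
        also have "\<dots> \<le> D * l powr (\<zeta> - \<beta>)" using D by (intro mult_right_mono) auto
        finally have "hsize R \<beta> (\<Gamma> x y \<tau>) \<le> C * hsize R \<zeta> \<tau> * (D * l powr (\<zeta> - \<beta>))"
          using C(1) hsize_nonneg by (simp add: mult_left_mono)
        also have "\<dots> \<le> (C + B) * hsize R \<zeta> \<tau> * (D * l powr (\<zeta> - \<beta>))"
          using B(1) hsize_nonneg by (intro mult_right_mono) (auto simp: D_def)
        finally show ?thesis by (simp add: mult_ac)
      next
        case gt: False
        have \<tau>h: "\<tau> \<in> hsum R {..<\<gamma>}" using \<tau> \<zeta> homspace_hsum by auto
        have "hsize R \<beta> (\<Gamma> x y \<tau>) \<le> total \<gamma> (\<Gamma> x y \<tau>)"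
          by (rule hsize_le_total[OF sgroup_hsum[OF \<Gamma>_sgroup \<tau>h]])
        also have "\<dots> \<le> B * total \<gamma> \<tau>" using xy l \<tau>h by (intro B) auto
        also have "\<dots> = B * hsize R \<zeta> \<tau> * 1" using total_homspace[OF \<tau> \<zeta>] by simp
        also have "1 \<le> D * l powr (\<zeta> - \<beta>)"
        proof -
          have "1 \<le> (16 * l) powr (\<zeta> - \<beta>)" using gt xy True by (intro ge_one_powr_ge_zero) auto
          also have "\<dots> = 16 powr (\<zeta> - \<beta>) * l powr (\<zeta> - \<beta>)" using l by (simp add: powr_mult)
          also have "\<dots> \<le> D * l powr (\<zeta> - \<beta>)" using D by (intro mult_right_mono) auto
          finally show ?thesis .
        qed
        finally have "hsize R \<beta> (\<Gamma> x y \<tau>) \<le> B * hsize R \<zeta> \<tau> * (D * l powr (\<zeta> - \<beta>))"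
          using B(1) hsize_nonneg by (simp add: mult_left_mono)
        also have "\<dots> \<le> (C + B) * hsize R \<zeta> \<tau> * (D * l powr (\<zeta> - \<beta>))"
          using C(1) hsize_nonneg by (intro mult_right_mono) (auto simp: D_def)
        finally show ?thesis by (simp add: mult_ac)
      qed
    qed
  qed
  then show ?thesis ..
qed

lemma \<Gamma>_bound_hsum:
  assumes M: "\<Gamma>_bounded \<gamma> M" and l: "0 < l" "l \<le> 1" "snorm s (x - y) \<le> 16 * l"
    and \<tau>: "\<gamma>' \<le> \<gamma>" "\<tau> \<in> hsum R {..<\<gamma>'}"
  shows "hsize R \<beta> (\<Gamma> x y \<tau>) \<le> M * (\<Sum>c\<in>below \<gamma>'. hsize R c \<tau> * l powr (c - \<beta>))"
proof -
  have "hsize R \<beta> (\<Gamma> x y \<tau>) \<le> (\<Sum>c\<in>below \<gamma>'. hsize R \<beta> (\<Gamma> x y (hproj R c \<tau>)))"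
    by (rule hsize_\<Gamma>_decomp[OF \<tau>(2)])
  also have "\<dots> \<le> (\<Sum>c\<in>below \<gamma>'. M * hsize R c (hproj R c \<tau>) * l powr (c - \<beta>))"
    using \<tau>(1) by (intro sum_mono \<Gamma>_boundedD[OF M l] hproj_in) (auto simp: homs_below_def)
  finally show ?thesis
    by (simp add: hsize_hproj sum_distrib_left mult.assoc)
qed

text \<open>The \<open>\<beta>\<close>-component of \<open>\<Gamma> x y \<tau> - \<tau>\<close> comes from components of \<open>\<tau>\<close> of homogeneity strictly above
\<open>\<beta>\<close>.  Only finitely many homogeneities are involved, so their smallest gap is an exponent for
all of them.\<close>

lemma \<Gamma>_near_id:
  obtains M \<kappa> where "0 \<le> M" "0 < \<kappa>"
    "\<And>x y l \<tau> \<beta>. 0 < l \<Longrightarrow> l \<le> 1 \<Longrightarrow> snorm s (x - y) \<le> l \<Longrightarrow> \<tau> \<in> hsum R {..<\<gamma>} \<Longrightarrow>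
      hsize R \<beta> (\<Gamma> x y \<tau> - \<tau>) \<le> M * total \<gamma> \<tau> * l powr \<kappa>"
proof -
  obtain M where M: "\<Gamma>_bounded \<gamma> M" using \<Gamma>_bounded_ex by blast
  then have M0: "0 \<le> M" by (simp add: \<Gamma>_bounded_def)
  define gaps where "gaps = insert 1 {c - b |c b. c \<in> below \<gamma> \<and> b \<in> below \<gamma> \<and> b < c}"
  have fin: "finite gaps"
  proof -
    have "gaps \<subseteq> insert 1 ((\<lambda>(c, b). c - b) ` (below \<gamma> \<times> below \<gamma>))" by (auto simp: gaps_def)
    then show ?thesis using finite_homs_below by (meson finite_SigmaI finite_imageI finite_insert finite_subset)
  qed
  define \<kappa> where "\<kappa> = Min gaps"
  show ?thesis
  proof
    show "0 \<le> M" by fact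
    show "0 < \<kappa>" unfolding \<kappa>_def using fin by (subst Min_gr_iff) (auto simp: gaps_def)
    fix x y l \<tau> \<beta>
    assume *: "0 < l" "l \<le> 1" "snorm s (x - y) \<le> l" and \<tau>: "\<tau> \<in> hsum R {..<\<gamma>}"
    have one: "hsize R \<beta> (\<Gamma> x y (hproj R c \<tau>) - hproj R c \<tau>) \<le> M * hsize R c \<tau> * l powr \<kappa>" if c: "c \<in> below \<gamma>" for c
    proof (cases "\<beta> < c \<and> \<beta> \<in> homs R")
      case True
      then have "\<beta> \<in> below \<gamma>" using c by (auto simp: homs_below_def)
      then have "\<kappa> \<le> c - \<beta>" unfolding \<kappa>_def using fin True c by (intro Min_le) (auto simp: gaps_def)
      have "hproj R \<beta> (hproj R c \<tau>) = 0" using True hproj_other[OF hproj_in] by auto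
      then have "hsize R \<beta> (\<Gamma> x y (hproj R c \<tau>) - hproj R c \<tau>) = hsize R \<beta> (\<Gamma> x y (hproj R c \<tau>))"
        by (simp add: hsize_def hproj_sub)
      also have "\<dots> \<le> M * hsize R c (hproj R c \<tau>) * l powr (c - \<beta>)"
        using * c by (intro \<Gamma>_boundedD[OF M] hproj_in) (auto simp: homs_below_def)
      also have "\<dots> \<le> M * hsize R c (hproj R c \<tau>) * l powr \<kappa>"
        using * M0 \<open>\<kappa> \<le> c - \<beta>\<close> by (intro mult_left_mono powr_mono' mult_nonneg_nonneg hsize_nonneg) auto
      finally show ?thesis by (simp add: hsize_hproj)
    next
      case False
      then have "hsize R \<beta> (\<Gamma> x y (hproj R c \<tau>) - hproj R c \<tau>) = 0"
        using hsize_notin hsize_hsum_zero[OF sgroup_diff[OF \<Gamma>_sgroup hproj_in]] by fastforce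
      then show ?thesis using M0 hsize_nonneg by simp
    qed
    have "\<Gamma> x y \<tau> - \<tau> = (\<Sum>c\<in>below \<gamma>. \<Gamma> x y (hproj R c \<tau>) - hproj R c \<tau>)"
      by (simp only: sum_subtractf \<Gamma>_sum[symmetric] decomp_below[OF \<tau>, symmetric])
    then have "hsize R \<beta> (\<Gamma> x y \<tau> - \<tau>) \<le> (\<Sum>c\<in>below \<gamma>. hsize R \<beta> (\<Gamma> x y (hproj R c \<tau>) - hproj R c \<tau>))"
      using hsize_sum by simp
    also have "\<dots> \<le> (\<Sum>c\<in>below \<gamma>. M * hsize R c \<tau> * l powr \<kappa>)"
      by (intro sum_mono one)
    finally show "hsize R \<beta> (\<Gamma> x y \<tau> - \<tau>) \<le> M * total \<gamma> \<tau> * l powr \<kappa>"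
      by (simp add: total_def sum_distrib_left sum_distrib_right)
  qed
qed

text \<open>For \<open>(x', u')\<close> near \<open>(x, u)\<close> write \<open>\<Gamma> u' x' = \<Gamma> u' u \<circ> \<Gamma> u x \<circ> \<Gamma> x x'\<close>.  The outer maps
are close to the identity, and \<open>\<Gamma> u' x\<close> is bounded for \<open>u'\<close> near \<open>u\<close>.\<close>

lemma continuous_\<Gamma>:
  assumes \<tau>: "\<tau> \<in> hsum R {..<\<gamma>}"
  shows "continuous_on UNIV (\<lambda>z. hsize R \<beta> (\<sigma> - \<Gamma> (snd z) (fst z) \<tau>))"
  unfolding continuous_on_iff
proof (intro ballI allI impI)
  fix z :: "(real^'d) \<times> (real^'d)" and e :: real
  assume "0 < e"
  define x u where "x = fst z" and "u = snd z"
  obtain M \<kappa> where M: "0 \<le> M" "0 < \<kappa>"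
    "\<And>x y l \<tau> \<beta>. 0 < l \<Longrightarrow> l \<le> 1 \<Longrightarrow> snorm s (x - y) \<le> l \<Longrightarrow> \<tau> \<in> hsum R {..<\<gamma>} \<Longrightarrow>
      hsize R \<beta> (\<Gamma> x y \<tau> - \<tau>) \<le> M * total \<gamma> \<tau> * l powr \<kappa>"
    using \<Gamma>_near_id[of \<gamma>] by blast
  obtain B where B: "0 \<le> B"
    "\<And>a b \<tau>. snorm s (a - b) \<le> 1 + snorm s (u - x) \<Longrightarrow> \<tau> \<in> hsum R {..<\<gamma>} \<Longrightarrow> total \<gamma> (\<Gamma> a b \<tau>) \<le> B * total \<gamma> \<tau>"
    using total_\<Gamma>_bounded[of "1 + snorm s (u - x)" \<gamma>] by blast
  define K where "K = B * (real (card (below \<gamma>)) * (M * total \<gamma> \<tau>)) + M * total \<gamma> (\<Gamma> u x \<tau>)"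
  have K0: "0 \<le> K" unfolding K_def using B(1) M(1) total_nonneg by simp
  define l where "l = min 1 ((e / (K + 1)) powr (1 / \<kappa>) / 2)"
  have l: "0 < l" "l \<le> 1" using \<open>0 < e\<close> K0 by (auto simp: l_def)
  have "l < (e / (K + 1)) powr (1 / \<kappa>)" using \<open>0 < e\<close> K0 by (auto simp: l_def min_less_iff_disj)
  then have "l powr \<kappa> < ((e / (K + 1)) powr (1 / \<kappa>)) powr \<kappa>" using l M(2) by (intro powr_less_mono2) auto
  also have "\<dots> = e / (K + 1)" using M(2) \<open>0 < e\<close> K0 by (simp add: powr_powr)
  finally have "l powr \<kappa> * (K + 1) < e" using K0 by (simp add: pos_less_divide_eq)
  moreover have "K * l powr \<kappa> \<le> l powr \<kappa> * (K + 1)" by (simp add: algebra_simps)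
  ultimately have Kl: "K * l powr \<kappa> < e" by linarith
  obtain \<delta> where \<delta>: "0 < \<delta>" "\<And>x. norm x < \<delta> \<Longrightarrow> snorm s x \<le> l"
    using snorm_small[OF s_pos l(1)] by blast
  show "\<exists>d>0. \<forall>z'\<in>UNIV. dist z' z < d \<longrightarrow>
      dist (hsize R \<beta> (\<sigma> - \<Gamma> (snd z') (fst z') \<tau>)) (hsize R \<beta> (\<sigma> - \<Gamma> (snd z) (fst z) \<tau>)) < e"
  proof (intro exI[of _ \<delta>] conjI ballI impI)
    show "0 < \<delta>" by fact
    fix z' :: "(real^'d) \<times> (real^'d)" assume "dist z' z < \<delta>"
    define x' u' where "x' = fst z'" and "u' = snd z'"
    have "dist x' x < \<delta>" "dist u' u < \<delta>"
      using \<open>dist z' z < \<delta>\<close> dist_fst_le[of z' z] dist_snd_le[of z' z] by (auto simp: x_def u_def x'_def u'_def)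
    then have xx: "snorm s (x - x') \<le> l" and uu: "snorm s (u' - u) \<le> l"
      using \<delta>(2) by (auto simp: dist_norm norm_minus_commute)
    have ux: "snorm s (u' - x) \<le> 1 + snorm s (u - x)"
      using snorm_triangle[OF s_pos, of "u' - u" "u - x"] uu l by simp
    have hs: "\<Gamma> x x' \<tau> - \<tau> \<in> hsum R {..<\<gamma>}" "\<Gamma> u x \<tau> \<in> hsum R {..<\<gamma>}"
      by (rule hsum_diff[OF sgroup_hsum[OF \<Gamma>_sgroup \<tau>] \<tau>], rule sgroup_hsum[OF \<Gamma>_sgroup \<tau>])
    have eq: "\<Gamma> u' x' \<tau> - \<Gamma> u x \<tau> = \<Gamma> u' x (\<Gamma> x x' \<tau> - \<tau>) + (\<Gamma> u' u (\<Gamma> u x \<tau>) - \<Gamma> u x \<tau>)"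
      by (simp add: \<Gamma>_diff \<Gamma>_comp)
    have "total \<gamma> (\<Gamma> x x' \<tau> - \<tau>) \<le> real (card (below \<gamma>)) * (M * total \<gamma> \<tau> * l powr \<kappa>)"
      unfolding total_def[of _ "\<Gamma> x x' \<tau> - \<tau>"] using l xx \<tau> by (intro sum_bounded_above M)
    then have "hsize R \<beta> (\<Gamma> u' x (\<Gamma> x x' \<tau> - \<tau>)) \<le> B * (real (card (below \<gamma>)) * (M * total \<gamma> \<tau> * l powr \<kappa>))"
      using hsize_le_total[OF sgroup_hsum[OF \<Gamma>_sgroup hs(1)], of \<beta> u' x] B(2)[OF ux hs(1)] B(1)
      by (meson mult_left_mono order_trans)
    moreover have "hsize R \<beta> (\<Gamma> u' u (\<Gamma> u x \<tau>) - \<Gamma> u x \<tau>) \<le> M * total \<gamma> (\<Gamma> u x \<tau>) * l powr \<kappa>"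
      by (intro M l uu hs)
    ultimately have "hsize R \<beta> (\<Gamma> u' x' \<tau> - \<Gamma> u x \<tau>) \<le> K * l powr \<kappa>"
      using hsize_add[of \<beta> "\<Gamma> u' x (\<Gamma> x x' \<tau> - \<tau>)" "\<Gamma> u' u (\<Gamma> u x \<tau>) - \<Gamma> u x \<tau>"] eq
      by (simp add: K_def algebra_simps)
    moreover have "\<bar>hsize R \<beta> (\<sigma> - \<Gamma> u' x' \<tau>) - hsize R \<beta> (\<sigma> - \<Gamma> u x \<tau>)\<bar> \<le> hsize R \<beta> (\<Gamma> u' x' \<tau> - \<Gamma> u x \<tau>)"
      using hsize_diff_le[of \<beta> "\<sigma> - \<Gamma> u' x' \<tau>" "\<sigma> - \<Gamma> u x \<tau>"] hsize_minus[of \<beta> "\<Gamma> u' x' \<tau> - \<Gamma> u x \<tau>"] by simp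
    ultimately show "dist (hsize R \<beta> (\<sigma> - \<Gamma> (snd z') (fst z') \<tau>)) (hsize R \<beta> (\<sigma> - \<Gamma> (snd z) (fst z) \<tau>)) < e"
      using Kl by (simp add: dist_real_def x_def u_def x'_def u'_def)
  qed
qed

end

section \<open>Measurability of increments\<close>

text \<open>Reduced to monotone real functions by truncating \<open>f\<close> at \<open>n\<close>.\<close>

lemma borel_measurable_mono_ennreal:
  fixes f :: "real \<Rightarrow> ennreal"
  assumes "mono f" shows "f \<in> borel_measurable borel"
proof -
  have "(\<lambda>x. enn2real (min (f x) (of_nat n))) \<in> borel_measurable borel" for n
  proof (rule borel_measurable_mono, rule monoI)
    fix x y :: real assume "x \<le> y"
    then show "enn2real (min (f x) (of_nat n)) \<le> enn2real (min (f y) (of_nat n))"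
      using monoD[OF assms, of x y]
      by (intro enn2real_mono) (auto simp: min.coboundedI1 min_less_iff_disj ennreal_of_nat_eq_real_of_nat)
  qed
  then have "(\<lambda>x. SUP n. ennreal (enn2real (min (f x) (of_nat n)))) \<in> borel_measurable borel"
    by measurable
  also have "(\<lambda>x. SUP n. ennreal (enn2real (min (f x) (of_nat n)))) = f"
  proof
    fix x
    have eq: "ennreal (enn2real (min (f x) (of_nat n))) = min (f x) (of_nat n)" for n
      by (intro ennreal_enn2real) (auto simp: min_less_iff_disj ennreal_of_nat_eq_real_of_nat)
    show "(SUP n. ennreal (enn2real (min (f x) (of_nat n)))) = f x"
      unfolding eq
    proof (rule antisym)
      show "f x \<le> (SUP n. min (f x) (of_nat n))"
      proof (cases "f x = top")
        case True
        then show ?thesis by (simp add: ennreal_SUP_of_nat_eq_top)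
      next
        case False
        then obtain n where "f x \<le> of_nat n"
          by (metis ennreal_Ex_less_of_nat less_imp_le less_top)
        then have "f x = min (f x) (of_nat n)" by (simp add: min_def)
        then show ?thesis by (metis SUP_upper UNIV_I)
      qed
    qed (auto intro: SUP_least)
  qed
  finally show ?thesis .
qed

text \<open>The special case of a translation of the affine change of variables.\<close>

lemma nn_integral_lebesgue_translate:
  fixes G :: "'a::euclidean_space \<Rightarrow> ennreal"
  assumes G: "G \<in> borel_measurable lebesgue"
  shows "(\<integral>\<^sup>+h. G (x + h) \<partial>lebesgue) = (\<integral>\<^sup>+u. G u \<partial>lebesgue)"
proof -
  have T: "(\<lambda>h::'a. x + (\<Sum>j\<in>Basis. (1 * (h \<bullet> j)) *\<^sub>R j)) = (+) x"
    by (auto simp: euclidean_representation)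
  have "lebesgue = density (distr lebesgue lebesgue ((+) x)) (\<lambda>_. 1)"
    using lebesgue_affine_euclidean[of "\<lambda>_. 1" x] unfolding T by simp
  then have L: "lebesgue = distr lebesgue lebesgue ((+) x)"
    by (simp add: density_1)
  have m: "(+) x \<in> lebesgue \<rightarrow>\<^sub>M lebesgue"
    using lebesgue_affine_measurable[of "\<lambda>_. 1" x] unfolding T by simp
  have "(\<integral>\<^sup>+u. G u \<partial>lebesgue) = (\<integral>\<^sup>+u. G u \<partial>distr lebesgue lebesgue ((+) x))"
    using L by metis
  also have "\<dots> = (\<integral>\<^sup>+h. G (x + h) \<partial>lebesgue)"
    by (rule nn_integral_distr[OF m]) (use G in simp)
  finally show ?thesis by simp
qed

lemma AE_lebesgue_null_set:
  assumes "AE x in lebesgue. P x"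
  obtains Z where "Z \<in> null_sets lebesgue" "\<And>x. x \<notin> Z \<Longrightarrow> P x"
proof -
  obtain Z where "\<And>x. x \<in> space lebesgue - Z \<Longrightarrow> P x" "Z \<in> null_sets lebesgue"
    using AE_E3[OF assms] by blast
  then show ?thesis by (intro that[of Z]) auto
qed

lemma borel_measurable_null_set_cong:
  assumes F: "F \<in> borel_measurable lebesgue" and Z: "Z \<in> null_sets lebesgue" "\<And>x. x \<notin> Z \<Longrightarrow> F x = G x"
  shows "G \<in> borel_measurable lebesgue"
proof (rule measurableI)
  fix A :: "'b set" assume A: "A \<in> sets borel"
  have "G -` A \<inter> space lebesgue = (F -` A \<inter> space lebesgue - Z) \<union> (G -` A \<inter> Z)"
    using Z(2) by auto
  moreover have "G -` A \<inter> Z \<in> null_sets lebesgue"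
    using Z(1) completion.complete2[of "G -` A \<inter> Z" Z] by blast
  moreover have "F -` A \<inter> space lebesgue - Z \<in> sets lebesgue"
    using null_setsD2[OF Z(1)] by (rule sets.Diff[OF measurable_sets[OF F A]])
  ultimately show "G -` A \<inter> space lebesgue \<in> sets lebesgue"
    by (metis null_setsD2 sets.Un)
qed auto

context reg_model
begin

text \<open>Strong measurability of all components with convergence everywhere instead of almost everywhere.
This keeps exceptional sets out of the passage to functions of two variables, where the product
sigma-algebra is not complete.\<close>

definition pointwise_limit :: "real \<Rightarrow> (real^'d \<Rightarrow> 't) \<Rightarrow> bool" where
  "pointwise_limit \<gamma> F \<longleftrightarrow> (\<forall>x. F x \<in> hsum R {..<\<gamma>}) \<and>
     (\<forall>c\<in>below \<gamma>. \<exists>S. (\<forall>n::nat. simple_function lebesgue (S n) \<and> range (S n) \<subseteq> homspace R c) \<and>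
        (\<forall>x. (\<lambda>n. N c (S n x - hproj R c (F x))) \<longlonglongrightarrow> 0))"

lemma pointwise_limit_const:
  assumes "\<tau> \<in> hsum R {..<\<gamma>}" shows "pointwise_limit \<gamma> (\<lambda>_. \<tau>)"
  unfolding pointwise_limit_def
proof (intro conjI allI ballI)
  fix c
  show "\<exists>S. (\<forall>n::nat. simple_function lebesgue (S n) \<and> range (S n) \<subseteq> homspace R c) \<and>
        (\<forall>x::real^'d. (\<lambda>n. N c (S n x - hproj R c \<tau>)) \<longlonglongrightarrow> 0)"
    by (intro exI[of _ "\<lambda>n x. hproj R c \<tau>"]) (auto simp: hproj_in N_zero)
qed (fact assms)

lemma pointwise_limit_total:
  assumes "pointwise_limit \<gamma> F"
  obtains S where "\<And>n::nat. simple_function lebesgue (S n)" "\<And>n x. S n x \<in> hsum R {..<\<gamma>}"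
    "\<And>x. (\<lambda>n. total \<gamma> (S n x - F x)) \<longlonglongrightarrow> 0"
proof -
  have "\<forall>c\<in>below \<gamma>. \<exists>S. (\<forall>n::nat. simple_function lebesgue (S n) \<and> range (S n) \<subseteq> homspace R c) \<and>
        (\<forall>x. (\<lambda>n. N c (S n x - hproj R c (F x))) \<longlonglongrightarrow> 0)"
    using assms by (simp add: pointwise_limit_def)
  from bchoice[OF this] obtain S where
    S0: "\<forall>c\<in>below \<gamma>. (\<forall>n. simple_function lebesgue (S c n) \<and> range (S c n) \<subseteq> homspace R c) \<and> (\<forall>x. (\<lambda>n. N c (S c n x - hproj R c (F x))) \<longlonglongrightarrow> 0)"
    by (rule exE)
  have S: "\<And>c n. c \<in> below \<gamma> \<Longrightarrow> simple_function lebesgue (S c n)"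
    "\<And>c n x. c \<in> below \<gamma> \<Longrightarrow> S c n x \<in> homspace R c"
    "\<And>c x. c \<in> below \<gamma> \<Longrightarrow> (\<lambda>n. N c (S c n x - hproj R c (F x))) \<longlonglongrightarrow> 0"
    using S0 by (simp_all add: image_subset_iff)
  define T where "T n x = (\<Sum>c\<in>below \<gamma>. S c n x)" for n x
  have pT: "hproj R c (T n x) = S c n x" if "c \<in> below \<gamma>" for c n x
  proof -
    have "hproj R c (T n x) = (\<Sum>b\<in>below \<gamma>. if c = b then S b n x else 0)"
      unfolding T_def hproj_sum by (intro sum.cong refl) (simp add: hproj_homspace[OF S(2)])
    then show ?thesis using that finite_homs_below by simp
  qed
  have tot: "total \<gamma> (T n x - F x) = (\<Sum>c\<in>below \<gamma>. N c (S c n x - hproj R c (F x)))" for n x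
    unfolding total_def by (intro sum.cong refl) (simp add: hsize_def hproj_sub pT)
  show ?thesis
  proof
    show "simple_function lebesgue (T n)" for n
      unfolding T_def[abs_def] using S by auto
    show "T n x \<in> hsum R {..<\<gamma>}" for n x
      unfolding T_def by (intro hsum_sum homspace_hsum[OF S(2)]) (auto simp: homs_below_def)
    show "(\<lambda>n. total \<gamma> (T n x - F x)) \<longlonglongrightarrow> 0" for x
      unfolding tot by (intro tendsto_null_sum S)
  qed
qed

text \<open>If \<open>F\<close> and \<open>G\<close> are simple, the function is continuous on each of finitely many measurable
rectangles.  The general case is a pointwise limit, because \<open>\<Gamma> u x\<close> is bounded for fixed \<open>u\<close>
and \<open>x\<close>.\<close>

lemma increment_joint_measurable:
  assumes "pointwise_limit \<gamma> F" "pointwise_limit \<gamma> G"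
  shows "(\<lambda>(x, u). hsize R c (F u - \<Gamma> u x (G x))) \<in> borel_measurable (lebesgue \<Otimes>\<^sub>M lebesgue)"
proof -
  obtain S where S: "\<And>n::nat. simple_function lebesgue (S n)" "\<And>n x. S n x \<in> hsum R {..<\<gamma>}"
    "\<And>x. (\<lambda>n. total \<gamma> (S n x - F x)) \<longlonglongrightarrow> 0"
    using pointwise_limit_total[OF assms(1)] by blast
  obtain T where T: "\<And>n::nat. simple_function lebesgue (T n)" "\<And>n x. T n x \<in> hsum R {..<\<gamma>}"
    "\<And>x. (\<lambda>n. total \<gamma> (T n x - G x)) \<longlonglongrightarrow> 0"
    using pointwise_limit_total[OF assms(2)] by blast
  have FG: "F x \<in> hsum R {..<\<gamma>}" "G x \<in> hsum R {..<\<gamma>}" for x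
    using assms by (auto simp: pointwise_limit_def)
  have simple: "(\<lambda>z. hsize R c (S n (snd z) - \<Gamma> (snd z) (fst z) (T n (fst z)))) \<in> borel_measurable (lebesgue \<Otimes>\<^sub>M lebesgue)" for n
  proof -
    define I where "I = S n ` space lebesgue \<times> T n ` space lebesgue"
    have fin: "finite I" using S(1)[of n] T(1)[of n] by (simp add: I_def simple_function_def)
    have Sm: "(\<lambda>z. S n (snd z)) \<in> measurable (lebesgue \<Otimes>\<^sub>M lebesgue) (count_space UNIV)"
      by (rule measurable_compose[OF measurable_snd measurable_simple_function[OF S(1)]])
    have Tm: "(\<lambda>z. T n (fst z)) \<in> measurable (lebesgue \<Otimes>\<^sub>M lebesgue) (count_space UNIV)"
      by (rule measurable_compose[OF measurable_fst measurable_simple_function[OF T(1)]])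
    have idx: "(\<lambda>z. (S n (snd z), T n (fst z))) \<in> measurable (lebesgue \<Otimes>\<^sub>M lebesgue) (count_space I)"
    proof (rule measurable_count_space_eq2[THEN iffD2, OF fin], intro conjI ballI funcsetI)
      fix i assume "i \<in> I"
      have "(\<lambda>z. (S n (snd z), T n (fst z))) -` {i} \<inter> space (lebesgue \<Otimes>\<^sub>M lebesgue)
         = ((\<lambda>z. S n (snd z)) -` {fst i} \<inter> space (lebesgue \<Otimes>\<^sub>M lebesgue))
           \<inter> ((\<lambda>z. T n (fst z)) -` {snd i} \<inter> space (lebesgue \<Otimes>\<^sub>M lebesgue))"
        by (cases i) auto
      also have "\<dots> \<in> sets (lebesgue \<Otimes>\<^sub>M lebesgue)"
        by (intro sets.Int measurable_sets[OF Sm] measurable_sets[OF Tm]) auto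
      finally show "(\<lambda>z. (S n (snd z), T n (fst z))) -` {i} \<inter> space (lebesgue \<Otimes>\<^sub>M lebesgue) \<in> sets (lebesgue \<Otimes>\<^sub>M lebesgue)" .
    qed (auto simp: I_def)
    have *: "(\<lambda>z. hsize R c (fst i - \<Gamma> (snd z) (fst z) (snd i))) \<in> borel_measurable (lebesgue \<Otimes>\<^sub>M lebesgue)" if "i \<in> I" for i
    proof -
      have "snd i \<in> hsum R {..<\<gamma>}" using that T(2) by (auto simp: I_def)
      then show ?thesis
        by (intro borel_imp_lebesgue_pair_measurable borel_measurable_continuous_onI continuous_\<Gamma>)
    qed
    show ?thesis
      using measurable_compose_countable'[where f="\<lambda>i z. hsize R c (fst i - \<Gamma> (snd z) (fst z) (snd i))", OF * idx] fin by (simp add: countable_finite)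
  qed
  have lim: "(\<lambda>n. hsize R c (S n u - \<Gamma> u x (T n x))) \<longlonglongrightarrow> hsize R c (F u - \<Gamma> u x (G x))" for x u
  proof -
    obtain B where B: "0 \<le> B"
      "\<And>a b \<tau>. snorm s (a - b) \<le> snorm s (u - x) \<Longrightarrow> \<tau> \<in> hsum R {..<\<gamma>} \<Longrightarrow> total \<gamma> (\<Gamma> a b \<tau>) \<le> B * total \<gamma> \<tau>"
      using total_\<Gamma>_bounded[of "snorm s (u - x)" \<gamma>] by blast
    have le: "\<bar>hsize R c (S n u - \<Gamma> u x (T n x)) - hsize R c (F u - \<Gamma> u x (G x))\<bar>
        \<le> total \<gamma> (S n u - F u) + B * total \<gamma> (T n x - G x)" for n
    proof -
      have eq: "(S n u - \<Gamma> u x (T n x)) - (F u - \<Gamma> u x (G x)) = (S n u - F u) - \<Gamma> u x (T n x - G x)"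
        by (simp add: \<Gamma>_diff)
      have d: "S n u - F u \<in> hsum R {..<\<gamma>}" "T n x - G x \<in> hsum R {..<\<gamma>}"
        using S(2) T(2) FG hsum_diff by auto
      have "hsize R c ((S n u - F u) - \<Gamma> u x (T n x - G x)) \<le> hsize R c (S n u - F u) + hsize R c (\<Gamma> u x (T n x - G x))"
        by (rule hsize_diff)
      also have "hsize R c (S n u - F u) \<le> total \<gamma> (S n u - F u)" by (rule hsize_le_total[OF d(1)])
      also have "hsize R c (\<Gamma> u x (T n x - G x)) \<le> total \<gamma> (\<Gamma> u x (T n x - G x))"
        by (rule hsize_le_total[OF sgroup_hsum[OF \<Gamma>_sgroup d(2)]])
      also have "\<dots> \<le> B * total \<gamma> (T n x - G x)" by (rule B(2)[OF order_refl d(2)])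
      finally show ?thesis
        using hsize_diff_le[of c "S n u - \<Gamma> u x (T n x)" "F u - \<Gamma> u x (G x)"] eq by simp
    qed
    have "(\<lambda>n. total \<gamma> (S n u - F u) + B * total \<gamma> (T n x - G x)) \<longlonglongrightarrow> 0 + B * 0"
      by (intro tendsto_intros S T)
    then have "(\<lambda>n. total \<gamma> (S n u - F u) + B * total \<gamma> (T n x - G x)) \<longlonglongrightarrow> 0" by simp
    then have "(\<lambda>n. hsize R c (S n u - \<Gamma> u x (T n x)) - hsize R c (F u - \<Gamma> u x (G x))) \<longlonglongrightarrow> 0"
      by (rule Lim_null_comparison[rotated]) (use le in auto)
    then show ?thesis by (simp add: LIM_zero_iff)
  qed
  have "(\<lambda>z. hsize R c (F (snd z) - \<Gamma> (snd z) (fst z) (G (fst z)))) \<in> borel_measurable (lebesgue \<Otimes>\<^sub>M lebesgue)"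
    using lim by (intro borel_measurable_LIMSEQ_real[OF _ simple]) auto
  then show ?thesis by (simp add: split_def)
qed

text \<open>The requirements on the elements of \<open>F_space\<close> apart from the finiteness of the norm.\<close>

definition measurable_dist :: "real \<Rightarrow> (real^'d \<Rightarrow> 't) \<Rightarrow> bool" where
  "measurable_dist \<gamma> f \<longleftrightarrow> (\<forall>x. f x \<in> hsum R {..<\<gamma>}) \<and>
     (\<forall>\<zeta>\<in>below \<gamma>. strongly_measurable R \<zeta> (\<lambda>x. hproj R \<zeta> (f x)))"

text \<open>The function is set to 0 on the null set on which one of the finitely many components fails to
converge.\<close>

lemma measurable_dist_AE:
  assumes "measurable_dist \<gamma> f"
  obtains f' where "pointwise_limit \<gamma> f'" "AE x in lebesgue. f' x = f x"
proof -
  have "\<forall>c\<in>below \<gamma>. \<exists>S. (\<forall>n::nat. simple_function lebesgue (S n) \<and> range (S n) \<subseteq> homspace R c) \<and>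
        (AE x in lebesgue. (\<lambda>n. N c (S n x - hproj R c (f x))) \<longlonglongrightarrow> 0)"
    using assms by (simp add: measurable_dist_def strongly_measurable_def)
  from bchoice[OF this] obtain S where
    S0: "\<forall>c\<in>below \<gamma>. (\<forall>n. simple_function lebesgue (S c n) \<and> range (S c n) \<subseteq> homspace R c) \<and> (AE x in lebesgue. (\<lambda>n. N c (S c n x - hproj R c (f x))) \<longlonglongrightarrow> 0)"
    by (rule exE)
  have S: "\<And>c n. c \<in> below \<gamma> \<Longrightarrow> simple_function lebesgue (S c n)"
    "\<And>c n x. c \<in> below \<gamma> \<Longrightarrow> S c n x \<in> homspace R c"
    "\<And>c. c \<in> below \<gamma> \<Longrightarrow> AE x in lebesgue. (\<lambda>n. N c (S c n x - hproj R c (f x))) \<longlonglongrightarrow> 0"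
    using S0 by (simp_all add: image_subset_iff)
  have "AE x in lebesgue. \<forall>c\<in>below \<gamma>. (\<lambda>n. N c (S c n x - hproj R c (f x))) \<longlonglongrightarrow> 0"
    using S(3) finite_homs_below by (intro AE_finite_allI) auto
  from AE_lebesgue_null_set[OF this]
  obtain Z where Z: "Z \<in> null_sets lebesgue"
    "\<And>x. x \<notin> Z \<Longrightarrow> \<forall>c\<in>below \<gamma>. (\<lambda>n. N c (S c n x - hproj R c (f x))) \<longlonglongrightarrow> 0"
    by blast
  define f' where "f' x = (if x \<in> Z then 0 else f x)" for x
  define S' where "S' c n x = (if x \<in> Z then 0 else S c n x)" for c n x
  show ?thesis
  proof
    show "AE x in lebesgue. f' x = f x"
      using AE_not_in[OF Z(1)] by eventually_elim (simp add: f'_def)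
    show "pointwise_limit \<gamma> f'" unfolding pointwise_limit_def
    proof (intro conjI allI ballI)
      show "f' x \<in> hsum R {..<\<gamma>}" for x
        using assms hsum_0 by (auto simp: measurable_dist_def f'_def)
      fix c assume c: "c \<in> below \<gamma>"
      have "simple_function lebesgue (S' c n)" for n
        unfolding S'_def[abs_def] using Z(1)
        by (intro simple_function_If_set S(1) c) (auto simp: null_setsD2)
      moreover have "S' c n x \<in> homspace R c" for n x
        using S(2)[OF c] homspace_0 by (simp add: S'_def)
      moreover have "(\<lambda>n. N c (S' c n x - hproj R c (f' x))) \<longlonglongrightarrow> 0" for x
        using Z(2)[of x] c by (cases "x \<in> Z") (auto simp: S'_def f'_def hproj_0 N_zero)
      ultimately show "\<exists>S. (\<forall>n::nat. simple_function lebesgue (S n) \<and> range (S n) \<subseteq> homspace R c) \<and>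
        (\<forall>x. (\<lambda>n. N c (S n x - hproj R c (f' x))) \<longlonglongrightarrow> 0)"
        by (intro exI[of _ "S' c"]) auto
    qed
  qed
qed

lemma increment_measurable:
  assumes f: "measurable_dist \<gamma> f" and \<tau>: "\<tau> \<in> hsum R {..<\<gamma>}"
  shows "(\<lambda>u. hsize R c (f u - \<Gamma> u x \<tau>)) \<in> borel_measurable lebesgue"
proof -
  obtain f' where f': "pointwise_limit \<gamma> f'" "AE x in lebesgue. f' x = f x"
    using measurable_dist_AE[OF f] by blast
  have "(\<lambda>u. hsize R c (f' u - \<Gamma> u x \<tau>)) \<in> borel_measurable lebesgue"
    using measurable_Pair2[OF increment_joint_measurable[OF f'(1) pointwise_limit_const[OF \<tau>]], of x c] by simp
  moreover have "AE u in lebesgue. hsize R c (f' u - \<Gamma> u x \<tau>) = hsize R c (f u - \<Gamma> u x \<tau>)"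
    using f'(2) by eventually_elim simp
  ultimately show ?thesis by (rule borel_measurable_AE)
qed

lemma hsize_measurable:
  assumes "measurable_dist \<gamma> f" shows "(\<lambda>u. hsize R c (f u)) \<in> borel_measurable lebesgue"
  using increment_measurable[OF assms hsum_0, of c 0] by (simp add: \<Gamma>_0)

definition incr :: "(real^'d \<Rightarrow> 't) \<Rightarrow> real \<Rightarrow> real^'d \<Rightarrow> real^'d \<Rightarrow> ennreal" where
  "incr f c x u = ennreal (hsize R c (f u - \<Gamma> u x (f x)))"

lemma incr_measurable:
  assumes f: "measurable_dist \<gamma> f" shows "incr f c x \<in> borel_measurable lebesgue"
  unfolding incr_def[abs_def]
  using increment_measurable[OF f, of "f x" c x] f by (auto simp: measurable_dist_def)

lemma ball_integral_cong_AE: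
  assumes "AE u in lebesgue. F u = G u" shows "ball_integral s \<rho> F x = ball_integral s \<rho> G x"
  unfolding ball_integral_def using assms by (intro nn_integral_cong_AE) (auto elim: eventually_mono)

text \<open>The claim is clear for a version of \<open>f\<close> that is a limit of simple functions everywhere.  For \<open>x\<close>
outside of the null set where the two versions differ, the integrands agree for almost all \<open>u\<close>, so
that the integrals differ for \<open>x\<close> in a null set only.\<close>

lemma ball_integral_incr_measurable:
  assumes f: "measurable_dist \<gamma> f" and "0 \<le> \<rho>"
  shows "(\<lambda>x. ball_integral s \<rho> (incr f c x) x) \<in> borel_measurable lebesgue"
proof -
  obtain f' where f': "pointwise_limit \<gamma> f'" "AE x in lebesgue. f' x = f x"
    using measurable_dist_AE[OF f] by blast
  have "(\<lambda>(x, u). incr f' c x u) \<in> borel_measurable (lebesgue \<Otimes>\<^sub>M lebesgue)"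
    using measurable_compose[OF increment_joint_measurable[OF f'(1) f'(1), of c] measurable_ennreal]
    by (simp add: incr_def split_def)
  then have m: "(\<lambda>x. ball_integral s \<rho> (incr f' c x) x) \<in> borel_measurable lebesgue"
    by (rule ball_integral_joint_measurable[OF s_pos \<open>0 \<le> \<rho>\<close>])
  have ae: "AE x in lebesgue. ball_integral s \<rho> (incr f' c x) x = ball_integral s \<rho> (incr f c x) x"
    using f'(2)
  proof eventually_elim
    case (elim x)
    have "AE u in lebesgue. incr f' c x u = incr f c x u"
      using f'(2) by eventually_elim (simp add: incr_def elim)
    then show ?case by (rule ball_integral_cong_AE)
  qed
  obtain Z where Z: "Z \<in> null_sets lebesgue"
    "\<And>x. x \<notin> Z \<Longrightarrow> ball_integral s \<rho> (incr f' c x) x = ball_integral s \<rho> (incr f c x) x"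
    using AE_lebesgue_null_set[OF ae] by blast
  show ?thesis
    by (rule borel_measurable_null_set_cong[OF m Z])
qed

lemma mean_increment_eq:
  assumes f: "measurable_dist \<gamma>' f" and l: "0 < l"
  shows "mean_increment R s \<Gamma> \<gamma> \<zeta> f x l =
    ennreal (l powr (\<zeta> - \<gamma>)) * ball_avg s l (incr f \<zeta> x) x"
proof -
  have [measurable]: "sball s x (4 * l) \<in> sets lebesgue" using l s_pos by simp
  define G where "G u = ennreal (hsize R \<zeta> (f u - \<Gamma> u x (f x)) / l powr (\<gamma> - \<zeta>)) * indicator (sball s x (4 * l)) u" for u
  have eq: "ennreal (hsize R \<zeta> (f u - \<Gamma> u x (f x)) / l powr (\<gamma> - \<zeta>)) = ennreal (l powr (\<zeta> - \<gamma>)) * incr f \<zeta> x u" for u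
    using l hsize_nonneg powr_minus[of l "\<gamma> - \<zeta>"]
    by (simp add: incr_def ennreal_mult[symmetric] divide_inverse mult.commute)
  note [measurable] = incr_measurable[OF f]
  have Gm: "G \<in> borel_measurable lebesgue" unfolding G_def[abs_def] eq by measurable
  have "(\<integral>\<^sup>+h\<in>sball s 0 (4 * l). ennreal (hsize R \<zeta> (f (x + h) - \<Gamma> (x + h) x (f x)) / l powr (\<gamma> - \<zeta>)) \<partial>lebesgue)
      = (\<integral>\<^sup>+h. G (x + h) \<partial>lebesgue)"
    unfolding G_def by (intro nn_integral_cong) (auto simp: indicator_def mem_sball)
  also have "\<dots> = (\<integral>\<^sup>+u. G u \<partial>lebesgue)" by (rule nn_integral_lebesgue_translate[OF Gm])
  also have "\<dots> = ennreal (l powr (\<zeta> - \<gamma>)) * ball_integral s (4 * l) (incr f \<zeta> x) x"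
    unfolding G_def eq ball_integral_def mult.assoc by (rule nn_integral_cmult) measurable
  finally show ?thesis by (simp add: mean_increment_def ball_avg_def ennreal_times_divide)
qed

text \<open>The integral over a ball is monotone in the radius.\<close>

lemma mean_increment_measurable:
  assumes f: "measurable_dist \<gamma>' f"
  shows "mean_increment R s \<Gamma> \<gamma> \<zeta> f x \<in> borel_measurable scale_measure01"
proof -
  have [measurable]: "(\<lambda>l. ball_integral s (4 * l) (incr f \<zeta> x) x) \<in> borel_measurable borel"
    using monoD[OF ball_integral_mono_radius[of s "incr f \<zeta> x" x]]
    by (intro borel_measurable_mono_ennreal monoI) auto
  have "(\<lambda>l. ennreal (l powr (\<zeta> - \<gamma>)) * (ball_integral s (4 * l) (incr f \<zeta> x) x / ennreal (2 ^ CARD('d) * (4 * l) ^ scal_size s)))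
     \<in> borel_measurable borel" by measurable
  from borel_measurable_scale_measure01[OF this]
  show ?thesis
    by (rule measurable_cong[THEN iffD1, rotated])
      (use s_pos in \<open>auto simp: space_scale_measure01 mean_increment_eq[OF f] ball_avg_def emeasure_sball simp del: emeasure_completion\<close>)
qed

end

section \<open>A control function for modelled distributions\<close>

context reg_model
begin

text \<open>This bounds the \<open>c\<close>-component of the mean increment at all scales of \<open>dyadic n\<close> at once: the first
factor is an upper bound for \<open>l powr (c - \<gamma>)\<close> divided by the \<open>scal_size s\<close>-th power of \<open>l\<close>.  The ball has
radius \<open>8 * (1/2)^n\<close> because averages over the ball of radius \<open>4 * l\<close> around a point \<open>x\<close> also have
to be compared with increments based at another point of that ball.\<close>

definition dyadic_incr :: "real \<Rightarrow> (real^'d \<Rightarrow> 't) \<Rightarrow> real \<Rightarrow> nat \<Rightarrow> real^'d \<Rightarrow> ennreal" where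
  "dyadic_incr \<gamma> f c n x = ennreal ((2 ^ Suc n) powr (\<gamma> - c + real (scal_size s)))
     * ball_integral s (8 * (1/2)^n) (incr f c x) x"

definition dyadic_total :: "real \<Rightarrow> (real^'d \<Rightarrow> 't) \<Rightarrow> nat \<Rightarrow> real^'d \<Rightarrow> ennreal" where
  "dyadic_total \<gamma> f n x = (\<Sum>c\<in>below \<gamma>. dyadic_incr \<gamma> f c n x)"

text \<open>The function \<open>H\<close> of the pointwise estimate.  It dominates \<open>f\<close> itself and the \<open>\<ell>\<^sup>q\<close> norm, hence also
the supremum, of its mean increments over the dyadic scales.\<close>

definition control :: "real \<Rightarrow> ennreal \<Rightarrow> (real^'d \<Rightarrow> 't) \<Rightarrow> real^'d \<Rightarrow> ennreal" where
  "control \<gamma> q f x = ennreal (total \<gamma> (f x)) + lq_norm q (\<lambda>n. dyadic_total \<gamma> f n x)"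

lemma dyadic_incr_measurable:
  assumes f: "measurable_dist \<gamma> f" shows "dyadic_incr \<gamma>' f c n \<in> borel_measurable lebesgue"
  unfolding dyadic_incr_def[abs_def]
  by (intro borel_measurable_times_ennreal borel_measurable_const ball_integral_incr_measurable[OF f]) simp

lemma dyadic_total_measurable:
  assumes f: "measurable_dist \<gamma> f" shows "dyadic_total \<gamma> f n \<in> borel_measurable lebesgue"
  unfolding dyadic_total_def[abs_def] by (intro borel_measurable_sum dyadic_incr_measurable[OF f])

lemma total_measurable:
  assumes f: "measurable_dist \<gamma> f" shows "(\<lambda>x. total \<gamma> (f x)) \<in> borel_measurable lebesgue"
  unfolding total_def by (intro borel_measurable_sum hsize_measurable[OF f])

lemma control_measurable:
  assumes f: "measurable_dist \<gamma> f" shows "control \<gamma> q f \<in> borel_measurable lebesgue"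
proof -
  note [measurable] = dyadic_total_measurable[OF f] total_measurable[OF f]
  show ?thesis unfolding control_def[abs_def] by measurable
qed

lemma dyadic_total_le_control: "1 \<le> q \<Longrightarrow> dyadic_total \<gamma> f n x \<le> control \<gamma> q f x"
  unfolding control_def using lq_norm_ge[of q "\<lambda>n. dyadic_total \<gamma> f n x" n]
  by (simp add: add_increasing)

text \<open>All components of an increment, each divided by the power of the scale that is expected of it.\<close>

definition weighted_incr :: "real \<Rightarrow> (real^'d \<Rightarrow> 't) \<Rightarrow> real \<Rightarrow> real^'d \<Rightarrow> real^'d \<Rightarrow> ennreal" where
  "weighted_incr \<gamma> f l x y = (\<Sum>a\<in>below \<gamma>. ennreal (l powr (a - \<gamma>)) * incr f a x y)"

lemma weighted_incr_measurable:
  assumes f: "measurable_dist \<gamma> f" shows "weighted_incr \<gamma> f l x \<in> borel_measurable lebesgue"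
proof -
  note [measurable] = incr_measurable[OF f]
  show ?thesis unfolding weighted_incr_def[abs_def] by measurable
qed

text \<open>The ball of radius \<open>4 * l\<close> around \<open>x\<close> is contained in the one of radius \<open>8 * (1/2)^n\<close> around
\<open>y\<close>.\<close>

lemma weighted_avg_le_dyadic_incr:
  assumes l: "l \<in> dyadic n" and c: "c \<in> below \<gamma>" and xy: "snorm s (y - x) \<le> 4 * l"
  shows "ennreal (l powr (c - \<gamma>)) * ball_avg s l (incr f c y) x \<le> dyadic_incr \<gamma> f c n y"
proof -
  have l0: "0 < l" "l \<le> (1/2)^n" using l dyadic_subset[of n] by (auto simp: dyadic_def)
  have "sball s x (4 * l) \<subseteq> sball s y (8 * (1/2)^n)"
    using sball_trans[OF s_pos, of x y "4 * l" _ "4 * l"] xy l0 by (force simp: mem_sball snorm_commute)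
  then have "ball_integral s (4 * l) (incr f c y) x \<le> ball_integral s (8 * (1/2)^n) (incr f c y) y"
    unfolding ball_integral_def by (intro nn_integral_mono) (auto simp: indicator_def)
  then have "ball_avg s l (incr f c y) x \<le> ennreal (l powr (- real (scal_size s))) * ball_integral s (8 * (1/2)^n) (incr f c y) y"
    by (intro order_trans[OF ball_avg_le[OF s_pos l0(1)]] mult_left_mono) auto
  then have "ennreal (l powr (c - \<gamma>)) * ball_avg s l (incr f c y) x \<le>
      ennreal (l powr (c - \<gamma>)) * (ennreal (l powr (- real (scal_size s))) * ball_integral s (8 * (1/2)^n) (incr f c y) y)"
    by (rule mult_left_mono) simp
  also have "\<dots> = ennreal (l powr (- (\<gamma> - c + real (scal_size s)))) * ball_integral s (8 * (1/2)^n) (incr f c y) y"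
    using powr_add[of l "c - \<gamma>" "- real (scal_size s)"] by (simp add: ennreal_mult mult_ac)
  also have "\<dots> \<le> dyadic_incr \<gamma> f c n y"
    unfolding dyadic_incr_def using c
    by (intro mult_right_mono ennreal_leI powr_dyadic_le[OF l]) (auto simp: homs_below_def)
  finally show ?thesis .
qed

lemma weighted_incr_avg_le:
  assumes f: "measurable_dist \<gamma> f" and l: "l \<in> dyadic n" and xy: "snorm s (y - x) \<le> 4 * l"
  shows "ball_avg s l (weighted_incr \<gamma> f l y) x \<le> dyadic_total \<gamma> f n y"
proof -
  have l0: "0 < l" using l dyadic_subset[of n] by auto
  note [measurable] = incr_measurable[OF f]
  have "ball_avg s l (weighted_incr \<gamma> f l y) x = (\<Sum>c\<in>below \<gamma>. ennreal (l powr (c - \<gamma>)) * ball_avg s l (incr f c y) x)"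
    unfolding weighted_incr_def[abs_def]
    by (subst ball_avg_sum[OF s_pos l0]) (simp_all add: ball_avg_cmult[OF s_pos l0] incr_measurable[OF f])
  also have "\<dots> \<le> dyadic_total \<gamma> f n y"
    unfolding dyadic_total_def by (intro sum_mono weighted_avg_le_dyadic_incr[OF l _ xy])
  finally show ?thesis .
qed

text \<open>The shift by two scales turns the radius \<open>8 * (1/2)^n\<close> into \<open>2 * (1/2)^n\<close>, which is at most the
radius \<open>4 * l\<close> of the mean increment.\<close>

lemma dyadic_incr_le_mean_increment:
  assumes f: "measurable_dist \<gamma> f" and l: "l \<in> dyadic n" and c: "c \<in> below \<gamma>"
  shows "dyadic_incr \<gamma> f c (n + 2) x \<le> ennreal (8 powr (\<gamma> - c + real (scal_size s)) * (2 ^ CARD('d) * 4 ^ scal_size s))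
     * mean_increment R s \<Gamma> \<gamma> c f x l"
proof -
  define \<theta> where "\<theta> = \<gamma> - c + real (scal_size s)"
  have \<theta>: "0 \<le> \<theta>" using c by (simp add: \<theta>_def homs_below_def)
  have l0: "0 < l" "(1/2)^Suc n < l" using l dyadic_subset[of n] by (auto simp: dyadic_def)
  have r: "8 * (1/2)^(n + 2) \<le> 4 * l" using l0 by simp
  have "(2 ^ Suc (n + 2)) powr \<theta> = 8 powr \<theta> * (2 ^ n) powr \<theta>"
    by (simp add: powr_mult[symmetric])
  also have "\<dots> \<le> 8 powr \<theta> * l powr (- \<theta>)"
    by (intro mult_left_mono powr_dyadic_ge[OF l \<theta>]) simp
  finally have le: "(2 ^ Suc (n + 2)) powr \<theta> \<le> 8 powr \<theta> * l powr (- \<theta>)" .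
  have "dyadic_incr \<gamma> f c (n + 2) x \<le> ennreal (8 powr \<theta> * l powr (- \<theta>)) * ball_integral s (4 * l) (incr f c x) x"
    unfolding dyadic_incr_def \<theta>_def[symmetric]
    by (intro mult_mono ennreal_leI le monoD[OF ball_integral_mono_radius] r) auto
  also have "8 powr \<theta> * l powr (- \<theta>) = 8 powr \<theta> * (2 ^ CARD('d) * 4 ^ scal_size s) * (l powr (c - \<gamma>) * (1 / (2 ^ CARD('d) * (4 * l) ^ scal_size s)))"
  proof -
    have "l powr (- \<theta>) = l powr (c - \<gamma>) * l powr (- real (scal_size s))"
      by (simp add: \<theta>_def powr_add[symmetric])
    also have "l powr (- real (scal_size s)) = 1 / l ^ scal_size s"
      using l0 by (simp add: powr_minus_divide powr_realpow)
    finally show ?thesis by (simp add: power_mult_distrib)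
  qed
  also have "ennreal \<dots> * ball_integral s (4 * l) (incr f c x) x =
     ennreal (8 powr \<theta> * (2 ^ CARD('d) * 4 ^ scal_size s)) *
      (ennreal (l powr (c - \<gamma>)) * (ball_integral s (4 * l) (incr f c x) x * ennreal (1 / (2 ^ CARD('d) * (4 * l) ^ scal_size s))))"
    using l0 by (subst ennreal_mult, simp, simp, subst (2) ennreal_mult) (auto simp: mult_ac)
  also have "ennreal (1 / (2 ^ CARD('d) * (4 * l) ^ scal_size s)) = inverse (emeasure lebesgue (sball s (0::real^'d) (4 * l)))"
    using l0 s_pos by (subst emeasure_sball) (auto simp: inverse_ennreal inverse_eq_divide)
  finally show ?thesis by (simp add: mean_increment_eq[OF f l0(1)] ball_avg_def divide_ennreal_def \<theta>_def)
qed

text \<open>The pointwise estimate.  For each \<open>u\<close> in the ball around \<open>x\<close>, the increment from \<open>x\<close> to \<open>y\<close> is the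
difference of the increments from \<open>x\<close> to \<open>u\<close> and from \<open>y\<close> to \<open>u\<close>, transported to \<open>y\<close>.
Averaging over \<open>u\<close> leaves mean increments at \<open>x\<close> and at \<open>y\<close>.\<close>

lemma weighted_incr_le_dyadic_total:
  obtains M where "0 \<le> M"
    "\<And>\<gamma> f l n x y. \<gamma> \<le> \<gamma>' \<Longrightarrow> measurable_dist \<gamma> f \<Longrightarrow> l \<in> dyadic n \<Longrightarrow> snorm s (y - x) \<le> 4 * l \<Longrightarrow>
      weighted_incr \<gamma> f l x y \<le> ennreal M * (dyadic_total \<gamma> f n x + dyadic_total \<gamma> f n y)"
proof -
  obtain M where M: "\<Gamma>_bounded \<gamma>' M" using \<Gamma>_bounded_ex by blast
  then have M0: "0 \<le> M" by (simp add: \<Gamma>_bounded_def)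
  show ?thesis
  proof (rule that[of "real (card (below \<gamma>')) * M"])
    show "0 \<le> real (card (below \<gamma>')) * M" using M0 by simp
    fix \<gamma> f l n x y
    assume \<gamma>: "\<gamma> \<le> \<gamma>'" and f: "measurable_dist \<gamma> f" and l: "l \<in> dyadic n" and xy: "snorm s (y - x) \<le> 4 * l"
    have l01: "0 < l" "l \<le> 1" using l dyadic_subset[of n] by auto
    have fh: "f z \<in> hsum R {..<\<gamma>}" for z using f by (simp add: measurable_dist_def)
    note [measurable] = weighted_incr_measurable[OF f]
    define U where "U u = weighted_incr \<gamma> f l x u + weighted_incr \<gamma> f l y u" for u
    have [measurable]: "U \<in> borel_measurable lebesgue" unfolding U_def[abs_def] by measurable
    \<comment> \<open>any intermediate point \<open>u\<close> serves; the right-hand side is averaged over \<open>u\<close> below\<close>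
    have pt: "weighted_incr \<gamma> f l x y \<le> ennreal (real (card (below \<gamma>')) * M) * U u"
      if u: "u \<in> sball s x (4 * l)" for u
    proof -
      have yu: "snorm s (y - u) \<le> 16 * l"
        using snorm_triangle[OF s_pos, of "y - x" "x - u"] xy u l01 by (simp add: mem_sball snorm_commute)
      define dx dy where "dx = f u - \<Gamma> u x (f x)" and "dy = f u - \<Gamma> u y (f y)"
      have h: "dx \<in> hsum R {..<\<gamma>}" "dy \<in> hsum R {..<\<gamma>}"
        unfolding dx_def dy_def by (rule hsum_diff[OF fh sgroup_hsum[OF \<Gamma>_sgroup fh]])+
      have eq: "f y - \<Gamma> y x (f x) = \<Gamma> y u dx - \<Gamma> y u dy"
        by (simp add: dx_def dy_def \<Gamma>_diff \<Gamma>_comp \<Gamma>_refl)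
      have one: "ennreal (l powr (a - \<gamma>)) * incr f a x y \<le> ennreal M * U u" for a
      proof -
        have "hsize R a (f y - \<Gamma> y x (f x)) \<le> hsize R a (\<Gamma> y u dx) + hsize R a (\<Gamma> y u dy)"
          unfolding eq by (rule hsize_diff)
        also have "\<dots> \<le> M * (\<Sum>c\<in>below \<gamma>. hsize R c dx * l powr (c - a)) + M * (\<Sum>c\<in>below \<gamma>. hsize R c dy * l powr (c - a))"
          by (intro add_mono \<Gamma>_bound_hsum[OF M l01 yu \<gamma>] h)
        finally have "l powr (a - \<gamma>) * hsize R a (f y - \<Gamma> y x (f x)) \<le> l powr (a - \<gamma>) * \<dots>"
          by (rule mult_left_mono) simp
        also have "\<dots> = M * (\<Sum>c\<in>below \<gamma>. (l powr (a - \<gamma>) * l powr (c - a)) * (hsize R c dx + hsize R c dy))"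
          by (simp add: sum_distrib_left sum.distrib[symmetric] algebra_simps)
        also have "\<dots> = M * (\<Sum>c\<in>below \<gamma>. l powr (c - \<gamma>) * (hsize R c dx + hsize R c dy))"
          by (simp add: powr_add[symmetric])
        finally have "ennreal (l powr (a - \<gamma>)) * incr f a x y \<le> ennreal (M * (\<Sum>c\<in>below \<gamma>. l powr (c - \<gamma>) * (hsize R c dx + hsize R c dy)))"
          unfolding incr_def by (subst ennreal_mult[symmetric]) (auto simp: hsize_nonneg intro: ennreal_leI)
        also have "\<dots> = ennreal M * (\<Sum>c\<in>below \<gamma>. ennreal (l powr (c - \<gamma>) * (hsize R c dx + hsize R c dy)))"
          using M0 by (subst sum_ennreal) (auto simp: ennreal_mult sum_nonneg hsize_nonneg simp del: ennreal_plus)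
        also have "\<dots> = ennreal M * U u"
          by (simp add: U_def weighted_incr_def incr_def dx_def dy_def ennreal_mult hsize_nonneg distrib_left sum.distrib)
        finally show ?thesis .
      qed
      have "weighted_incr \<gamma> f l x y \<le> of_nat (card (below \<gamma>)) * (ennreal M * U u)"
        unfolding weighted_incr_def[of _ _ _ x y] by (intro sum_bounded_above one)
      also have "\<dots> \<le> of_nat (card (below \<gamma>')) * (ennreal M * U u)"
        using \<gamma> finite_homs_below by (intro mult_right_mono of_nat_mono card_mono) (auto simp: homs_below_def)
      finally show ?thesis using M0 by (simp add: ennreal_mult ennreal_of_nat_eq_real_of_nat mult.assoc)
    qed
    have "weighted_incr \<gamma> f l x y = ball_avg s l (\<lambda>_. weighted_incr \<gamma> f l x y) x"
      by (simp add: ball_avg_const[OF s_pos l01(1)])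
    also have "\<dots> \<le> ball_avg s l (\<lambda>u. ennreal (real (card (below \<gamma>')) * M) * U u) x"
      by (rule ball_avg_mono[OF s_pos l01(1) pt])
    also have "\<dots> = ennreal (real (card (below \<gamma>')) * M) * (ball_avg s l (weighted_incr \<gamma> f l x) x + ball_avg s l (weighted_incr \<gamma> f l y) x)"
      unfolding U_def[abs_def] by (simp add: ball_avg_cmult[OF s_pos l01(1)] ball_avg_add[OF s_pos l01(1)])
    also have "\<dots> \<le> ennreal (real (card (below \<gamma>')) * M) * (dyadic_total \<gamma> f n x + dyadic_total \<gamma> f n y)"
      using l01 snorm_le_iff[OF s_pos, of "4 * l" 0] xy
      by (intro mult_left_mono add_mono weighted_incr_avg_le[OF f l]) auto
    finally show "weighted_incr \<gamma> f l x y \<le> ennreal (real (card (below \<gamma>')) * M) * (dyadic_total \<gamma> f n x + dyadic_total \<gamma> f n y)" .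
  qed
qed

text \<open>From the third dyadic scale on, the terms of the control function are dominated by the mean
increments of the norm.  The first two would require scales above 1.  There the increment is
estimated by its two parts, and the part depending on \<open>u\<close> by an average of \<open>f\<close> over a ball of
radius 8, whose \<open>L\<^sup>p\<close> norm is under control by Jensen's inequality.\<close>

lemma Lnorm_control:
  assumes p: "1 \<le> p" and q: "1 \<le> q"
  obtains C :: real where "0 \<le> C"
    "\<And>f. measurable_dist \<gamma> f \<Longrightarrow>
      Lp p (control \<gamma> q f) \<le> ennreal C * F_norm R s \<Gamma> \<gamma> (ennreal p) q f"
proof -
  obtain M where M: "\<Gamma>_bounded \<gamma> M" using \<Gamma>_bounded_ex by blast
  then have M0: "0 \<le> M" by (simp add: \<Gamma>_bounded_def)
  define m :: real where "m = 2 ^ CARD('d) * 8 ^ scal_size s"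
  have m: "emeasure lebesgue (sball s (x::real^'d) 8) = ennreal m" for x
    using s_pos unfolding m_def by (intro emeasure_sball) auto
  define k where "k = card (below \<gamma>)"
  define A :: real where "A = (\<Sum>c\<in>below \<gamma>. 4 powr (\<gamma> - c + real (scal_size s)))"
  define K :: real where "K = 1 + (\<Sum>c\<in>below \<gamma>. 8 powr (\<gamma> - c + real (scal_size s)) * (2 ^ CARD('d) * 4 ^ scal_size s))"
  have A0: "0 \<le> A" "0 \<le> m" by (auto simp: A_def m_def sum_nonneg)
  have K1: "1 \<le> K" by (simp add: K_def sum_nonneg)
  have A_ge: "4 powr (\<gamma> - c + real (scal_size s)) \<le> A" if "c \<in> below \<gamma>" for c
    unfolding A_def using that finite_homs_below by (intro member_le_sum) auto
  have K_ge: "8 powr (\<gamma> - c + real (scal_size s)) * (2 ^ CARD('d) * 4 ^ scal_size s) \<le> K" if "c \<in> below \<gamma>" for c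
  proof -
    have "8 powr (\<gamma> - c + real (scal_size s)) * (2 ^ CARD('d) * 4 ^ scal_size s) \<le> (\<Sum>c\<in>below \<gamma>. 8 powr (\<gamma> - c + real (scal_size s)) * (2 ^ CARD('d) * 4 ^ scal_size s))"
      using that finite_homs_below
      by (intro member_le_sum[of c _ "\<lambda>c. 8 powr (\<gamma> - c + real (scal_size s)) * (2 ^ CARD('d) * 4 ^ scal_size s)"]) auto
    then show ?thesis by (simp add: K_def)
  qed
  define c2 :: real where "c2 = 9 * (2 * (A * (1 + m * M)) + 1)"
  have c2: "0 \<le> c2" using A0 M0 by (simp add: c2_def)
  define c3 :: real where "c3 = 1 + real (k * k) * (real k * c2)"
  have c3: "0 < c3" using c2 by (simp add: c3_def add_pos_nonneg)
  define c4 :: real where "c4 = real (k * k) * (real k * (4 * (1 + 4 * (m + 2 * K))))"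
  show ?thesis
  proof
    show "0 \<le> c3 * c4" using c3 A0 K1 by (simp add: c4_def)
    fix f assume f: "measurable_dist \<gamma> f"
    define T where "T = F_norm R s \<Gamma> \<gamma> (ennreal p) q f"
    have fh: "f z \<in> hsum R {..<\<gamma>}" for z using f by (simp add: measurable_dist_def)
    define u where "u c x = ennreal (hsize R c (f x))" for c x
    have um[measurable]: "u c \<in> borel_measurable lebesgue" for c
      using hsize_measurable[OF f, of c] unfolding u_def[abs_def] by measurable
    define B where "B c = ball_integral s 8 (u c)" for c
    have Bm[measurable]: "B c \<in> borel_measurable lebesgue" for c
      unfolding B_def using s_pos um by (intro ball_integral_measurable) auto
    define D where "D c x = lq_norm q (\<lambda>n. dyadic_incr \<gamma> f c (n + 2) x)" for c x
    have Dm[measurable]: "D c \<in> borel_measurable lebesgue" for c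
      unfolding D_def[abs_def] using dyadic_incr_measurable[OF f] by (intro lq_norm_measurable) auto
    define X where "X x = (\<Sum>c\<in>below \<gamma>. u c x + (B c x + D c x))" for x
    have tot: "ennreal (total \<gamma> (f x)) = (\<Sum>c\<in>below \<gamma>. u c x)" for x
      unfolding total_def u_def by (intro sum_ennreal[symmetric] hsize_nonneg)
    have totX: "ennreal (total \<gamma> (f x)) \<le> X x" for x
      unfolding tot X_def by (intro sum_mono) (simp add: add_increasing2)
    have partX: "B c x \<le> X x" "D c x \<le> X x" if "c \<in> below \<gamma>" for c x
    proof -
      have "u c x + (B c x + D c x) \<le> X x"
        unfolding X_def using that finite_homs_below
        by (intro member_le_sum[of c _ "\<lambda>c. u c x + (B c x + D c x)"]) auto
      moreover have "B c x \<le> u c x + (B c x + D c x)" "D c x \<le> u c x + (B c x + D c x)"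
        by (simp_all add: add_increasing add_increasing2)
      ultimately show "B c x \<le> X x" "D c x \<le> X x" by (blast intro: order_trans)+
    qed
    \<comment> \<open>scale 1: the increment is estimated by its two parts\<close>
    have large: "ball_integral s 8 (incr f c x) x \<le> ennreal (1 + m * M) * X x" if c: "c \<in> below \<gamma>" for c x
    proof -
      have "incr f c x v \<le> u c v + ennreal M * X x" if v: "v \<in> sball s x 8" for v
      proof -
        have "hsize R c (\<Gamma> v x (f x)) \<le> M * (\<Sum>b\<in>below \<gamma>. hsize R b (f x) * 1 powr (b - c))"
          using v by (intro \<Gamma>_bound_hsum[OF M]) (auto simp: mem_sball fh)
        then have G: "hsize R c (\<Gamma> v x (f x)) \<le> M * total \<gamma> (f x)" by (simp add: total_def)
        have "hsize R c (f v - \<Gamma> v x (f x)) \<le> hsize R c (f v) + M * total \<gamma> (f x)"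
          using hsize_diff[of c "f v" "\<Gamma> v x (f x)"] G by simp
        then have "incr f c x v \<le> ennreal (hsize R c (f v) + M * total \<gamma> (f x))"
          unfolding incr_def by (rule ennreal_leI)
        also have "\<dots> = u c v + ennreal M * ennreal (total \<gamma> (f x))"
          using M0 hsize_nonneg total_nonneg by (simp add: u_def ennreal_mult)
        also have "\<dots> \<le> u c v + ennreal M * X x" by (intro add_left_mono mult_left_mono totX) auto
        finally show ?thesis .
      qed
      then have "ball_integral s 8 (incr f c x) x \<le> (\<integral>\<^sup>+v. u c v * indicator (sball s x 8) v + ennreal M * X x * indicator (sball s x 8) v \<partial>lebesgue)"
        unfolding ball_integral_def by (intro nn_integral_mono) (auto simp: indicator_def)
      also have "\<dots> = B c x + ennreal M * X x * ennreal m"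
        using sets_sball[OF s_pos, of 8 x] m[of x]
        by (subst nn_integral_add) (auto simp: B_def ball_integral_def nn_integral_cmult_indicator simp del: emeasure_completion)
      also have "\<dots> \<le> X x + ennreal M * X x * ennreal m" using partX[OF c] by (intro add_right_mono)
      also have "\<dots> = ennreal (1 + m * M) * X x"
        using A0 M0 by (simp add: ennreal_mult distrib_left distrib_right mult_ac)
      finally show ?thesis .
    qed
    \<comment> \<open>the scales \<open>n = 0\<close> and \<open>n = 1\<close>\<close>
    have small_n: "dyadic_incr \<gamma> f c n x \<le> ennreal (A * (1 + m * M)) * X x" if c: "c \<in> below \<gamma>" and n: "n \<le> 1" for c n x
    proof -
      have "(2 ^ Suc n) powr (\<gamma> - c + real (scal_size s)) \<le> 4 powr (\<gamma> - c + real (scal_size s))"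
        using n c power_increasing[of "Suc n" 2 "2::real"] by (intro powr_mono2) (auto simp: homs_below_def)
      also have "\<dots> \<le> A" by (rule A_ge[OF c])
      finally have w: "(2 ^ Suc n) powr (\<gamma> - c + real (scal_size s)) \<le> A" .
      have "8 * (1/2)^n \<le> (8::real)" by (simp add: power_le_one)
      then have "dyadic_incr \<gamma> f c n x \<le> ennreal A * ball_integral s 8 (incr f c x) x"
        unfolding dyadic_incr_def using w by (intro mult_mono ennreal_leI monoD[OF ball_integral_mono_radius]) auto
      also have "\<dots> \<le> ennreal A * (ennreal (1 + m * M) * X x)" by (intro mult_left_mono large[OF c]) auto
      finally show ?thesis using A0 M0 by (simp add: ennreal_mult mult.assoc)
    qed
    have lqc: "lq_norm q (\<lambda>n. dyadic_incr \<gamma> f c n x) \<le> ennreal c2 * X x" if c: "c \<in> below \<gamma>" for c x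
    proof -
      have "lq_norm q (\<lambda>n. dyadic_incr \<gamma> f c n x) \<le> 9 * (dyadic_incr \<gamma> f c 0 x + dyadic_incr \<gamma> f c 1 x + D c x)"
        unfolding D_def by (rule lq_norm_shift[OF q])
      also have "\<dots> \<le> 9 * (ennreal (A * (1 + m * M)) * X x + ennreal (A * (1 + m * M)) * X x + X x)"
        by (intro mult_left_mono add_mono small_n c partX) auto
      also have "\<dots> = 9 * ((ennreal (A * (1 + m * M)) + ennreal (A * (1 + m * M)) + 1) * X x)"
        by (simp add: distrib_right)
      also have "ennreal (A * (1 + m * M)) + ennreal (A * (1 + m * M)) + 1 = ennreal (2 * (A * (1 + m * M)) + 1)"
        using A0 M0 by (simp add: ennreal_plus[symmetric] del: ennreal_plus flip: ennreal_1)
      also have "9 * (ennreal (2 * (A * (1 + m * M)) + 1) * X x) = ennreal c2 * X x"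
        using A0 M0 ennreal_mult[of 9 "2 * (A * (1 + m * M)) + 1"]
        by (simp add: c2_def mult.assoc del: ennreal_plus)
      finally show ?thesis .
    qed
    have ctrl: "control \<gamma> q f x \<le> ennreal c3 * X x" for x
    proof -
      have "lq_norm q (\<lambda>n. dyadic_total \<gamma> f n x) \<le> of_nat (k * k) * (\<Sum>c\<in>below \<gamma>. lq_norm q (\<lambda>n. dyadic_incr \<gamma> f c n x))"
        unfolding dyadic_total_def k_def by (rule lq_norm_sum[OF q finite_homs_below])
      also have "\<dots> \<le> of_nat (k * k) * (\<Sum>c\<in>below \<gamma>. ennreal c2 * X x)"
        by (intro mult_left_mono sum_mono lqc) auto
      also have "\<dots> = ennreal (real (k * k) * (real k * c2)) * X x"
        using c2 by (simp add: k_def ennreal_mult ennreal_of_nat_eq_real_of_nat mult.assoc)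
      finally have "control \<gamma> q f x \<le> X x + ennreal (real (k * k) * (real k * c2)) * X x"
        unfolding control_def by (intro add_mono totX)
      also have "\<dots> = ennreal c3 * X x"
        using c2 by (simp add: c3_def distrib_right)
      finally show ?thesis .
    qed
    have Tu: "Lp p (u c) \<le> T" if "c \<in> below \<gamma>" for c
      unfolding T_def F_norm_def u_def using that by (intro add_increasing2 SUP_upper) auto
    have TD: "Lp p (D c) \<le> ennreal (2 * K) * T" if c: "c \<in> below \<gamma>" for c
    proof -
      have "Lp p (D c) \<le> ennreal (2 * K) * Lp p (\<lambda>x. Lnorm q scale_measure01 (mean_increment R s \<Gamma> \<gamma> c f x))"
      proof (rule Lnorm_real_le_cmult)
        fix x
        have inv: "ennreal K * (ennreal (1/K) * a) = a" for a
          using K1 by (simp add: mult.assoc[symmetric] ennreal_mult[symmetric])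
        have b: "ennreal (1/K) * dyadic_incr \<gamma> f c (n + 2) x \<le> mean_increment R s \<Gamma> \<gamma> c f x l" if l: "l \<in> dyadic n" for n l
        proof -
          have "dyadic_incr \<gamma> f c (n + 2) x \<le> ennreal K * mean_increment R s \<Gamma> \<gamma> c f x l"
            by (rule order_trans[OF dyadic_incr_le_mean_increment[OF f l c]])
              (intro mult_right_mono ennreal_leI K_ge[OF c], simp)
          from mult_left_mono[OF this, of "ennreal (1/K)"] show ?thesis
            using K1 by (simp add: mult.assoc[symmetric] ennreal_mult[symmetric])
        qed
        have "D c x = lq_norm q (\<lambda>n. ennreal K * (ennreal (1/K) * dyadic_incr \<gamma> f c (n + 2) x))"
          unfolding D_def inv ..
        also have "\<dots> = ennreal K * lq_norm q (\<lambda>n. ennreal (1/K) * dyadic_incr \<gamma> f c (n + 2) x)"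
          by (rule lq_norm_cmult[OF q])
        also have "\<dots> \<le> ennreal K * (2 * Lnorm q scale_measure01 (mean_increment R s \<Gamma> \<gamma> c f x))"
          by (intro mult_left_mono lq_norm_le_Lnorm_scale[OF q] b) auto
        also have "\<dots> = ennreal (2 * K) * Lnorm q scale_measure01 (mean_increment R s \<Gamma> \<gamma> c f x)"
          using K1 by (simp add: ennreal_mult mult_ac)
        finally show "D c x \<le> ennreal (2 * K) * Lnorm q scale_measure01 (mean_increment R s \<Gamma> \<gamma> c f x)" .
      qed (use p K1 Dm in auto)
      also have "\<dots> \<le> ennreal (2 * K) * T"
        unfolding T_def F_norm_def using c by (intro mult_left_mono add_increasing SUP_upper) auto
      finally show ?thesis .
    qed
    have TB: "Lp p (B c) \<le> ennreal m * T" if c: "c \<in> below \<gamma>" for c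
    proof -
      have "Lp p (B c) \<le> emeasure lebesgue (sball s (0::real^'d) 8) * Lp p (u c)"
        unfolding B_def using s_pos p um by (intro Lnorm_ball_integral) auto
      also have "\<dots> \<le> ennreal m * T" unfolding m by (intro mult_left_mono Tu c) auto
      finally show ?thesis .
    qed
    have one: "Lp p (\<lambda>x. u c x + (B c x + D c x)) \<le> ennreal (4 * (1 + 4 * (m + 2 * K))) * T" if c: "c \<in> below \<gamma>" for c
    proof -
      have "Lp p (\<lambda>x. u c x + (B c x + D c x)) \<le> 4 * (Lp p (u c) + Lp p (\<lambda>x. B c x + D c x))"
        using p by (intro Lnorm_real_add) auto
      also have "\<dots> \<le> 4 * (T + 4 * (Lp p (B c) + Lp p (D c)))"
        using p c by (intro mult_left_mono add_mono Tu Lnorm_real_add) auto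
      also have "\<dots> \<le> 4 * (T + 4 * (ennreal m * T + ennreal (2 * K) * T))"
        by (intro mult_left_mono add_mono order_refl TB TD c) auto
      also have "\<dots> = 4 * ((1 + 4 * (ennreal m + ennreal (2 * K))) * T)"
        by (simp add: distrib_right mult.assoc)
      also have "\<dots> = ennreal (4 * (1 + 4 * (m + 2 * K))) * T"
        using A0 K1 by (simp add: ennreal_mult distrib_left distrib_right mult.assoc[symmetric])
      finally show ?thesis .
    qed
    have "Lp p (control \<gamma> q f) \<le> ennreal c3 * Lp p X"
      using p c3 control_measurable[OF f] ctrl by (intro Lnorm_real_le_cmult) auto
    also have "Lp p X \<le> of_nat (k * k) * (\<Sum>c\<in>below \<gamma>. Lp p (\<lambda>x. u c x + (B c x + D c x)))"
      unfolding X_def[abs_def] k_def by (rule Lnorm_real_sum[OF p finite_homs_below]) measurable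
    also have "\<dots> \<le> of_nat (k * k) * (\<Sum>c\<in>below \<gamma>. ennreal (4 * (1 + 4 * (m + 2 * K))) * T)"
      by (intro mult_left_mono sum_mono one) auto
    also have "\<dots> = ennreal c4 * T"
      unfolding c4_def using A0 K1
      by (simp add: k_def ennreal_mult ennreal_of_nat_eq_real_of_nat mult.assoc del: ennreal_plus)
    finally show "Lp p (control \<gamma> q f) \<le> ennreal (c3 * c4) * F_norm R s \<Gamma> \<gamma> (ennreal p) q f"
      using c3 A0 K1 unfolding T_def by (simp add: ennreal_mult mult.assoc c4_def mult_left_mono)
  qed
qed

end

section \<open>Strong measurability of the product\<close>

lemma squeeze_null:
  fixes a b :: "nat \<Rightarrow> real"
  assumes "\<And>n. a n \<le> b n" "\<And>n. 0 \<le> a n" "b \<longlonglongrightarrow> L" "L = 0"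
  shows "a \<longlonglongrightarrow> 0"
  using assms by (intro tendsto_sandwich[of "\<lambda>_. 0" a sequentially b 0]) auto

context reg_struct
begin

lemma near_best_approximation:
  assumes U: "subspace U" and "0 < e" and v: "v \<in> homspace R a"
  shows "\<exists>w \<in> U \<inter> homspace R a. \<forall>z \<in> U \<inter> homspace R a. N a (v - w) \<le> N a (v - z) + e"
proof -
  define D where "D = (\<lambda>z. N a (v - z)) ` (U \<inter> homspace R a)"
  have ne: "D \<noteq> {}" using subspace_0[OF U] homspace_0 by (auto simp: D_def)
  have bd: "bdd_below D"
    unfolding D_def using v homspace_diff N_nonneg by (intro bdd_belowI[of _ 0]) auto
  have "Inf D < Inf D + e" using \<open>0 < e\<close> by simp
  then obtain d where d: "d \<in> D" "d < Inf D + e" using cInf_lessD[OF ne] by blast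
  then obtain w where w: "w \<in> U \<inter> homspace R a" "d = N a (v - w)" by (auto simp: D_def)
  have "N a (v - w) \<le> N a (v - z) + e" if "z \<in> U \<inter> homspace R a" for z
  proof -
    have "Inf D \<le> N a (v - z)" using bd that by (intro cInf_lower) (auto simp: D_def)
    then show ?thesis using d w by simp
  qed
  then show ?thesis using w by blast
qed

text \<open>The approximants of a strongly measurable function need not take values in the sector, where
alone the product is meaningful, and the sector need not be closed.  Replacing each value by a
nearly closest element of the sector at most doubles the distance to \<open>F x\<close>, up to an error
tending to 0.\<close>

lemma strongly_measurable_sector:
  fixes F :: "real^'d::finite \<Rightarrow> 't"
  assumes U: "subspace U" and F: "strongly_measurable R a F" "\<And>x. F x \<in> U \<inter> homspace R a"
  obtains S where "\<And>n::nat. simple_function lebesgue (S n)" "\<And>n x. S n x \<in> U \<inter> homspace R a"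
    "AE x in lebesgue. (\<lambda>n. N a (S n x - F x)) \<longlonglongrightarrow> 0"
proof -
  obtain S where S: "\<And>n::nat. simple_function lebesgue (S n)" "\<And>n x. S n x \<in> homspace R a"
    "AE x in lebesgue. (\<lambda>n. N a (S n x - F x)) \<longlonglongrightarrow> 0"
    using F(1) unfolding strongly_measurable_def by (auto simp: image_subset_iff)
  define P where "P n v w \<longleftrightarrow> w \<in> U \<inter> homspace R a \<and>
      (\<forall>z\<in>U \<inter> homspace R a. N a (v - w) \<le> N a (v - z) + inverse (real (Suc n)))" for n v w
  define \<phi> where "\<phi> n v = (SOME w. P n v w)" for n v
  have \<phi>0: "P n v (\<phi> n v)" if "v \<in> homspace R a" for n v
  proof -
    have "\<exists>w. P n v w"
      using near_best_approximation[OF U _ that, of "inverse (real (Suc n))"] unfolding P_def by auto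
    then show ?thesis unfolding \<phi>_def by (rule someI_ex)
  qed
  have \<phi>: "\<And>n v. v \<in> homspace R a \<Longrightarrow> \<phi> n v \<in> U \<inter> homspace R a"
    "\<And>n v z. v \<in> homspace R a \<Longrightarrow> z \<in> U \<inter> homspace R a \<Longrightarrow> N a (v - \<phi> n v) \<le> N a (v - z) + inverse (real (Suc n))"
    using \<phi>0 unfolding P_def by blast+
  show ?thesis
  proof
    show "simple_function lebesgue (\<lambda>x. \<phi> n (S n x))" for n
      by (rule simple_function_compose1[OF S(1)])
    show "\<phi> n (S n x) \<in> U \<inter> homspace R a" for n x by (rule \<phi>(1)[OF S(2)])
    show "AE x in lebesgue. (\<lambda>n. N a (\<phi> n (S n x) - F x)) \<longlonglongrightarrow> 0"
      using S(3)
    proof eventually_elim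
      case (elim x)
      have Fx: "F x \<in> homspace R a" using F(2) by blast
      have "N a (\<phi> n (S n x) - F x) \<le> 2 * N a (S n x - F x) + inverse (real (Suc n))" for n
      proof -
        have h: "S n x - \<phi> n (S n x) \<in> homspace R a" "S n x - F x \<in> homspace R a"
          using S(2) \<phi>(1) Fx homspace_diff by blast+
        have "N a (\<phi> n (S n x) - F x) = N a ((S n x - F x) - (S n x - \<phi> n (S n x)))" by simp
        also have "\<dots> \<le> N a (S n x - F x) + N a (S n x - \<phi> n (S n x))" by (rule N_diff[OF h(2,1)])
        also have "\<dots> \<le> N a (S n x - F x) + (N a (S n x - F x) + inverse (real (Suc n)))"
          by (intro add_left_mono \<phi>(2) S(2) F(2))
        finally show ?thesis by simp
      qed
      moreover have "0 \<le> N a (\<phi> n (S n x) - F x)" for n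
        using \<phi>(1)[OF S(2)] Fx homspace_diff N_nonneg by blast
      moreover have "(\<lambda>n. 2 * N a (S n x - F x) + inverse (real (Suc n))) \<longlonglongrightarrow> 2 * 0 + 0"
        by (intro tendsto_intros elim LIMSEQ_inverse_real_of_nat)
      ultimately show ?case by (rule squeeze_null) simp
    qed
  qed
qed

lemma strongly_measurable_zero: "strongly_measurable R \<zeta> (\<lambda>_::real^'d::finite. 0)"
  unfolding strongly_measurable_def
  by (intro exI[of _ "\<lambda>n x. 0"]) (auto simp: homspace_0 N_zero)

lemma strongly_measurable_add:
  fixes F G :: "real^'d::finite \<Rightarrow> 't"
  assumes F: "strongly_measurable R \<zeta> F" "\<And>x. F x \<in> homspace R \<zeta>"
    and G: "strongly_measurable R \<zeta> G" "\<And>x. G x \<in> homspace R \<zeta>"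
  shows "strongly_measurable R \<zeta> (\<lambda>x. F x + G x)"
proof -
  obtain S where S: "\<And>n::nat. simple_function lebesgue (S n)" "\<And>n x. S n x \<in> homspace R \<zeta>"
    "AE x in lebesgue. (\<lambda>n. N \<zeta> (S n x - F x)) \<longlonglongrightarrow> 0"
    using F(1) unfolding strongly_measurable_def by (auto simp: image_subset_iff)
  obtain T where T: "\<And>n::nat. simple_function lebesgue (T n)" "\<And>n x. T n x \<in> homspace R \<zeta>"
    "AE x in lebesgue. (\<lambda>n. N \<zeta> (T n x - G x)) \<longlonglongrightarrow> 0"
    using G(1) unfolding strongly_measurable_def by (auto simp: image_subset_iff)
  have "AE x in lebesgue. (\<lambda>n. N \<zeta> ((S n x + T n x) - (F x + G x))) \<longlonglongrightarrow> 0"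
    using S(3) T(3)
  proof eventually_elim
    case (elim x)
    have h: "S n x - F x \<in> homspace R \<zeta>" "T n x - G x \<in> homspace R \<zeta>" for n
      using S(2) T(2) F(2) G(2) homspace_diff by auto
    have "N \<zeta> ((S n x + T n x) - (F x + G x)) \<le> N \<zeta> (S n x - F x) + N \<zeta> (T n x - G x)" for n
      using N_triangle[OF h] by (simp add: algebra_simps)
    moreover have "0 \<le> N \<zeta> ((S n x + T n x) - (F x + G x))" for n
      using S(2) T(2) F(2) G(2) by (intro N_nonneg homspace_diff homspace_add)
    moreover have "(\<lambda>n. N \<zeta> (S n x - F x) + N \<zeta> (T n x - G x)) \<longlonglongrightarrow> 0 + 0"
      by (intro tendsto_add elim)
    ultimately show ?case by (rule squeeze_null) simp
  qed
  then show ?thesis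
    unfolding strongly_measurable_def using S(1,2) T(1,2) homspace_add
    by (intro exI[of _ "\<lambda>n x. S n x + T n x"]) (auto intro: simple_function_compose2)
qed

lemma strongly_measurable_sum:
  fixes F :: "'i \<Rightarrow> real^'d::finite \<Rightarrow> 't"
  assumes "\<And>i. i \<in> I \<Longrightarrow> strongly_measurable R \<zeta> (F i)" "\<And>i x. i \<in> I \<Longrightarrow> F i x \<in> homspace R \<zeta>"
  shows "strongly_measurable R \<zeta> (\<lambda>x. \<Sum>i\<in>I. F i x)"
  using assms
proof (induction I rule: infinite_finite_induct)
  case (insert i I)
  then show ?case by (simp add: strongly_measurable_add homspace_sum)
qed (simp_all add: strongly_measurable_zero)

lemma truncate_add: "truncate R \<gamma> (\<sigma> + \<tau>) = truncate R \<gamma> \<sigma> + truncate R \<gamma> \<tau>"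
  by (simp add: truncate_def hproj_add sum.distrib)

lemma truncate_zero: "truncate R \<gamma> 0 = 0"
  by (simp add: truncate_def hproj_0)

lemma truncate_sum: "truncate R \<gamma> (\<Sum>i\<in>I. f i) = (\<Sum>i\<in>I. truncate R \<gamma> (f i))"
  by (induction I rule: infinite_finite_induct) (auto simp: truncate_add truncate_zero)

lemma truncate_homspace: "\<tau> \<in> homspace R \<beta> \<Longrightarrow> truncate R \<gamma> \<tau> = (if \<beta> < \<gamma> then \<tau> else 0)"
proof -
  assume \<tau>: "\<tau> \<in> homspace R \<beta>"
  have "truncate R \<gamma> \<tau> = (if \<beta> \<in> below \<gamma> then \<tau> else 0)"
    unfolding truncate_def using finite_homs_below by (simp add: hproj_homspace[OF \<tau>])
  moreover have "\<beta> \<notin> homs R \<Longrightarrow> \<tau> = 0" using \<tau> homspace_notin by auto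
  ultimately show ?thesis by (auto simp: homs_below_def)
qed

end

context sector_prod
begin

text \<open>Products of simple functions are simple, and \<open>S \<star> T - F \<star> G = (S - F) \<star> T + F \<star> (T - G)\<close>.\<close>

lemma strongly_measurable_star:
  fixes F G :: "real^'d::finite \<Rightarrow> 't"
  assumes a: "a \<in> below \<gamma>\<^sub>1" and b: "b \<in> below \<gamma>\<^sub>2"
    and F: "strongly_measurable R a F" "\<And>x. F x \<in> V \<inter> homspace R a"
    and G: "strongly_measurable R b G" "\<And>x. G x \<in> W \<inter> homspace R b"
  shows "strongly_measurable R (a + b) (\<lambda>x. F x \<star> G x)"
proof -
  obtain K where K: "star_bounded \<gamma>\<^sub>1 \<gamma>\<^sub>2 K" using star_bounded_ex by blast
  then have K0: "0 \<le> K" by (simp add: star_bounded_def)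
  note sV = sector_subspace[OF V] and sW = sector_subspace[OF W]
  obtain S where S: "\<And>n::nat. simple_function lebesgue (S n)" "\<And>n x. S n x \<in> V \<inter> homspace R a"
    "AE x in lebesgue. (\<lambda>n. N a (S n x - F x)) \<longlonglongrightarrow> 0"
    using strongly_measurable_sector[OF sV F] by blast
  obtain T where T: "\<And>n::nat. simple_function lebesgue (T n)" "\<And>n x. T n x \<in> W \<inter> homspace R b"
    "AE x in lebesgue. (\<lambda>n. N b (T n x - G x)) \<longlonglongrightarrow> 0"
    using strongly_measurable_sector[OF sW G] by blast
  have ST: "S n x \<star> T m y \<in> homspace R (a + b)" for n m x y
    using S(2) T(2) star_homspace by blast
  have FGh: "F x \<star> G x \<in> homspace R (a + b)" for x using F(2) G(2) star_homspace by blast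
  have "AE x in lebesgue. (\<lambda>n. N (a + b) (S n x \<star> T n x - F x \<star> G x)) \<longlonglongrightarrow> 0"
    using S(3) T(3)
  proof eventually_elim
    case (elim x)
    have "N (a + b) (S n x \<star> T n x - F x \<star> G x) \<le>
      K * N a (S n x - F x) * (N b (T n x - G x) + N b (G x)) + K * N a (F x) * N b (T n x - G x)" for n
    proof -
      have m: "S n x \<in> V" "F x \<in> V" "T n x \<in> W" "G x \<in> W" "S n x \<in> homspace R a" "F x \<in> homspace R a"
        "T n x \<in> homspace R b" "G x \<in> homspace R b"
        using S(2) T(2) F(2) G(2) by blast+
      have d: "S n x - F x \<in> V" "S n x - F x \<in> homspace R a" "T n x - G x \<in> W" "T n x - G x \<in> homspace R b"
        using m subspace_diff[OF sV] subspace_diff[OF sW] homspace_diff by auto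
      have "S n x \<star> T n x - F x \<star> G x = (S n x - F x) \<star> T n x + F x \<star> (T n x - G x)"
        using m by (simp add: star_diff_left star_diff_right)
      then have "N (a + b) (S n x \<star> T n x - F x \<star> G x) \<le> N (a + b) ((S n x - F x) \<star> T n x) + N (a + b) (F x \<star> (T n x - G x))"
        using N_triangle[OF star_homspace[OF d(1,2) m(3,7)] star_homspace[OF m(2,6) d(3,4)]] by simp
      also have "N (a + b) ((S n x - F x) \<star> T n x) \<le> K * N a (S n x - F x) * N b (T n x)"
        using K a b d m unfolding star_bounded_def by blast
      also have "K * N a (S n x - F x) * N b (T n x) \<le> K * N a (S n x - F x) * (N b (T n x - G x) + N b (G x))"
        using N_triangle[OF d(4) m(8)] K0 N_nonneg[OF d(2)] by (intro mult_left_mono) auto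
      also have "N (a + b) (F x \<star> (T n x - G x)) \<le> K * N a (F x) * N b (T n x - G x)"
        using K a b d m unfolding star_bounded_def by blast
      finally show ?thesis by simp
    qed
    moreover have "0 \<le> N (a + b) (S n x \<star> T n x - F x \<star> G x)" for n
      by (intro N_nonneg homspace_diff ST FGh)
    moreover have "(\<lambda>n. K * N a (S n x - F x) * (N b (T n x - G x) + N b (G x)) + K * N a (F x) * N b (T n x - G x))
      \<longlonglongrightarrow> K * 0 * (0 + N b (G x)) + K * N a (F x) * 0"
      by (intro tendsto_intros elim)
    ultimately show ?case by (rule squeeze_null) simp
  qed
  then show ?thesis
    unfolding strongly_measurable_def using S(1) T(1) ST
    by (intro exI[of _ "\<lambda>n x. S n x \<star> T n x"]) (auto intro: simple_function_compose2)
qed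

lemma star_hproj: "\<sigma> \<in> V \<Longrightarrow> \<tau> \<in> W \<Longrightarrow> hproj R a \<sigma> \<star> hproj R b \<tau> \<in> homspace R (a + b)"
  by (intro star_homspace sector_hproj[OF V] sector_hproj[OF W] hproj_in)

lemma hsize_star_component:
  assumes "star_bounded \<gamma>\<^sub>1 \<gamma>\<^sub>2 K" "a \<in> below \<gamma>\<^sub>1" "b \<in> below \<gamma>\<^sub>2" "\<sigma> \<in> V" "\<tau> \<in> W"
  shows "hsize R (a + b) (hproj R a \<sigma> \<star> hproj R b \<tau>) \<le> K * (hsize R a \<sigma> * hsize R b \<tau>)"
  using assms hproj_in[of a \<sigma>] hproj_in[of b \<tau>] sector_hproj[OF V assms(4)] sector_hproj[OF W assms(5)]
    hsize_homspace[OF star_hproj[OF assms(4,5)], of "a + b" a b]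
  by (simp add: star_bounded_def hsize_def mult.assoc)

text \<open>Arranged so that a weight \<open>w\<close> depending on \<open>\<zeta> = a + b\<close> can be distributed over the two factors
before summing.\<close>

lemma esize_star:
  assumes K: "star_bounded \<gamma>\<^sub>1 \<gamma>\<^sub>2 K"
    and *: "\<sigma> \<in> V" "\<sigma> \<in> hsum R {..<\<gamma>\<^sub>1}" "\<tau> \<in> W" "\<tau> \<in> hsum R {..<\<gamma>\<^sub>2}"
    and BD: "\<And>a b. a \<in> below \<gamma>\<^sub>1 \<Longrightarrow> b \<in> below \<gamma>\<^sub>2 \<Longrightarrow> a + b = \<zeta> \<Longrightarrow> w * (esize a \<sigma> * esize b \<tau>) \<le> B a * D b"
  shows "w * esize \<zeta> (\<sigma> \<star> \<tau>) \<le> ennreal K * ((\<Sum>a\<in>below \<gamma>\<^sub>1. B a) * (\<Sum>b\<in>below \<gamma>\<^sub>2. D b))"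
proof -
  have "esize \<zeta> (\<sigma> \<star> \<tau>) \<le> ennreal (\<Sum>a\<in>below \<gamma>\<^sub>1. \<Sum>b\<in>below \<gamma>\<^sub>2. hsize R \<zeta> (hproj R a \<sigma> \<star> hproj R b \<tau>))"
    unfolding star_decomp[OF *] by (intro ennreal_leI order_trans[OF hsize_sum] sum_mono hsize_sum)
  also have "\<dots> = (\<Sum>a\<in>below \<gamma>\<^sub>1. \<Sum>b\<in>below \<gamma>\<^sub>2. esize \<zeta> (hproj R a \<sigma> \<star> hproj R b \<tau>))"
    by (simp add: hsize_nonneg sum_nonneg)
  finally have "w * esize \<zeta> (\<sigma> \<star> \<tau>) \<le> w * \<dots>" by (rule mult_left_mono) simp
  also have "\<dots> = (\<Sum>a\<in>below \<gamma>\<^sub>1. \<Sum>b\<in>below \<gamma>\<^sub>2. w * esize \<zeta> (hproj R a \<sigma> \<star> hproj R b \<tau>))"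
    unfolding sum_distrib_left ..
  also have "\<dots> \<le> (\<Sum>a\<in>below \<gamma>\<^sub>1. \<Sum>b\<in>below \<gamma>\<^sub>2. ennreal K * (B a * D b))"
  proof (intro sum_mono)
    fix a b assume ab: "a \<in> below \<gamma>\<^sub>1" "b \<in> below \<gamma>\<^sub>2"
    show "w * esize \<zeta> (hproj R a \<sigma> \<star> hproj R b \<tau>) \<le> ennreal K * (B a * D b)"
    proof (cases "a + b = \<zeta>")
      case True
      have "w * esize \<zeta> (hproj R a \<sigma> \<star> hproj R b \<tau>) \<le> w * ennreal (K * (hsize R a \<sigma> * hsize R b \<tau>))"
        using hsize_star_component[OF K ab *(1,3)] True by (intro mult_left_mono ennreal_leI) auto
      also have "\<dots> = ennreal K * (w * (esize a \<sigma> * esize b \<tau>))"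
        using K by (simp add: star_bounded_def ennreal_mult hsize_nonneg mult_ac)
      also have "\<dots> \<le> ennreal K * (B a * D b)" by (intro mult_left_mono BD ab True) auto
      finally show ?thesis .
    next
      case False
      then show ?thesis using hsize_homspace[OF star_hproj[OF *(1,3)], of \<zeta> a b] by auto
    qed
  qed
  also have "\<dots> = ennreal K * ((\<Sum>a\<in>below \<gamma>\<^sub>1. B a) * (\<Sum>b\<in>below \<gamma>\<^sub>2. D b))"
    by (simp only: sum_product) (simp only: sum_distrib_left)
  finally show ?thesis .
qed

end

text \<open>The setting of the theorem, except for the integrability exponents.\<close>

locale model_prod = reg_model R s \<pi> \<Gamma> + sector_prod R V W star
  for R :: "('t::real_vector) reg_structure" and s :: "('d::finite) scaling" and \<pi> \<Gamma> V W
    and star (infixl "\<star>" 70) +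
  fixes \<gamma>\<^sub>1 \<gamma>\<^sub>2 \<alpha>\<^sub>1 \<alpha>\<^sub>2 \<gamma> :: real
  assumes \<gamma>: "\<gamma> = min (\<gamma>\<^sub>1 + \<alpha>\<^sub>2) (\<gamma>\<^sub>2 + \<alpha>\<^sub>1)" and \<gamma>_notin: "\<gamma> \<notin> homs R"
begin

text \<open>The hypotheses on \<open>f\<close> apart from the finiteness of its norm.\<close>

definition factor1 :: "(real^'d \<Rightarrow> 't) \<Rightarrow> bool" where
  "factor1 f \<longleftrightarrow> measurable_dist \<gamma>\<^sub>1 f \<and> (\<forall>x. f x \<in> V \<and> f x \<in> hsum R {\<alpha>\<^sub>1..})"

definition factor2 :: "(real^'d \<Rightarrow> 't) \<Rightarrow> bool" where
  "factor2 g \<longleftrightarrow> measurable_dist \<gamma>\<^sub>2 g \<and> (\<forall>x. g x \<in> W \<and> g x \<in> hsum R {\<alpha>\<^sub>2..})"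

lemma factor1D:
  assumes "factor1 f" shows "measurable_dist \<gamma>\<^sub>1 f" "f x \<in> V" "f x \<in> hsum R {\<alpha>\<^sub>1..}" "f x \<in> hsum R {..<\<gamma>\<^sub>1}"
  using assms by (auto simp: factor1_def measurable_dist_def)

lemma factor2D:
  assumes "factor2 g" shows "measurable_dist \<gamma>\<^sub>2 g" "g x \<in> W" "g x \<in> hsum R {\<alpha>\<^sub>2..}" "g x \<in> hsum R {..<\<gamma>\<^sub>2}"
  using assms by (auto simp: factor2_def measurable_dist_def)

lemma trunc_product_measurable:
  assumes f: "factor1 f" and g: "factor2 g"
  shows "measurable_dist \<gamma> (trunc_product R star \<gamma> f g)"
  unfolding measurable_dist_def
proof (intro conjI allI ballI)
  fix x show "trunc_product R star \<gamma> f g x \<in> hsum R {..<\<gamma>}"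
    unfolding trunc_product_def by (rule truncate_hsum)
next
  fix \<zeta> assume \<zeta>: "\<zeta> \<in> below \<gamma>"
  have eq: "hproj R \<zeta> (trunc_product R star \<gamma> f g x) =
     (\<Sum>a\<in>below \<gamma>\<^sub>1. \<Sum>b\<in>below \<gamma>\<^sub>2. if a + b = \<zeta> then hproj R a (f x) \<star> hproj R b (g x) else 0)" for x
    using \<zeta> by (simp add: trunc_product_def hproj_truncate homs_below_def
      hproj_star[OF factor1D(2,4)[OF f] factor2D(2,4)[OF g]])
  have V': "hproj R a (f x) \<in> V \<inter> homspace R a" and W': "hproj R b (g x) \<in> W \<inter> homspace R b" for a b x
    using sector_hproj[OF V factor1D(2)[OF f]] sector_hproj[OF W factor2D(2)[OF g]] hproj_in by auto
  have m: "strongly_measurable R \<zeta> (\<lambda>x. if a + b = \<zeta> then hproj R a (f x) \<star> hproj R b (g x) else 0)"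
    if "a \<in> below \<gamma>\<^sub>1" "b \<in> below \<gamma>\<^sub>2" for a b
  proof (cases "a + b = \<zeta>")
    case True
    have "strongly_measurable R (a + b) (\<lambda>x. hproj R a (f x) \<star> hproj R b (g x))"
      using that V' W' factor1D(1)[OF f] factor2D(1)[OF g]
      by (intro strongly_measurable_star[OF that]) (auto simp: measurable_dist_def)
    then show ?thesis using True by simp
  qed (simp add: strongly_measurable_zero)
  have h: "(if a + b = \<zeta> then hproj R a (f x) \<star> hproj R b (g x) else 0) \<in> homspace R \<zeta>" for a b x
    using star_homspace[of "hproj R a (f x)" a "hproj R b (g x)" b] V' W' homspace_0 by auto
  show "strongly_measurable R \<zeta> (\<lambda>x. hproj R \<zeta> (trunc_product R star \<gamma> f g x))"
    unfolding eq by (intro strongly_measurable_sum m homspace_sum h)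
qed

text \<open>If \<open>a + b < \<alpha>\<^sub>1 + \<alpha>\<^sub>2\<close>, then \<open>a < \<alpha>\<^sub>1\<close> or \<open>b < \<alpha>\<^sub>2\<close>, and one of the factors has no such
component.\<close>

lemma trunc_product_ge:
  assumes f: "factor1 f" and g: "factor2 g"
  shows "trunc_product R star \<gamma> f g x \<in> hsum R {\<alpha>\<^sub>1 + \<alpha>\<^sub>2..}"
  unfolding trunc_product_def truncate_def
proof (intro hsum_sum)
  fix \<zeta> assume "\<zeta> \<in> below \<gamma>"
  show "hproj R \<zeta> (f x \<star> g x) \<in> hsum R {\<alpha>\<^sub>1 + \<alpha>\<^sub>2..}"
  proof (cases "\<alpha>\<^sub>1 + \<alpha>\<^sub>2 \<le> \<zeta>")
    case True
    then show ?thesis using homspace_hsum[OF hproj_in] by auto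
  next
    case False
    have "hproj R a (f x) \<star> hproj R b (g x) = 0" if "a + b = \<zeta>" for a b
    proof -
      have "a < \<alpha>\<^sub>1 \<or> b < \<alpha>\<^sub>2" using False that by linarith
      then have "hproj R a (f x) = 0 \<or> hproj R b (g x) = 0"
        using hproj_hsum_zero[OF factor1D(3)[OF f], of a] hproj_hsum_zero[OF factor2D(3)[OF g], of b] by fastforce
      then show ?thesis
        using star_0_left star_0_right sector_hproj[OF V factor1D(2)[OF f]] sector_hproj[OF W factor2D(2)[OF g]] by auto
    qed
    then have "hproj R \<zeta> (f x \<star> g x) = 0"
      unfolding hproj_star[OF factor1D(2,4)[OF f] factor2D(2,4)[OF g]] by (intro sum.neutral ballI) auto
    then show ?thesis using hsum_0 by simp
  qed
qed

end

section \<open>Increments of the product\<close>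

context reg_model
begin

text \<open>Re-expansion creates components below \<open>\<alpha>\<close>, but each of them is small: it comes from a component
of homogeneity at least \<open>\<alpha>\<close>, so it gains at least the power \<open>\<alpha> - \<beta>\<close>.\<close>

lemma esize_\<Gamma>_lower_bounded:
  assumes M: "\<Gamma>_bounded \<gamma> M" and l: "0 < l" "l \<le> 1" "snorm s (x - y) \<le> 16 * l"
    and \<tau>: "\<gamma>' \<le> \<gamma>" "\<tau> \<in> hsum R {..<\<gamma>'}" "\<tau> \<in> hsum R {\<alpha>..}"
  shows "esize \<beta> (\<Gamma> x y \<tau>) \<le> ennreal (M * l powr (\<alpha> - \<beta>)) * ennreal (total \<gamma>' \<tau>)"
proof -
  have M0: "0 \<le> M" using M by (simp add: \<Gamma>_bounded_def)
  have "hsize R \<beta> (\<Gamma> x y \<tau>) \<le> M * (\<Sum>c\<in>below \<gamma>'. hsize R c \<tau> * l powr (c - \<beta>))"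
    by (rule \<Gamma>_bound_hsum[OF M l \<tau>(1,2)])
  also have "\<dots> \<le> M * (\<Sum>c\<in>below \<gamma>'. hsize R c \<tau> * l powr (\<alpha> - \<beta>))"
  proof (intro mult_left_mono[OF _ M0] sum_mono)
    fix c
    show "hsize R c \<tau> * l powr (c - \<beta>) \<le> hsize R c \<tau> * l powr (\<alpha> - \<beta>)"
    proof (cases "\<alpha> \<le> c")
      case True
      then show ?thesis using l by (intro mult_left_mono powr_mono' hsize_nonneg) auto
    next
      case False
      then show ?thesis using hsize_hsum_zero[OF \<tau>(3)] by simp
    qed
  qed
  also have "\<dots> = M * l powr (\<alpha> - \<beta>) * total \<gamma>' \<tau>"
    by (simp add: total_def sum_distrib_right[symmetric])
  finally show ?thesis
    using M0 total_nonneg by (simp add: ennreal_mult[symmetric] ennreal_leI)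
qed

lemma total_le_control: "ennreal (total \<gamma> (f x)) \<le> control \<gamma> q f x"
  by (simp add: control_def add_increasing2)

end

context model_prod
begin

abbreviation "prd f g \<equiv> trunc_product R star \<gamma> f g"

text \<open>The spare power of the scale: the smallest of finitely many positive numbers.\<close>

lemma exponent_gap:
  obtains \<delta> where "0 < \<delta>" "\<And>a b. a \<in> below \<gamma>\<^sub>1 \<Longrightarrow> b \<in> below \<gamma>\<^sub>2 \<Longrightarrow> \<gamma> < a + b \<Longrightarrow> \<delta> \<le> a + b - \<gamma>"
    "\<gamma> < \<gamma>\<^sub>1 + \<gamma>\<^sub>2 \<Longrightarrow> \<delta> \<le> \<gamma>\<^sub>1 + \<gamma>\<^sub>2 - \<gamma>"
proof -
  \<comment> \<open>the two entries 1 only keep the set nonempty and its elements positive\<close>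
  define D where "D = insert (if \<gamma> < \<gamma>\<^sub>1 + \<gamma>\<^sub>2 then \<gamma>\<^sub>1 + \<gamma>\<^sub>2 - \<gamma> else 1)
     ((\<lambda>(a, b). if \<gamma> < a + b then a + b - \<gamma> else 1) ` (below \<gamma>\<^sub>1 \<times> below \<gamma>\<^sub>2))"
  have fin: "finite D" using finite_homs_below by (simp add: D_def)
  show ?thesis
  proof
    show "0 < Min D" using fin by (subst Min_gr_iff) (auto simp: D_def)
    show "Min D \<le> a + b - \<gamma>" if "a \<in> below \<gamma>\<^sub>1" "b \<in> below \<gamma>\<^sub>2" "\<gamma> < a + b" for a b
      using fin that by (intro Min_le) (force simp: D_def)+
    show "Min D \<le> \<gamma>\<^sub>1 + \<gamma>\<^sub>2 - \<gamma>" if "\<gamma> < \<gamma>\<^sub>1 + \<gamma>\<^sub>2"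
      using fin that by (intro Min_le) (auto simp: D_def)
  qed
qed

text \<open>Products with \<open>a + b = \<gamma>\<close> vanish because \<open>\<gamma>\<close> is not a homogeneity, which makes the inequality
strict.\<close>

lemma truncated_part:
  assumes f: "factor1 f" and g: "factor2 g"
  shows "f x \<star> g x - prd f g x = (\<Sum>a\<in>below \<gamma>\<^sub>1. \<Sum>b\<in>below \<gamma>\<^sub>2. if \<gamma> < a + b then hproj R a (f x) \<star> hproj R b (g x) else 0)"
proof -
  note dec = star_decomp[OF factor1D(2,4)[OF f] factor2D(2,4)[OF g], of x x]
  have h: "hproj R a (f x) \<star> hproj R b (g x) \<in> homspace R (a + b)" for a b
    by (rule star_hproj[OF factor1D(2)[OF f] factor2D(2)[OF g]])
  have "hproj R a (f x) \<star> hproj R b (g x) - truncate R \<gamma> (hproj R a (f x) \<star> hproj R b (g x))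
     = (if \<gamma> < a + b then hproj R a (f x) \<star> hproj R b (g x) else 0)" for a b
    using truncate_homspace[OF h, of \<gamma> a b] h[of a b] homspace_notin[OF \<gamma>_notin] by (cases "a + b = \<gamma>") auto
  then show ?thesis
    unfolding trunc_product_def dec truncate_sum by (simp add: sum_subtractf[symmetric])
qed

text \<open>If \<open>\<gamma>\<^sub>1 + \<gamma>\<^sub>2 \<le> \<gamma>\<close>, then \<open>\<gamma>\<^sub>1 \<le> \<alpha>\<^sub>1\<close> or \<open>\<gamma>\<^sub>2 \<le> \<alpha>\<^sub>2\<close>, and no homogeneity is left for the
components of \<open>f\<close> or \<open>g\<close>.\<close>

lemma zero_factor:
  assumes f: "factor1 f" and g: "factor2 g" and "\<not> \<gamma> < \<gamma>\<^sub>1 + \<gamma>\<^sub>2"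
  shows "(\<forall>x. f x = 0) \<or> (\<forall>x. g x = 0)"
proof -
  have "\<gamma>\<^sub>1 \<le> \<alpha>\<^sub>1 \<or> \<gamma>\<^sub>2 \<le> \<alpha>\<^sub>2" using assms(3) \<gamma> by linarith
  moreover have "\<tau> = 0" if "\<gamma>' \<le> \<alpha>" "\<tau> \<in> hsum R {..<\<gamma>'}" "\<tau> \<in> hsum R {\<alpha>..}" for \<tau> \<gamma>' \<alpha>
  proof -
    have "\<tau> = (\<Sum>\<zeta>\<in>below \<gamma>'. hproj R \<zeta> \<tau>)" by (rule decomp_below[OF that(2)])
    also have "\<dots> = 0" using that(1) hproj_hsum_zero[OF that(3)] by (intro sum.neutral) (auto simp: homs_below_def)
    finally show ?thesis .
  qed
  ultimately show ?thesis using factor1D(3,4)[OF f] factor2D(3,4)[OF g] by blast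
qed

text \<open>The three summands on the right correspond to one increment times a value, a value times one
increment, and the terms with a spare power of the scale.  The last ones are the product of the
two increments, by the pointwise estimate, and the truncated components.\<close>

lemma product_increment:
  assumes q: "1 \<le> q\<^sub>1" "1 \<le> q\<^sub>2"
  obtains C \<delta> :: real where "0 \<le> C" "0 < \<delta>"
    "\<And>f g x y l n \<zeta>. factor1 f \<Longrightarrow> factor2 g \<Longrightarrow> l \<in> dyadic n \<Longrightarrow> snorm s (y - x) \<le> 4 * l \<Longrightarrow> \<zeta> < \<gamma> \<Longrightarrow>
      ennreal (l powr (\<zeta> - \<gamma>)) * incr (prd f g) \<zeta> x y \<le> ennreal C *
      (weighted_incr \<gamma>\<^sub>1 f l x y * control \<gamma>\<^sub>2 q\<^sub>2 g x + control \<gamma>\<^sub>1 q\<^sub>1 f x * weighted_incr \<gamma>\<^sub>2 g l x y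
        + ennreal (l powr \<delta>) * ((control \<gamma>\<^sub>1 q\<^sub>1 f x + control \<gamma>\<^sub>1 q\<^sub>1 f y) * (control \<gamma>\<^sub>2 q\<^sub>2 g x + control \<gamma>\<^sub>2 q\<^sub>2 g y)))"
proof -
  obtain K where K: "star_bounded \<gamma>\<^sub>1 \<gamma>\<^sub>2 K" using star_bounded_ex by blast
  then have K0: "0 \<le> K" by (simp add: star_bounded_def)
  obtain M where M: "\<Gamma>_bounded (max \<gamma>\<^sub>1 \<gamma>\<^sub>2) M" using \<Gamma>_bounded_ex by blast
  obtain M' where M': "\<Gamma>_bounded (\<gamma>\<^sub>1 + \<gamma>\<^sub>2) M'" using \<Gamma>_bounded_ex by blast
  have M0: "0 \<le> M" "0 \<le> M'" using M M' by (simp_all add: \<Gamma>_bounded_def)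
  obtain L where L: "0 \<le> L"
    "\<And>\<gamma>' f l n x y. \<gamma>' \<le> max \<gamma>\<^sub>1 \<gamma>\<^sub>2 \<Longrightarrow> measurable_dist \<gamma>' f \<Longrightarrow> l \<in> dyadic n \<Longrightarrow> snorm s (y - x) \<le> 4 * l \<Longrightarrow>
      weighted_incr \<gamma>' f l x y \<le> ennreal L * (dyadic_total \<gamma>' f n x + dyadic_total \<gamma>' f n y)"
    using weighted_incr_le_dyadic_total[of "max \<gamma>\<^sub>1 \<gamma>\<^sub>2"] by blast
  obtain \<delta> where \<delta>: "0 < \<delta>" "\<And>a b. a \<in> below \<gamma>\<^sub>1 \<Longrightarrow> b \<in> below \<gamma>\<^sub>2 \<Longrightarrow> \<gamma> < a + b \<Longrightarrow> \<delta> \<le> a + b - \<gamma>"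
    "\<gamma> < \<gamma>\<^sub>1 + \<gamma>\<^sub>2 \<Longrightarrow> \<delta> \<le> \<gamma>\<^sub>1 + \<gamma>\<^sub>2 - \<gamma>"
    using exponent_gap by blast
  define k1 k2 where "k1 = real (card (below \<gamma>\<^sub>1))" and "k2 = real (card (below \<gamma>\<^sub>2))"
  have k: "0 \<le> k1" "0 \<le> k2" by (simp_all add: k1_def k2_def)
  define c1 c2 c3 c4 where "c1 = K * (k2 * M)" and "c2 = K * (k1 * M)" and "c3 = K * (L * L)" and "c4 = k1 * (k2 * (M' * K))"
  have c: "0 \<le> c1" "0 \<le> c2" "0 \<le> c3" "0 \<le> c4"
    using K0 M0(1) M0(2) L(1) k by (simp_all add: c1_def c2_def c3_def c4_def)
  show ?thesis
  proof (rule that[OF _ \<delta>(1)])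
    show "0 \<le> c1 + c2 + c3 + c4" using c by simp
    fix f g x y l n \<zeta>
    assume f: "factor1 f" and g: "factor2 g" and ln: "l \<in> dyadic n" and xy: "snorm s (y - x) \<le> 4 * l" and \<zeta>: "\<zeta> < \<gamma>"
    note fD = factor1D[OF f] and gD = factor2D[OF g]
    have l: "0 < l" "l \<le> 1" using ln dyadic_subset[of n] by auto
    have xy16: "snorm s (y - x) \<le> 16 * l" using xy l by simp
    define w where "w = ennreal (l powr (\<zeta> - \<gamma>))"
    have wp: "w * ennreal (l powr e) = ennreal (l powr (\<zeta> - \<gamma> + e))" for e
      by (simp add: w_def ennreal_mult[symmetric] powr_add)
    define Hf Hg where "Hf = control \<gamma>\<^sub>1 q\<^sub>1 f" and "Hg = control \<gamma>\<^sub>2 q\<^sub>2 g"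
    define A B where "A = weighted_incr \<gamma>\<^sub>1 f l x y" and "B = weighted_incr \<gamma>\<^sub>2 g l x y"
    define Z where "Z = (Hf x + Hf y) * (Hg x + Hg y)"
    define \<Gamma>f \<Gamma>g where "\<Gamma>f = \<Gamma> y x (f x)" and "\<Gamma>g = \<Gamma> y x (g x)"
    define \<Delta>f \<Delta>g where "\<Delta>f = f y - \<Gamma>f" and "\<Delta>g = g y - \<Gamma>g"
    have inc: "incr f a x y = esize a \<Delta>f" "incr g a x y = esize a \<Delta>g" for a
      by (simp_all add: incr_def \<Delta>f_def \<Delta>g_def \<Gamma>f_def \<Gamma>g_def)
    have mf: "\<Gamma>f \<in> V" "\<Gamma>f \<in> hsum R {..<\<gamma>\<^sub>1}" "\<Delta>f \<in> V" "\<Delta>f \<in> hsum R {..<\<gamma>\<^sub>1}"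
      unfolding \<Delta>f_def \<Gamma>f_def
      using sector_sgroup[OF V \<Gamma>_sgroup fD(2)] sgroup_hsum[OF \<Gamma>_sgroup fD(4)]
        subspace_diff[OF sector_subspace[OF V] fD(2)] hsum_diff[OF fD(4)] by auto
    have mg: "\<Gamma>g \<in> W" "\<Gamma>g \<in> hsum R {..<\<gamma>\<^sub>2}" "\<Delta>g \<in> W" "\<Delta>g \<in> hsum R {..<\<gamma>\<^sub>2}"
      unfolding \<Delta>g_def \<Gamma>g_def
      using sector_sgroup[OF W \<Gamma>_sgroup gD(2)] sgroup_hsum[OF \<Gamma>_sgroup gD(4)]
        subspace_diff[OF sector_subspace[OF W] gD(2)] hsum_diff[OF gD(4)] by auto
    have tot: "ennreal (total \<gamma>\<^sub>1 (f x)) \<le> Hf x" "ennreal (total \<gamma>\<^sub>2 (g x)) \<le> Hg x"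
      unfolding Hf_def Hg_def by (rule total_le_control)+
    have bf: "esize a \<Gamma>f \<le> ennreal (M * l powr (\<alpha>\<^sub>1 - a)) * Hf x" for a
      unfolding \<Gamma>f_def using esize_\<Gamma>_lower_bounded[OF M l xy16 _ fD(4) fD(3)] tot(1) by (force intro: order_trans mult_left_mono)
    have bg: "esize b \<Gamma>g \<le> ennreal (M * l powr (\<alpha>\<^sub>2 - b)) * Hg x" for b
      unfolding \<Gamma>g_def using esize_\<Gamma>_lower_bounded[OF M l xy16 _ gD(4) gD(3)] tot(2) by (force intro: order_trans mult_left_mono)
    \<comment> \<open>increment of \<open>f\<close> against \<open>\<Gamma> y x (g x)\<close>, using \<open>\<gamma> \<le> \<gamma>\<^sub>1 + \<alpha>\<^sub>2\<close>\<close>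
    have T1: "w * esize \<zeta> (\<Delta>f \<star> \<Gamma>g) \<le> ennreal c1 * (A * Hg x)"
    proof -
      have "w * esize \<zeta> (\<Delta>f \<star> \<Gamma>g) \<le> ennreal K * ((\<Sum>a\<in>below \<gamma>\<^sub>1. ennreal (l powr (a - \<gamma>\<^sub>1)) * esize a \<Delta>f) * (\<Sum>b\<in>below \<gamma>\<^sub>2. ennreal M * Hg x))"
      proof (rule esize_star[OF K mf(3,4) mg(1,2)])
        fix a b assume ab: "a + b = \<zeta>"
        have "w * (esize a \<Delta>f * esize b \<Gamma>g) \<le> w * (esize a \<Delta>f * (ennreal (M * l powr (\<alpha>\<^sub>2 - b)) * Hg x))"
          by (intro mult_left_mono bg) auto
        also have "\<dots> = (w * ennreal (l powr (\<alpha>\<^sub>2 - b))) * esize a \<Delta>f * (ennreal M * Hg x)"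
          using M0(1) by (simp add: ennreal_mult mult_ac)
        also have "\<dots> \<le> ennreal (l powr (a - \<gamma>\<^sub>1)) * esize a \<Delta>f * (ennreal M * Hg x)"
          unfolding wp using ab l \<gamma> by (intro mult_right_mono ennreal_leI powr_mono') auto
        finally show "w * (esize a \<Delta>f * esize b \<Gamma>g) \<le> \<dots>" .
      qed
      then show ?thesis using K0 M0(1) k
        by (simp add: A_def weighted_incr_def inc c1_def k2_def ennreal_mult ennreal_of_nat_eq_real_of_nat mult_ac)
    qed
    \<comment> \<open>increment of \<open>g\<close> against \<open>\<Gamma> y x (f x)\<close>, using \<open>\<gamma> \<le> \<gamma>\<^sub>2 + \<alpha>\<^sub>1\<close>\<close>
    have T2: "w * esize \<zeta> (\<Gamma>f \<star> \<Delta>g) \<le> ennreal c2 * (Hf x * B)"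
    proof -
      have "w * esize \<zeta> (\<Gamma>f \<star> \<Delta>g) \<le> ennreal K * ((\<Sum>a\<in>below \<gamma>\<^sub>1. ennreal M * Hf x) * (\<Sum>b\<in>below \<gamma>\<^sub>2. ennreal (l powr (b - \<gamma>\<^sub>2)) * esize b \<Delta>g))"
      proof (rule esize_star[OF K mf(1,2) mg(3,4)])
        fix a b assume ab: "a + b = \<zeta>"
        have "w * (esize a \<Gamma>f * esize b \<Delta>g) \<le> w * ((ennreal (M * l powr (\<alpha>\<^sub>1 - a)) * Hf x) * esize b \<Delta>g)"
          by (intro mult_left_mono mult_right_mono bf) auto
        also have "\<dots> = ennreal M * Hf x * ((w * ennreal (l powr (\<alpha>\<^sub>1 - a))) * esize b \<Delta>g)"
          using M0(1) by (simp add: ennreal_mult mult_ac)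
        also have "\<dots> \<le> ennreal M * Hf x * (ennreal (l powr (b - \<gamma>\<^sub>2)) * esize b \<Delta>g)"
          unfolding wp using ab l \<gamma> by (intro mult_left_mono mult_right_mono ennreal_leI powr_mono') auto
        finally show "w * (esize a \<Gamma>f * esize b \<Delta>g) \<le> \<dots>" .
      qed
      then show ?thesis using K0 M0(1) k
        by (simp add: B_def weighted_incr_def inc c2_def k1_def ennreal_mult ennreal_of_nat_eq_real_of_nat mult_ac)
    qed
    \<comment> \<open>product of the increments: the scale appears with the spare power \<open>\<gamma>\<^sub>1 + \<gamma>\<^sub>2 - \<gamma>\<close>\<close>
    have T3: "w * esize \<zeta> (\<Delta>f \<star> \<Delta>g) \<le> ennreal c3 * (ennreal (l powr \<delta>) * Z)"
    proof -
      define d where "d = ennreal (l powr (\<gamma>\<^sub>1 + \<gamma>\<^sub>2 - \<gamma>))"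
      have "w * esize \<zeta> (\<Delta>f \<star> \<Delta>g) \<le> ennreal K * ((\<Sum>a\<in>below \<gamma>\<^sub>1. d * (ennreal (l powr (a - \<gamma>\<^sub>1)) * esize a \<Delta>f)) * (\<Sum>b\<in>below \<gamma>\<^sub>2. ennreal (l powr (b - \<gamma>\<^sub>2)) * esize b \<Delta>g))"
      proof (rule esize_star[OF K mf(3,4) mg(3,4)])
        fix a b assume ab: "a + b = \<zeta>"
        have "w = d * ennreal (l powr (a - \<gamma>\<^sub>1)) * ennreal (l powr (b - \<gamma>\<^sub>2))"
          unfolding w_def d_def ab[symmetric] by (simp add: ennreal_mult[symmetric] powr_add[symmetric] algebra_simps)
        then show "w * (esize a \<Delta>f * esize b \<Delta>g) \<le> d * (ennreal (l powr (a - \<gamma>\<^sub>1)) * esize a \<Delta>f) * (ennreal (l powr (b - \<gamma>\<^sub>2)) * esize b \<Delta>g)"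
          by (simp add: mult_ac)
      qed
      then have le: "w * esize \<zeta> (\<Delta>f \<star> \<Delta>g) \<le> ennreal K * (d * (A * B))"
        by (simp add: A_def B_def weighted_incr_def inc sum_distrib_left[symmetric] mult.assoc)
      show ?thesis
      proof (cases "\<gamma> < \<gamma>\<^sub>1 + \<gamma>\<^sub>2")
        case True
        have A: "A \<le> ennreal L * (Hf x + Hf y)"
          unfolding A_def Hf_def
          by (intro order_trans[OF L(2)[OF _ fD(1) ln xy]] mult_left_mono add_mono dyadic_total_le_control q) auto
        have B: "B \<le> ennreal L * (Hg x + Hg y)"
          unfolding B_def Hg_def
          by (intro order_trans[OF L(2)[OF _ gD(1) ln xy]] mult_left_mono add_mono dyadic_total_le_control q) auto
        have "d \<le> ennreal (l powr \<delta>)"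
          unfolding d_def using l \<delta>(3)[OF True] by (intro ennreal_leI powr_mono') auto
        then have "w * esize \<zeta> (\<Delta>f \<star> \<Delta>g) \<le> ennreal K * (ennreal (l powr \<delta>) * ((ennreal L * (Hf x + Hf y)) * (ennreal L * (Hg x + Hg y))))"
          by (intro order_trans[OF le] mult_left_mono mult_mono A B) auto
        then show ?thesis using K0 L(1) by (simp add: c3_def Z_def ennreal_mult mult_ac)
      next
        case False
        then have "A = 0 \<or> B = 0"
          using zero_factor[OF f g] by (auto simp: A_def B_def weighted_incr_def incr_def \<Gamma>_0)
        then show ?thesis using le by auto
      qed
    qed
    define rest where "rest = f x \<star> g x - prd f g x"
    \<comment> \<open>truncated components, with the spare power \<open>a + b - \<gamma>\<close>\<close>
    have T4: "w * esize \<zeta> (\<Gamma> y x rest) \<le> ennreal c4 * (ennreal (l powr \<delta>) * Z)"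
    proof -
      define F G where "F = total \<gamma>\<^sub>1 (f x)" and "G = total \<gamma>\<^sub>2 (g x)"
      have FG: "0 \<le> F" "0 \<le> G" by (simp_all add: F_def G_def total_nonneg)
      have one: "hsize R \<zeta> (\<Gamma> y x (if \<gamma> < a + b then hproj R a (f x) \<star> hproj R b (g x) else 0)) \<le> M' * K * (F * G) * l powr (\<gamma> - \<zeta> + \<delta>)"
        if ab: "a \<in> below \<gamma>\<^sub>1" "b \<in> below \<gamma>\<^sub>2" for a b
      proof (cases "\<gamma> < a + b")
        case True
        have h: "hproj R a (f x) \<star> hproj R b (g x) \<in> homspace R (a + b)"
          by (rule star_hproj[OF fD(2) gD(2)])
        have ab': "a + b < \<gamma>\<^sub>1 + \<gamma>\<^sub>2" using ab by (simp add: homs_below_def)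
        have "hsize R (a + b) (hproj R a (f x) \<star> hproj R b (g x)) \<le> K * (hsize R a (f x) * hsize R b (g x))"
          by (rule hsize_star_component[OF K ab fD(2) gD(2)])
        also have "\<dots> \<le> K * (F * G)"
          unfolding F_def G_def
          by (intro mult_left_mono mult_mono hsize_le_total fD(4) gD(4) K0 hsize_nonneg total_nonneg)
        finally have "M' * hsize R (a + b) (hproj R a (f x) \<star> hproj R b (g x)) * l powr (a + b - \<zeta>) \<le> M' * (K * (F * G)) * l powr (\<gamma> - \<zeta> + \<delta>)"
          using l \<delta>(2)[OF ab True] M0(2) K0 FG by (intro mult_mono mult_left_mono powr_mono') auto
        then show ?thesis using order_trans[OF \<Gamma>_boundedD[OF M' l xy16 ab' h, of \<zeta>]] True by (simp add: mult.assoc)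
      next
        case False
        then show ?thesis using M0(2) K0 FG by (simp add: \<Gamma>_0)
      qed
      have "hsize R \<zeta> (\<Gamma> y x rest) \<le> (\<Sum>a\<in>below \<gamma>\<^sub>1. \<Sum>b\<in>below \<gamma>\<^sub>2. hsize R \<zeta> (\<Gamma> y x (if \<gamma> < a + b then hproj R a (f x) \<star> hproj R b (g x) else 0)))"
        unfolding rest_def truncated_part[OF f g] \<Gamma>_sum by (intro order_trans[OF hsize_sum] sum_mono hsize_sum)
      also have "\<dots> \<le> (\<Sum>a\<in>below \<gamma>\<^sub>1. \<Sum>b\<in>below \<gamma>\<^sub>2. M' * K * (F * G) * l powr (\<gamma> - \<zeta> + \<delta>))"
        by (intro sum_mono one)
      also have "\<dots> = c4 * (F * G) * l powr (\<gamma> - \<zeta> + \<delta>)" by (simp add: c4_def k1_def k2_def mult_ac)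
      finally have "w * esize \<zeta> (\<Gamma> y x rest) \<le> w * ennreal (c4 * (F * G) * l powr (\<gamma> - \<zeta> + \<delta>))"
        by (intro mult_left_mono ennreal_leI) auto
      also have "\<dots> = ennreal c4 * ((w * ennreal (l powr (\<gamma> - \<zeta> + \<delta>))) * (ennreal F * ennreal G))"
        using c FG by (simp add: ennreal_mult mult_ac)
      also have "\<dots> \<le> ennreal c4 * (ennreal (l powr \<delta>) * Z)"
        unfolding wp Z_def F_def G_def
        by (intro mult_left_mono mult_mono order_trans[OF tot(1)] order_trans[OF tot(2)]) (auto simp: add_increasing2)
      finally show ?thesis .
    qed
    have star_y: "f y \<star> g y = \<Gamma>f \<star> \<Gamma>g + (\<Delta>f \<star> \<Gamma>g + \<Gamma>f \<star> \<Delta>g + \<Delta>f \<star> \<Delta>g)"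
    proof -
      have "f y = \<Gamma>f + \<Delta>f" "g y = \<Gamma>g + \<Delta>g" by (simp_all add: \<Delta>f_def \<Delta>g_def)
      then show ?thesis
        using mf mg subspace_add[OF sector_subspace[OF W]] by (simp add: star_add_left star_add_right)
    qed
    have "\<Gamma> y x (prd f g x) = \<Gamma> y x (f x \<star> g x) - \<Gamma> y x rest"
      by (simp add: rest_def \<Gamma>_diff)
    also have "\<Gamma> y x (f x \<star> g x) = \<Gamma>f \<star> \<Gamma>g"
      unfolding \<Gamma>f_def \<Gamma>g_def by (rule star_sgroup[OF fD(2,4) gD(2,4) \<Gamma>_sgroup])
    finally have "hproj R \<zeta> (prd f g y - \<Gamma> y x (prd f g x)) =
       hproj R \<zeta> (\<Delta>f \<star> \<Gamma>g + \<Gamma>f \<star> \<Delta>g + \<Delta>f \<star> \<Delta>g + \<Gamma> y x rest)"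
      using \<zeta> by (simp add: hproj_sub trunc_product_def[of R star \<gamma> f g y] hproj_truncate star_y hproj_add)
    then have "hsize R \<zeta> (prd f g y - \<Gamma> y x (prd f g x)) = hsize R \<zeta> (\<Delta>f \<star> \<Gamma>g + \<Gamma>f \<star> \<Delta>g + \<Delta>f \<star> \<Delta>g + \<Gamma> y x rest)"
      by (simp add: hsize_def)
    also have "\<dots> \<le> hsize R \<zeta> (\<Delta>f \<star> \<Gamma>g) + hsize R \<zeta> (\<Gamma>f \<star> \<Delta>g) + hsize R \<zeta> (\<Delta>f \<star> \<Delta>g) + hsize R \<zeta> (\<Gamma> y x rest)"
      by (intro order_trans[OF hsize_add] add_mono order_refl)
    finally have "incr (prd f g) \<zeta> x y \<le> esize \<zeta> (\<Delta>f \<star> \<Gamma>g) + esize \<zeta> (\<Gamma>f \<star> \<Delta>g) + esize \<zeta> (\<Delta>f \<star> \<Delta>g) + esize \<zeta> (\<Gamma> y x rest)"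
      unfolding incr_def by (simp add: ennreal_leI hsize_nonneg flip: ennreal_plus)
    then have "w * incr (prd f g) \<zeta> x y \<le> w * esize \<zeta> (\<Delta>f \<star> \<Gamma>g) + w * esize \<zeta> (\<Gamma>f \<star> \<Delta>g) + w * esize \<zeta> (\<Delta>f \<star> \<Delta>g) + w * esize \<zeta> (\<Gamma> y x rest)"
      unfolding distrib_left[symmetric] by (rule mult_left_mono) simp
    also have "\<dots> \<le> ennreal c1 * (A * Hg x) + ennreal c2 * (Hf x * B) + ennreal c3 * (ennreal (l powr \<delta>) * Z) + ennreal c4 * (ennreal (l powr \<delta>) * Z)"
      by (intro add_mono T1 T2 T3 T4)
    also have "\<dots> = ennreal c1 * (A * Hg x) + ennreal c2 * (Hf x * B) + ennreal (c3 + c4) * (ennreal (l powr \<delta>) * Z)"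
      using c by (simp add: distrib_right add.assoc)
    also have "\<dots> \<le> ennreal (c1 + c2 + c3 + c4) * (A * Hg x) + ennreal (c1 + c2 + c3 + c4) * (Hf x * B) + ennreal (c1 + c2 + c3 + c4) * (ennreal (l powr \<delta>) * Z)"
      using c by (intro add_mono mult_right_mono ennreal_leI) auto
    finally show "ennreal (l powr (\<zeta> - \<gamma>)) * incr (prd f g) \<zeta> x y \<le> ennreal (c1 + c2 + c3 + c4) *
      (weighted_incr \<gamma>\<^sub>1 f l x y * control \<gamma>\<^sub>2 q\<^sub>2 g x + control \<gamma>\<^sub>1 q\<^sub>1 f x * weighted_incr \<gamma>\<^sub>2 g l x y
        + ennreal (l powr \<delta>) * ((control \<gamma>\<^sub>1 q\<^sub>1 f x + control \<gamma>\<^sub>1 q\<^sub>1 f y) * (control \<gamma>\<^sub>2 q\<^sub>2 g x + control \<gamma>\<^sub>2 q\<^sub>2 g y)))"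
      by (simp only: A_def B_def Z_def Hf_def Hg_def w_def distrib_left)
  qed
qed

end

section \<open>The norm of the product\<close>

text \<open>What remains of \<open>(F x + F y) * (G x + G y)\<close> after averaging over \<open>y\<close>: in the mixed terms the
averages of \<open>F\<close> and \<open>G\<close> appear separately, in the last one the average of \<open>F * G\<close>.\<close>

definition product_majorant :: "('d::finite) scaling \<Rightarrow> real \<Rightarrow> (real^'d \<Rightarrow> ennreal) \<Rightarrow> (real^'d \<Rightarrow> ennreal) \<Rightarrow> real^'d \<Rightarrow> ennreal" where
  "product_majorant s \<epsilon> F G x = (F x + frac_maximal s \<epsilon> F x) * (G x + frac_maximal s \<epsilon> G x)
     + frac_maximal s \<epsilon> (\<lambda>y. F y * G y) x"

lemma product_majorant_measurable:
  assumes "\<forall>i. 0 < s i" and [measurable]: "F \<in> borel_measurable lebesgue" "G \<in> borel_measurable lebesgue"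
  shows "product_majorant s \<epsilon> F G \<in> borel_measurable lebesgue"
proof -
  note [measurable] = frac_maximal_measurable[OF assms(1)]
  show ?thesis unfolding product_majorant_def[abs_def] by measurable
qed

lemma Lnorm_product_majorant:
  fixes s :: "('d::finite) scaling"
  assumes s_pos: "\<forall>i. 0 < s i" and p: "1 \<le> p\<^sub>1" "1 \<le> p\<^sub>2" "p = p\<^sub>1 * p\<^sub>2 / (p\<^sub>1 + p\<^sub>2)" "1 \<le> p" and \<epsilon>: "0 < \<epsilon>"
  obtains C :: real where "0 \<le> C"
    "\<And>F G. F \<in> borel_measurable lebesgue \<Longrightarrow> G \<in> borel_measurable lebesgue \<Longrightarrow>
      Lp p (product_majorant s \<epsilon> F G)
      \<le> ennreal C * (Lp p\<^sub>1 F * Lp p\<^sub>2 G)"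
proof -
  obtain c1 :: real where c1: "0 \<le> c1" "\<And>F. F \<in> borel_measurable lebesgue \<Longrightarrow>
      Lp p\<^sub>1 (frac_maximal s \<epsilon> F) \<le> ennreal c1 * Lp p\<^sub>1 F"
    using Lnorm_frac_maximal[OF s_pos p(1) \<epsilon>] by blast
  obtain c2 :: real where c2: "0 \<le> c2" "\<And>F. F \<in> borel_measurable lebesgue \<Longrightarrow>
      Lp p\<^sub>2 (frac_maximal s \<epsilon> F) \<le> ennreal c2 * Lp p\<^sub>2 F"
    using Lnorm_frac_maximal[OF s_pos p(2) \<epsilon>] by blast
  obtain c3 :: real where c3: "0 \<le> c3" "\<And>F. F \<in> borel_measurable lebesgue \<Longrightarrow>
      Lp p (frac_maximal s \<epsilon> F) \<le> ennreal c3 * Lp p F"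
    using Lnorm_frac_maximal[OF s_pos p(4) \<epsilon>] by blast
  show ?thesis
  proof (rule that[of "4 * ((4 * (1 + c1)) * (4 * (1 + c2)) + c3)"])
    show "0 \<le> 4 * ((4 * (1 + c1)) * (4 * (1 + c2)) + c3)" using c1(1) c2(1) c3(1) by simp
    fix F G :: "real^'d \<Rightarrow> ennreal"
    assume [measurable]: "F \<in> borel_measurable lebesgue" "G \<in> borel_measurable lebesgue"
    note [measurable] = frac_maximal_measurable[OF s_pos]
    define n1 n2 where "n1 = Lp p\<^sub>1 F" and "n2 = Lp p\<^sub>2 G"
    have Y1: "Lp p\<^sub>1 (\<lambda>x. F x + frac_maximal s \<epsilon> F x) \<le> ennreal (4 * (1 + c1)) * n1"
    proof -
      have "Lp p\<^sub>1 (\<lambda>x. F x + frac_maximal s \<epsilon> F x) \<le> 4 * (n1 + Lp p\<^sub>1 (frac_maximal s \<epsilon> F))"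
        unfolding n1_def using p by (intro Lnorm_real_add) measurable
      also have "\<dots> \<le> 4 * (n1 + ennreal c1 * n1)"
        unfolding n1_def by (intro mult_left_mono add_left_mono c1(2)) auto
      finally show ?thesis using c1(1) by (simp add: ennreal_mult distrib_right mult.assoc)
    qed
    have Y2: "Lp p\<^sub>2 (\<lambda>x. G x + frac_maximal s \<epsilon> G x) \<le> ennreal (4 * (1 + c2)) * n2"
    proof -
      have "Lp p\<^sub>2 (\<lambda>x. G x + frac_maximal s \<epsilon> G x) \<le> 4 * (n2 + Lp p\<^sub>2 (frac_maximal s \<epsilon> G))"
        unfolding n2_def using p by (intro Lnorm_real_add) measurable
      also have "\<dots> \<le> 4 * (n2 + ennreal c2 * n2)"
        unfolding n2_def by (intro mult_left_mono add_left_mono c2(2)) auto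
      finally show ?thesis using c2(1) by (simp add: ennreal_mult distrib_right mult.assoc)
    qed
    have "Lp p (product_majorant s \<epsilon> F G)
      \<le> 4 * (Lp p (\<lambda>x. (F x + frac_maximal s \<epsilon> F x) * (G x + frac_maximal s \<epsilon> G x)) + Lp p (frac_maximal s \<epsilon> (\<lambda>y. F y * G y)))"
      unfolding product_majorant_def[abs_def] using p by (intro Lnorm_real_add) measurable
    also have "\<dots> \<le> 4 * ((ennreal (4 * (1 + c1)) * n1) * (ennreal (4 * (1 + c2)) * n2) + ennreal c3 * (n1 * n2))"
    proof (intro mult_left_mono[of _ _ "4::ennreal"] add_mono)
      have "Lp p (\<lambda>x. (F x + frac_maximal s \<epsilon> F x) * (G x + frac_maximal s \<epsilon> G x))
        \<le> Lp p\<^sub>1 (\<lambda>x. F x + frac_maximal s \<epsilon> F x) * Lp p\<^sub>2 (\<lambda>x. G x + frac_maximal s \<epsilon> G x)"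
        by (rule Lnorm_real_Holder[OF p(1,2,3)]) measurable
      also have "\<dots> \<le> (ennreal (4 * (1 + c1)) * n1) * (ennreal (4 * (1 + c2)) * n2)"
        by (intro mult_mono Y1 Y2) auto
      finally show "Lp p (\<lambda>x. (F x + frac_maximal s \<epsilon> F x) * (G x + frac_maximal s \<epsilon> G x)) \<le> (ennreal (4 * (1 + c1)) * n1) * (ennreal (4 * (1 + c2)) * n2)" .
      have "Lp p (frac_maximal s \<epsilon> (\<lambda>y. F y * G y)) \<le> ennreal c3 * Lp p (\<lambda>y. F y * G y)"
        by (rule c3(2)) measurable
      also have "\<dots> \<le> ennreal c3 * (n1 * n2)"
        unfolding n1_def n2_def by (intro mult_left_mono Lnorm_real_Holder[OF p(1,2,3)]) auto
      finally show "Lp p (frac_maximal s \<epsilon> (\<lambda>y. F y * G y)) \<le> ennreal c3 * (n1 * n2)" .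
    qed auto
    also have "\<dots> = 4 * ((ennreal (4 * (1 + c1)) * ennreal (4 * (1 + c2)) + ennreal c3) * (n1 * n2))"
    proof -
      have "(a * n1) * (b * n2) + c * (n1 * n2) = (a * b + c) * (n1 * n2)" for a b c :: ennreal
        by (simp only: distrib_right) (simp only: mult_ac)
      then show ?thesis by simp
    qed
    also have "\<dots> = (ennreal 4 * (ennreal (4 * (1 + c1)) * ennreal (4 * (1 + c2)) + ennreal c3)) * (n1 * n2)"
      by (simp only: mult.assoc ennreal_numeral)
    also have "ennreal 4 * (ennreal (4 * (1 + c1)) * ennreal (4 * (1 + c2)) + ennreal c3) = ennreal (4 * ((4 * (1 + c1)) * (4 * (1 + c2)) + c3))"
    proof -
      have "ennreal (4 * (1 + c1)) * ennreal (4 * (1 + c2)) + ennreal c3 = ennreal ((4 * (1 + c1)) * (4 * (1 + c2)) + c3)"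
        using c1(1) c2(1) c3(1) ennreal_mult[of "4 * (1 + c1)" "4 * (1 + c2)"]
          ennreal_plus[of "(4 * (1 + c1)) * (4 * (1 + c2))" c3] by simp
      then show ?thesis
        using c1(1) c2(1) c3(1) ennreal_mult[of 4 "(4 * (1 + c1)) * (4 * (1 + c2)) + c3"] by simp
    qed
    finally show "Lp p (product_majorant s \<epsilon> F G)
      \<le> ennreal (4 * ((4 * (1 + c1)) * (4 * (1 + c2)) + c3)) * (Lp p\<^sub>1 F * Lp p\<^sub>2 G)"
      unfolding n1_def n2_def .
  qed
qed

context model_prod
begin

text \<open>Averaging the previous estimate over \<open>y\<close> gives, at the scale \<open>dyadic n\<close>, dyadic increments of \<open>f\<close>
and \<open>g\<close>, whose \<open>\<ell>\<^sup>q\<close> norms are part of the control functions, and averages of products of control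
functions.  The spare power \<open>\<delta> = 2 * \<epsilon>\<close> is spent in equal parts on bounding these averages
uniformly in the scale and on the convergence of the \<open>\<ell>\<^sup>q\<close> norm.\<close>

lemma Lnorm_mean_increment_product:
  assumes q1: "1 \<le> q\<^sub>1" and q2: "1 \<le> q\<^sub>2" and q: "q = max q\<^sub>1 q\<^sub>2"
  obtains C \<epsilon> :: real where "0 < C" "0 < \<epsilon>"
    "\<And>f g x \<zeta>. factor1 f \<Longrightarrow> factor2 g \<Longrightarrow> \<zeta> < \<gamma> \<Longrightarrow>
      Lnorm q scale_measure01 (mean_increment R s \<Gamma> \<gamma> \<zeta> (prd f g) x) \<le> ennreal C *
        product_majorant s \<epsilon> (control \<gamma>\<^sub>1 q\<^sub>1 f) (control \<gamma>\<^sub>2 q\<^sub>2 g) x"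
proof -
  obtain C \<delta> :: real where C: "0 \<le> C" "0 < \<delta>"
    "\<And>f g x y l n \<zeta>. factor1 f \<Longrightarrow> factor2 g \<Longrightarrow> l \<in> dyadic n \<Longrightarrow> snorm s (y - x) \<le> 4 * l \<Longrightarrow> \<zeta> < \<gamma> \<Longrightarrow>
      ennreal (l powr (\<zeta> - \<gamma>)) * incr (prd f g) \<zeta> x y \<le> ennreal C *
      (weighted_incr \<gamma>\<^sub>1 f l x y * control \<gamma>\<^sub>2 q\<^sub>2 g x + control \<gamma>\<^sub>1 q\<^sub>1 f x * weighted_incr \<gamma>\<^sub>2 g l x y
        + ennreal (l powr \<delta>) * ((control \<gamma>\<^sub>1 q\<^sub>1 f x + control \<gamma>\<^sub>1 q\<^sub>1 f y) * (control \<gamma>\<^sub>2 q\<^sub>2 g x + control \<gamma>\<^sub>2 q\<^sub>2 g y)))"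
    using product_increment[OF q1 q2] by blast
  define \<epsilon> where "\<epsilon> = \<delta> / 2"
  have \<epsilon>: "0 < \<epsilon>" using C by (simp add: \<epsilon>_def)
  define c :: real where "c = 1 / (1 - (1/2) powr \<epsilon>)"
  have c: "0 \<le> c" using powr01_less_one[of "1/2" \<epsilon>] \<epsilon> by (simp add: c_def)
  have q1q: "1 \<le> q" "q\<^sub>1 \<le> q" "q\<^sub>2 \<le> q" using q q1 by (auto simp: le_max_iff_disj)
  show ?thesis
  proof (rule that[of "(C + 1) * (20 + 16 * c)" \<epsilon>])
    show "0 < (C + 1) * (20 + 16 * c)" "0 < \<epsilon>" using C(1) c \<epsilon> by (auto intro!: mult_pos_pos)
    fix f g x \<zeta> assume f: "factor1 f" and g: "factor2 g" and \<zeta>: "\<zeta> < \<gamma>"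
    define Hf Hg where "Hf = control \<gamma>\<^sub>1 q\<^sub>1 f" and "Hg = control \<gamma>\<^sub>2 q\<^sub>2 g"
    have Hm[measurable]: "Hf \<in> borel_measurable lebesgue" "Hg \<in> borel_measurable lebesgue"
      unfolding Hf_def Hg_def using control_measurable factor1D(1)[OF f] factor2D(1)[OF g] by auto
    have pm: "measurable_dist \<gamma> (prd f g)" by (rule trunc_product_measurable[OF f g])
    have [measurable]: "incr (prd f g) \<zeta> x \<in> borel_measurable lebesgue" by (rule incr_measurable[OF pm])
    define MM where "MM = frac_maximal s \<epsilon>"
    define K where "K = Hf x * Hg x + Hf x * MM Hg x + Hg x * MM Hf x + MM (\<lambda>y. Hf y * Hg y) x"
    define w where "w n = ennreal (((1/2)^n) powr \<epsilon>)" for n :: nat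
    define t where "t n = dyadic_total \<gamma>\<^sub>1 f n x * Hg x + (Hf x * dyadic_total \<gamma>\<^sub>2 g n x + K * w n)" for n
    have bound: "mean_increment R s \<Gamma> \<gamma> \<zeta> (prd f g) x l \<le> ennreal C * t n" if l: "l \<in> dyadic n" for n l
    proof -
      have l01: "0 < l" "l \<le> (1/2)^n" using l dyadic_subset[of n] by (auto simp: dyadic_def)
      note avg = ball_avg_add[OF s_pos l01(1)] ball_avg_cmult[OF s_pos l01(1)] ball_avg_const[OF s_pos l01(1)]
      define U1 U2 where "U1 = weighted_incr \<gamma>\<^sub>1 f l x" and "U2 = weighted_incr \<gamma>\<^sub>2 g l x"
      have [measurable]: "U1 \<in> borel_measurable lebesgue" "U2 \<in> borel_measurable lebesgue"
        unfolding U1_def U2_def using weighted_incr_measurable factor1D(1)[OF f] factor2D(1)[OF g] by auto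
      have "snorm s (x - x) \<le> 4 * l" using l01 snorm_le_iff[OF s_pos, of "4 * l" 0] by simp
      then have U1: "ball_avg s l U1 x \<le> dyadic_total \<gamma>\<^sub>1 f n x" and U2: "ball_avg s l U2 x \<le> dyadic_total \<gamma>\<^sub>2 g n x"
        unfolding U1_def U2_def
        using weighted_incr_avg_le[OF factor1D(1)[OF f] l] weighted_incr_avg_le[OF factor2D(1)[OF g] l] by auto
      define Z where "Z y = (Hf x + Hf y) * (Hg x + Hg y)" for y
      have [measurable]: "Z \<in> borel_measurable lebesgue" unfolding Z_def[abs_def] by measurable
      \<comment> \<open>one factor \<open>w n\<close> of \<open>l powr \<delta>\<close> turns the averages into maximal functions, the other one remains\<close>
      have Zavg: "ennreal (l powr \<delta>) * ball_avg s l Z x \<le> K * w n"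
      proof -
        have w1: "w n \<le> 1"
          using \<epsilon> unfolding w_def by (auto intro!: powr_le1 power_le_one)
        have MMge: "w n * ball_avg s l H x \<le> MM H x" for H
          unfolding w_def MM_def by (rule frac_maximal_ge[OF s_pos l])
        have "Z = (\<lambda>y. Hf x * Hg x + (Hf x * Hg y + (Hg x * Hf y + Hf y * Hg y)))"
          by (auto simp: Z_def distrib_left distrib_right mult_ac add_ac)
        then have "ball_avg s l Z x = Hf x * Hg x + (Hf x * ball_avg s l Hg x + (Hg x * ball_avg s l Hf x + ball_avg s l (\<lambda>y. Hf y * Hg y) x))"
          by (simp add: avg)
        then have "w n * ball_avg s l Z x = w n * (Hf x * Hg x) + Hf x * (w n * ball_avg s l Hg x) + Hg x * (w n * ball_avg s l Hf x) + w n * ball_avg s l (\<lambda>y. Hf y * Hg y) x"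
          by (simp add: distrib_left mult_ac add_ac)
        also have "\<dots> \<le> 1 * (Hf x * Hg x) + Hf x * MM Hg x + Hg x * MM Hf x + MM (\<lambda>y. Hf y * Hg y) x"
          by (intro add_mono mult_left_mono mult_right_mono MMge w1) auto
        finally have wZ: "w n * ball_avg s l Z x \<le> K" by (simp add: K_def)
        have "l powr \<delta> \<le> ((1/2)^n) powr \<delta>" using l01 C(2) by (intro powr_mono2) auto
        also have "\<dots> = ((1/2)^n) powr \<epsilon> * ((1/2)^n) powr \<epsilon>" by (simp add: \<epsilon>_def powr_add[symmetric])
        finally have "ennreal (l powr \<delta>) \<le> w n * w n"
          unfolding w_def by (subst ennreal_mult[symmetric]) (auto intro: ennreal_leI)
        then have "ennreal (l powr \<delta>) * ball_avg s l Z x \<le> (w n * w n) * ball_avg s l Z x" by (rule mult_right_mono) simp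
        also have "\<dots> = (w n * ball_avg s l Z x) * w n" by (simp add: mult_ac)
        also have "\<dots> \<le> K * w n" by (intro mult_right_mono wZ) simp
        finally show ?thesis .
      qed
      have "mean_increment R s \<Gamma> \<gamma> \<zeta> (prd f g) x l = ball_avg s l (\<lambda>y. ennreal (l powr (\<zeta> - \<gamma>)) * incr (prd f g) \<zeta> x y) x"
        by (simp add: avg mean_increment_eq[OF pm l01(1)])
      also have "\<dots> \<le> ball_avg s l (\<lambda>y. ennreal C * (Hg x * U1 y + Hf x * U2 y + ennreal (l powr \<delta>) * Z y)) x"
      proof (rule ball_avg_mono[OF s_pos l01(1)])
        fix y assume "y \<in> sball s x (4 * l)"
        then have "snorm s (y - x) \<le> 4 * l" by (simp add: mem_sball)
        from C(3)[OF f g l this \<zeta>]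
        show "ennreal (l powr (\<zeta> - \<gamma>)) * incr (prd f g) \<zeta> x y \<le> ennreal C * (Hg x * U1 y + Hf x * U2 y + ennreal (l powr \<delta>) * Z y)"
          by (simp add: U1_def U2_def Z_def Hf_def Hg_def mult.commute)
      qed
      also have "\<dots> = ennreal C * (Hg x * ball_avg s l U1 x + Hf x * ball_avg s l U2 x + ennreal (l powr \<delta>) * ball_avg s l Z x)"
        by (simp add: avg)
      also have "\<dots> \<le> ennreal C * (Hg x * dyadic_total \<gamma>\<^sub>1 f n x + Hf x * dyadic_total \<gamma>\<^sub>2 g n x + K * w n)"
        by (intro mult_left_mono add_mono U1 U2 Zavg) auto
      finally show ?thesis by (simp add: t_def mult.commute add.assoc)
    qed
    have "Lnorm q scale_measure01 (mean_increment R s \<Gamma> \<gamma> \<zeta> (prd f g) x) \<le> lq_norm q (\<lambda>n. ennreal C * t n)"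
      by (rule Lnorm_scale_le_lq_norm[OF q1q(1) mean_increment_measurable[OF pm] bound])
    also have "\<dots> = ennreal C * lq_norm q t" by (rule lq_norm_cmult[OF q1q(1)])
    also have "lq_norm q t \<le> 4 * (lq_norm q (\<lambda>n. dyadic_total \<gamma>\<^sub>1 f n x * Hg x) + 4 * (lq_norm q (\<lambda>n. Hf x * dyadic_total \<gamma>\<^sub>2 g n x) + lq_norm q (\<lambda>n. K * w n)))"
      unfolding t_def[abs_def]
      by (rule order_trans[OF lq_norm_add[OF q1q(1)]]) (intro mult_left_mono add_left_mono lq_norm_add q1q, auto)
    also have "\<dots> \<le> 4 * (Hf x * Hg x + 4 * (Hf x * Hg x + K * ennreal c))"
    proof (intro mult_left_mono add_mono)
      have "lq_norm q (\<lambda>n. dyadic_total \<gamma>\<^sub>1 f n x) \<le> lq_norm q\<^sub>1 (\<lambda>n. dyadic_total \<gamma>\<^sub>1 f n x)"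
        by (rule lq_norm_antimono[OF q1 q1q(2)])
      also have "\<dots> \<le> Hf x" by (simp add: Hf_def control_def add_increasing)
      finally show "lq_norm q (\<lambda>n. dyadic_total \<gamma>\<^sub>1 f n x * Hg x) \<le> Hf x * Hg x"
        using lq_norm_cmult[OF q1q(1), of "Hg x" "\<lambda>n. dyadic_total \<gamma>\<^sub>1 f n x"] by (simp add: mult.commute[of _ "Hg x"] mult_left_mono)
      have "lq_norm q (\<lambda>n. dyadic_total \<gamma>\<^sub>2 g n x) \<le> lq_norm q\<^sub>2 (\<lambda>n. dyadic_total \<gamma>\<^sub>2 g n x)"
        by (rule lq_norm_antimono[OF q2 q1q(3)])
      also have "\<dots> \<le> Hg x" by (simp add: Hg_def control_def add_increasing)
      finally show "lq_norm q (\<lambda>n. Hf x * dyadic_total \<gamma>\<^sub>2 g n x) \<le> Hf x * Hg x"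
        using lq_norm_cmult[OF q1q(1), of "Hf x" "\<lambda>n. dyadic_total \<gamma>\<^sub>2 g n x"] by (simp add: mult_left_mono)
      show "lq_norm q (\<lambda>n. K * w n) \<le> K * ennreal c"
        using lq_norm_cmult[OF q1q(1), of K w] lq_norm_geometric[OF q1q(1) \<epsilon>]
        by (simp add: w_def[abs_def] c_def mult_left_mono)
    qed auto
    also have "\<dots> \<le> 4 * (X + 4 * (X + X * ennreal c))"
      if X: "X = (Hf x + MM Hf x) * (Hg x + MM Hg x) + MM (\<lambda>y. Hf y * Hg y) x" for X
    proof -
      have "K = Hf x * (Hg x + MM Hg x) + MM Hf x * Hg x + MM (\<lambda>y. Hf y * Hg y) x"
        by (simp add: K_def distrib_left mult.commute add_ac)
      also have "\<dots> \<le> Hf x * (Hg x + MM Hg x) + MM Hf x * (Hg x + MM Hg x) + MM (\<lambda>y. Hf y * Hg y) x"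
        by (intro add_mono mult_left_mono order_refl) (auto simp: add_increasing2)
      also have "\<dots> = X" unfolding X by (simp add: distrib_right)
      finally have KX: "K \<le> X" .
      have "Hf x * Hg x \<le> (Hf x + MM Hf x) * (Hg x + MM Hg x)" by (intro mult_mono) (auto simp: add_increasing2)
      also have "\<dots> \<le> X" unfolding X by (simp add: add_increasing2)
      finally have "Hf x * Hg x \<le> X" .
      then show ?thesis by (intro mult_left_mono add_mono mult_right_mono KX) auto
    qed
    finally have fin: "Lnorm q scale_measure01 (mean_increment R s \<Gamma> \<gamma> \<zeta> (prd f g) x) \<le> ennreal C * (4 * (X + 4 * (X + X * ennreal c)))"
      if "X = (Hf x + MM Hf x) * (Hg x + MM Hg x) + MM (\<lambda>y. Hf y * Hg y) x" for X
      using that by (simp add: mult_left_mono)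
    define X where "X = (Hf x + MM Hf x) * (Hg x + MM Hg x) + MM (\<lambda>y. Hf y * Hg y) x"
    have "4 * (X + 4 * (X + X * ennreal c)) = (4 * (1 + 4 * (1 + ennreal c))) * X"
      by (simp only: distrib_left distrib_right mult_ac mult_1_left mult_1_right)
    also have "4 * (1 + 4 * (1 + ennreal c)) = ennreal (20 + 16 * c)"
      using c by (simp add: ennreal_mult distrib_left)
    finally have "Lnorm q scale_measure01 (mean_increment R s \<Gamma> \<gamma> \<zeta> (prd f g) x) \<le> ennreal C * (ennreal (20 + 16 * c) * X)"
      using fin[OF X_def] by simp
    also have "\<dots> \<le> ennreal (C + 1) * (ennreal (20 + 16 * c) * X)"
      by (intro mult_right_mono ennreal_leI) auto
    also have "\<dots> = ennreal ((C + 1) * (20 + 16 * c)) * X"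
      using C(1) c by (simp add: ennreal_mult mult.assoc del: ennreal_plus)
    finally show "Lnorm q scale_measure01 (mean_increment R s \<Gamma> \<gamma> \<zeta> (prd f g) x) \<le> ennreal ((C + 1) * (20 + 16 * c)) *
        product_majorant s \<epsilon> (control \<gamma>\<^sub>1 q\<^sub>1 f) (control \<gamma>\<^sub>2 q\<^sub>2 g) x"
      unfolding X_def Hf_def Hg_def MM_def product_majorant_def .
  qed
qed

lemma hsize_product_le:
  obtains K :: real where "0 \<le> K"
    "\<And>f g x \<zeta> q\<^sub>1 q\<^sub>2. factor1 f \<Longrightarrow> factor2 g \<Longrightarrow>
      esize \<zeta> (prd f g x) \<le> ennreal K * (control \<gamma>\<^sub>1 q\<^sub>1 f x * control \<gamma>\<^sub>2 q\<^sub>2 g x)"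
proof -
  obtain K where K: "star_bounded \<gamma>\<^sub>1 \<gamma>\<^sub>2 K" using star_bounded_ex by blast
  show ?thesis
  proof (rule that[of K])
    show "0 \<le> K" using K by (simp add: star_bounded_def)
    fix f g x \<zeta> q\<^sub>1 q\<^sub>2 assume f: "factor1 f" and g: "factor2 g"
    have "esize \<zeta> (prd f g x) \<le> 1 * esize \<zeta> (f x \<star> g x)"
      using hsize_nonneg by (simp add: hsize_def trunc_product_def hproj_truncate N_zero)
    also have "\<dots> \<le> ennreal K * ((\<Sum>a\<in>below \<gamma>\<^sub>1. esize a (f x)) * (\<Sum>b\<in>below \<gamma>\<^sub>2. esize b (g x)))"
      by (rule esize_star[OF K factor1D(2,4)[OF f] factor2D(2,4)[OF g]]) simp
    also have "\<dots> = ennreal K * (ennreal (total \<gamma>\<^sub>1 (f x)) * ennreal (total \<gamma>\<^sub>2 (g x)))"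
      by (simp add: total_def sum_ennreal hsize_nonneg)
    also have "\<dots> \<le> ennreal K * (control \<gamma>\<^sub>1 q\<^sub>1 f x * control \<gamma>\<^sub>2 q\<^sub>2 g x)"
      by (intro mult_left_mono mult_mono total_le_control) auto
    finally show "esize \<zeta> (prd f g x) \<le> \<dots>" .
  qed
qed

lemma F_norm_product:
  assumes p: "1 \<le> p\<^sub>1" "1 \<le> p\<^sub>2" "p = p\<^sub>1 * p\<^sub>2 / (p\<^sub>1 + p\<^sub>2)" "1 \<le> p"
    and q: "1 \<le> q\<^sub>1" "1 \<le> q\<^sub>2" "q = max q\<^sub>1 q\<^sub>2"
  obtains C :: real where
    "\<And>f g. factor1 f \<Longrightarrow> factor2 g \<Longrightarrow> F_norm R s \<Gamma> \<gamma> (ennreal p) q (prd f g)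
      \<le> ennreal C * F_norm R s \<Gamma> \<gamma>\<^sub>1 (ennreal p\<^sub>1) q\<^sub>1 f * F_norm R s \<Gamma> \<gamma>\<^sub>2 (ennreal p\<^sub>2) q\<^sub>2 g"
proof -
  obtain C1 :: real where C1: "0 \<le> C1" "\<And>f. measurable_dist \<gamma>\<^sub>1 f \<Longrightarrow>
      Lp p\<^sub>1 (control \<gamma>\<^sub>1 q\<^sub>1 f) \<le> ennreal C1 * F_norm R s \<Gamma> \<gamma>\<^sub>1 (ennreal p\<^sub>1) q\<^sub>1 f"
    using Lnorm_control[OF p(1) q(1)] by blast
  obtain C2 :: real where C2: "0 \<le> C2" "\<And>f. measurable_dist \<gamma>\<^sub>2 f \<Longrightarrow>
      Lp p\<^sub>2 (control \<gamma>\<^sub>2 q\<^sub>2 f) \<le> ennreal C2 * F_norm R s \<Gamma> \<gamma>\<^sub>2 (ennreal p\<^sub>2) q\<^sub>2 f"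
    using Lnorm_control[OF p(2) q(2)] by blast
  obtain C3 \<epsilon> :: real where C3: "0 < C3" "0 < \<epsilon>"
    "\<And>f g x \<zeta>. factor1 f \<Longrightarrow> factor2 g \<Longrightarrow> \<zeta> < \<gamma> \<Longrightarrow>
      Lnorm q scale_measure01 (mean_increment R s \<Gamma> \<gamma> \<zeta> (prd f g) x) \<le> ennreal C3 *
        product_majorant s \<epsilon> (control \<gamma>\<^sub>1 q\<^sub>1 f) (control \<gamma>\<^sub>2 q\<^sub>2 g) x"
    using Lnorm_mean_increment_product[OF q] by blast
  obtain C4 :: real where C4: "0 \<le> C4"
    "\<And>F G. F \<in> borel_measurable lebesgue \<Longrightarrow> G \<in> borel_measurable lebesgue \<Longrightarrow>
      Lp p (product_majorant s \<epsilon> F G)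
      \<le> ennreal C4 * (Lp p\<^sub>1 F * Lp p\<^sub>2 G)"
    using Lnorm_product_majorant[OF s_pos p C3(2)] by blast
  obtain K where K: "0 \<le> K" "\<And>f g x \<zeta> q\<^sub>1 q\<^sub>2. factor1 f \<Longrightarrow> factor2 g \<Longrightarrow>
      ennreal (hsize R \<zeta> (prd f g x)) \<le> ennreal K * (control \<gamma>\<^sub>1 q\<^sub>1 f x * control \<gamma>\<^sub>2 q\<^sub>2 g x)"
    using hsize_product_le by blast
  have p0: "0 < p" using p by simp
  show ?thesis
  proof (rule that[of "(K + C3 * C4) * (C1 * C2)"])
    fix f g assume f: "factor1 f" and g: "factor2 g"
    define Hf Hg where "Hf = control \<gamma>\<^sub>1 q\<^sub>1 f" and "Hg = control \<gamma>\<^sub>2 q\<^sub>2 g"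
    have [measurable]: "Hf \<in> borel_measurable lebesgue" "Hg \<in> borel_measurable lebesgue"
      unfolding Hf_def Hg_def using control_measurable factor1D(1)[OF f] factor2D(1)[OF g] by auto
    note [measurable] = product_majorant_measurable[OF s_pos]
    define n where "n = Lp p\<^sub>1 Hf * Lp p\<^sub>2 Hg"
    have size: "Lp p (\<lambda>x. ennreal (hsize R \<zeta> (prd f g x))) \<le> ennreal K * n" for \<zeta>
    proof -
      have "Lp p (\<lambda>x. ennreal (hsize R \<zeta> (prd f g x))) \<le> Lp p (\<lambda>x. ennreal K * (Hf x * Hg x))"
        unfolding Hf_def Hg_def by (intro Lnorm_real_mono p0 K(2) f g)
      also have "\<dots> = ennreal K * Lp p (\<lambda>x. Hf x * Hg x)"
        by (rule Lnorm_real_cmult[OF p0]) measurable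
      also have "\<dots> \<le> ennreal K * n"
        unfolding n_def by (intro mult_left_mono Lnorm_real_Holder[OF p(1,2,3)]) auto
      finally show ?thesis .
    qed
    have incr: "Lp p (\<lambda>x. Lnorm q scale_measure01 (mean_increment R s \<Gamma> \<gamma> \<zeta> (prd f g) x)) \<le> ennreal (C3 * C4) * n"
      if "\<zeta> < \<gamma>" for \<zeta>
    proof -
      have "Lp p (\<lambda>x. Lnorm q scale_measure01 (mean_increment R s \<Gamma> \<gamma> \<zeta> (prd f g) x))
        \<le> Lp p (\<lambda>x. ennreal C3 * product_majorant s \<epsilon> Hf Hg x)"
        unfolding Hf_def Hg_def by (intro Lnorm_real_mono p0 C3(3) f g that)
      also have "\<dots> = ennreal C3 * Lp p (product_majorant s \<epsilon> Hf Hg)"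
        by (rule Lnorm_real_cmult[OF p0]) measurable
      also have "\<dots> \<le> ennreal C3 * (ennreal C4 * n)"
        unfolding n_def by (intro mult_left_mono C4(2)) auto
      finally show ?thesis using C3(1) C4(1) by (simp add: ennreal_mult mult.assoc)
    qed
    have "F_norm R s \<Gamma> \<gamma> (ennreal p) q (prd f g) \<le> ennreal K * n + ennreal (C3 * C4) * n"
      unfolding F_norm_def by (intro add_mono SUP_least size incr) (auto simp: homs_below_def)
    also have "\<dots> = ennreal (K + C3 * C4) * n"
      using K(1) C3(1) C4(1) by (simp add: distrib_right)
    also have "\<dots> \<le> ennreal (K + C3 * C4) * ((ennreal C1 * F_norm R s \<Gamma> \<gamma>\<^sub>1 (ennreal p\<^sub>1) q\<^sub>1 f) * (ennreal C2 * F_norm R s \<Gamma> \<gamma>\<^sub>2 (ennreal p\<^sub>2) q\<^sub>2 g))"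
      unfolding n_def Hf_def Hg_def
      by (intro mult_left_mono mult_mono C1(2) C2(2) factor1D(1)[OF f] factor2D(1)[OF g]) auto
    also have "\<dots> = ennreal ((K + C3 * C4) * (C1 * C2)) * F_norm R s \<Gamma> \<gamma>\<^sub>1 (ennreal p\<^sub>1) q\<^sub>1 f * F_norm R s \<Gamma> \<gamma>\<^sub>2 (ennreal p\<^sub>2) q\<^sub>2 g"
      using K(1) C3(1) C4(1) C1(1) C2(1) by (simp add: ennreal_mult mult_ac del: ennreal_plus)
    finally show "F_norm R s \<Gamma> \<gamma> (ennreal p) q (prd f g) \<le> \<dots>" .
  qed
qed

end

theorem proposition7p3:
  fixes R :: "('t::real_vector) reg_structure"
    and s :: "('d::finite) scaling"
    and \<pi> :: "real^'d \<Rightarrow> 't \<Rightarrow> (real^'d \<Rightarrow> real) \<Rightarrow> real"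
    and \<Gamma> :: "real^'d \<Rightarrow> real^'d \<Rightarrow> 't \<Rightarrow> 't"
    and V W :: "'t set"
    and star :: "'t \<Rightarrow> 't \<Rightarrow> 't"
    and p\<^sub>1 p\<^sub>2 p :: real
    and q\<^sub>1 q\<^sub>2 q :: ennreal
    and \<gamma>\<^sub>1 \<gamma>\<^sub>2 \<gamma> \<alpha>\<^sub>1 \<alpha>\<^sub>2 \<alpha> :: real
  assumes "\<forall>i. 0 < s i"
    and "regularity_structure R"
    and "model R s \<pi> \<Gamma>"
    and "sector R V" and "sector R W"
    and "sector_product R V W star"
    and "1 \<le> p\<^sub>1" and "1 \<le> p\<^sub>2" and "1 \<le> q\<^sub>1" and "1 \<le> q\<^sub>2"
    and "0 < \<gamma>\<^sub>1" and "0 < \<gamma>\<^sub>2"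
    and "\<alpha> = \<alpha>\<^sub>1 + \<alpha>\<^sub>2"
    and "\<gamma> = min (\<gamma>\<^sub>1 + \<alpha>\<^sub>2) (\<gamma>\<^sub>2 + \<alpha>\<^sub>1)"
    and "p = p\<^sub>1 * p\<^sub>2 / (p\<^sub>1 + p\<^sub>2)"
    and "q = max q\<^sub>1 q\<^sub>2"
    and "1 \<le> p" and "0 < \<gamma>"
    and "\<gamma>\<^sub>1 \<notin> homs R" and "\<gamma>\<^sub>2 \<notin> homs R" and "\<gamma> \<notin> homs R"
  shows "\<exists>C::real. \<forall>f g.
    f \<in> F_space_ge R s \<Gamma> \<gamma>\<^sub>1 \<alpha>\<^sub>1 (ennreal p\<^sub>1) q\<^sub>1 \<longrightarrow> (\<forall>x. f x \<in> V) \<longrightarrow>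
    g \<in> F_space_ge R s \<Gamma> \<gamma>\<^sub>2 \<alpha>\<^sub>2 (ennreal p\<^sub>2) q\<^sub>2 \<longrightarrow> (\<forall>x. g x \<in> W) \<longrightarrow>
      trunc_product R star \<gamma> f g \<in> F_space_ge R s \<Gamma> \<gamma> \<alpha> (ennreal p) q \<and>
      F_norm R s \<Gamma> \<gamma> (ennreal p) q (trunc_product R star \<gamma> f g)
        \<le> ennreal C * F_norm R s \<Gamma> \<gamma>\<^sub>1 (ennreal p\<^sub>1) q\<^sub>1 f * F_norm R s \<Gamma> \<gamma>\<^sub>2 (ennreal p\<^sub>2) q\<^sub>2 g"
proof -
  interpret model_prod R s \<pi> \<Gamma> V W star \<gamma>\<^sub>1 \<gamma>\<^sub>2 \<alpha>\<^sub>1 \<alpha>\<^sub>2 \<gamma>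
    using assms by unfold_locales auto
  obtain C :: real where C: "\<And>f g. factor1 f \<Longrightarrow> factor2 g \<Longrightarrow> F_norm R s \<Gamma> \<gamma> (ennreal p) q (prd f g)
      \<le> ennreal C * F_norm R s \<Gamma> \<gamma>\<^sub>1 (ennreal p\<^sub>1) q\<^sub>1 f * F_norm R s \<Gamma> \<gamma>\<^sub>2 (ennreal p\<^sub>2) q\<^sub>2 g"
    using F_norm_product[of p\<^sub>1 p\<^sub>2 p q\<^sub>1 q\<^sub>2 q] assms by blast
  have "prd f g \<in> F_space_ge R s \<Gamma> \<gamma> \<alpha> (ennreal p) q \<and>
      F_norm R s \<Gamma> \<gamma> (ennreal p) q (prd f g)
        \<le> ennreal C * F_norm R s \<Gamma> \<gamma>\<^sub>1 (ennreal p\<^sub>1) q\<^sub>1 f * F_norm R s \<Gamma> \<gamma>\<^sub>2 (ennreal p\<^sub>2) q\<^sub>2 g"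
    if fF: "f \<in> F_space_ge R s \<Gamma> \<gamma>\<^sub>1 \<alpha>\<^sub>1 (ennreal p\<^sub>1) q\<^sub>1" and fV: "\<forall>x. f x \<in> V"
      and gF: "g \<in> F_space_ge R s \<Gamma> \<gamma>\<^sub>2 \<alpha>\<^sub>2 (ennreal p\<^sub>2) q\<^sub>2" and gW: "\<forall>x. g x \<in> W" for f g
  proof -
    have f: "factor1 f" and g: "factor2 g"
      using fF fV gF gW by (auto simp: factor1_def factor2_def measurable_dist_def F_space_ge_def F_space_def)
    have le: "F_norm R s \<Gamma> \<gamma> (ennreal p) q (prd f g)
        \<le> ennreal C * F_norm R s \<Gamma> \<gamma>\<^sub>1 (ennreal p\<^sub>1) q\<^sub>1 f * F_norm R s \<Gamma> \<gamma>\<^sub>2 (ennreal p\<^sub>2) q\<^sub>2 g"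
      by (rule C[OF f g])
    also have "\<dots> < \<infinity>"
      using fF gF by (auto simp: F_space_ge_def F_space_def intro!: ennreal_mult_less_top[THEN iffD2])
    finally have "F_norm R s \<Gamma> \<gamma> (ennreal p) q (prd f g) < \<infinity>" .
    then show ?thesis
      using le trunc_product_measurable[OF f g] trunc_product_ge[OF f g] assms(13)
      by (auto simp: F_space_ge_def F_space_def measurable_dist_def)
  qed
  then show ?thesis by blast
qed

end
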